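(* Let $\{x^k\}_{k\ge 0}$ be generated by the algorithm FWGSC (described in the context) applied to $\min_{x\in\mathcal X}f(x)$, under the standing assumptions listed in the context. For $x^0\in\mathcal X\cap\operatorname{dom}f$ and $\varepsilon>0$, put $h_k=f(x^k)-f^*$ and $N_\varepsilon(x^0)=\inf\{k\ge 0: h_k\le\varepsilon\}$. Then, for all $\varepsilon>0$, $$N_{\varepsilon}(x^{0})\leq \frac{\ln\left(\frac{c_{1}(M_{f},\nu)}{h_{0}\,c_{2}(M_{f},\nu)}\right)}{\ln(1-c_{1}(M_{f},\nu))}+\frac{1}{c_{2}(M_{f},\nu)\,\varepsilon},$$ where $c_1(M,\nu)$, $c_2(M,\nu)$ are the constants defined in the context.
   Context: **Generalized self-concordance (GSC).** For $\nu\in[2,3]$ and $M_f\ge0$, $\mathcal F_{M_f,\nu}$ is the class of closed (lower semicontinuous) convex functions $f:\mathbb R^n\to(-\infty,+\infty]$ with $\operatorname{dom}f=\{f<\infty\}$ open and nonempty, $f$ three times continuously differentiable on $\operatorname{dom}f$, and $|\langle D^3f(x)[v]u,u\rangle|\le M_f\|u\|_x^2\|v\|_x^{\nu-2}\|v\|_2^{3-\nu}$ for all $x\in\operatorname{dom}f$, $u,v\in\mathbb R^n$, where $\|u\|_x=\sqrt{\langle\nabla^2f(x)u,u\rangle}$. **Standing assumptions.** $f\in\mathcal F_{M_f,\nu}$ with $\nu\in[2,3]$; $\mathcal X\subset\mathbb R^n$ is convex and compact, and linear functions can be minimized over it efficiently and accurately; $\min_{x\in\mathcal X}f(x)$ has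 a solution $x^*$, $f^*=f(x^* )$; $\nabla^2f$ is continuous and positive definite on $\mathcal X\cap\operatorname{dom}f$. **Frank-Wolfe quantities** for $x\in\mathcal X\cap\operatorname{dom}f$: $s(x)\in\arg\min_{d\in\mathcal X}\langle\nabla f(x),d\rangle$ (a fixed selection), $\mathsf{Gap}(x)=\max_{s\in\mathcal X}\langle\nabla f(x),x-s\rangle$, $v_{FW}(x)=s(x)-x$, $e(x)=\|v_{FW}(x)\|_x$, $\beta(x)=\|v_{FW}(x)\|_2$; $\delta_2(x)=\beta(x)$ and $\delta_\nu(x)=\frac{\nu-2}{2}\beta(x)^{3-\nu}e(x)^{\nu-2}$ for $\nu\in(2,3]$. **Step size.** $\alpha_{M,\nu}(x)=\min\{1,t_{M,\nu}(x)\}$, where $t_{M,2}(x)=\frac{1}{M\delta_2(x)}\ln\left(1+\frac{\mathsf{Gap}(x)M\delta_2(x)}{e(x)^2}\right)$; $t_{M,\nu}(x)=\frac{1}{M\delta_\nu(x)}\left[1-\left(1+\frac{M\delta_\nu(x)\mathsf{Gap}(x)}{e(x)^2}\frac{4-\nu}{\nu-2}\right)^{-\frac{\nu-2}{4-\nu}}\right]$ for $\nu\in(2,3)$; $t_{M,3}(x)=\frac{\mathsf{Gap}(x)}{M\delta_3(x)\mathsf{Gap}(x)+e(x)^2}$. **Algorithm FWGSC.** Inputs: $x^0\in\mathcal X\cap\operatorname{dom}f$ and an error tolerance $\varepsilon>0$. For $k=0,1,\dots$: if $\mathsf{Gap}(x^k)>\varepsilon$, set $x^{k+1}=x^k+\alpha_kv_{FW}(x^k)$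 with $\alpha_k=\alpha_{M_f,\nu}(x^k)$. **Constants.** $\mathcal S(x^0)=\{x\in\mathcal X\cap\operatorname{dom}f: f(x)\le f(x^0)\}$ (compact), $L_{\nabla f}=\max_{x\in\mathcal S(x^0)}\lambda_{\max}(\nabla^2f(x))$, $D=\operatorname{diam}(\mathcal X)$. For $\nu\in(2,3)$: $\tilde\gamma_\nu=1+\frac{4-\nu}{2(3-\nu)}\left(1-2^{2(3-\nu)/(4-\nu)}\right)$ and $b=\frac{2-\nu}{4-\nu}$. For $(M,\nu)\in(0,\infty)\times[2,3]$: $c_1(M,2)=\min\{\frac12,\frac{2\ln2-1}{MD}\}$; $c_1(M,\nu)=\min\{\frac12,\frac{\tilde\gamma_\nu}{D(\nu/2-1)ML_{\nabla f}^{(\nu-2)/2}}\}$ for $\nu\in(2,3)$; $c_1(M,3)=\min\{\frac12,\frac{2(1-\ln2)}{M\sqrt{L_{\nabla f}}D}\}$; $c_2(M,2)=\frac{2\ln2-1}{L_{\nabla f}D^2}$; $c_2(M,\nu)=\frac{-1}{b}\frac{\tilde\gamma_\nu}{L_{\nabla f}D^2}$ for $\nu\in(2,3)$; $c_2(M,3)=\frac{2(1-\ln2)}{L_{\nabla f}D^2}$.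
   Formalization: The printed bound fails when ε ≥ h_0 (so N_ε = 0) and its right side is negative; it is proved as printed if ε < h_0 or h_0 ≥ c_1/c_2, and for every ε > 0 with right side replaced by max(0, right side). M_f > 0 is assumed, as the constants require. *)

theory Defs
  imports "HOL-Analysis.Analysis"
begin

definition edom :: "(real ^ 'n \<Rightarrow> ereal) \<Rightarrow> (real ^ 'n) set" where
  "edom f = {x. f x < \<infinity>}"

definition proper_closed_convex :: "(real ^ 'n \<Rightarrow> ereal) \<Rightarrow> bool" where
  "proper_closed_convex f \<longleftrightarrow>
     (\<forall>x. f x \<noteq> -\<infinity>) \<and> edom f \<noteq> {} \<and>
     (\<forall>x. f x \<le> Liminf (at x) f) \<and>
     (\<forall>x y. \<forall>t\<in>{0..1}. f ((1 - t) *\<^sub>R x + t *\<^sub>R y) \<le> ereal (1 - t) * f x + ereal t * f y)"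

(* The derivatives below are only meaningful at points of the open set edom f, near which f is
   finite and agrees with real_of_ereal o f. *)

definition gradient :: "(real ^ 'n \<Rightarrow> ereal) \<Rightarrow> real ^ 'n \<Rightarrow> real ^ 'n" where
  "gradient f x = (THE g. GDERIV (\<lambda>y. real_of_ereal (f y)) x :> g)"

definition hessian :: "(real ^ 'n \<Rightarrow> ereal) \<Rightarrow> real ^ 'n \<Rightarrow> real ^ 'n ^ 'n" where
  "hessian f x = matrix (frechet_derivative (gradient f) (at x))"

(* third_deriv f x v is the matrix D^3 f(x)[v], the derivative of the Hessian in direction v. *)
definition third_deriv :: "(real ^ 'n \<Rightarrow> ereal) \<Rightarrow> real ^ 'n \<Rightarrow> real ^ 'n \<Rightarrow> real ^ 'n ^ 'n" where
  "third_deriv f x v = frechet_derivative (hessian f) (at x) v"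

definition C3_on_edom :: "(real ^ 'n \<Rightarrow> ereal) \<Rightarrow> bool" where
  "C3_on_edom f \<longleftrightarrow>
     (\<forall>x\<in>edom f. (\<lambda>y. real_of_ereal (f y)) differentiable (at x) \<and>
                 gradient f differentiable (at x) \<and>
                 hessian f differentiable (at x)) \<and>
     (\<forall>v. continuous_on (edom f) (\<lambda>x. third_deriv f x v))"

definition local_norm :: "(real ^ 'n \<Rightarrow> ereal) \<Rightarrow> real ^ 'n \<Rightarrow> real ^ 'n \<Rightarrow> real" where
  "local_norm f x u = sqrt ((hessian f x *v u) \<bullet> u)"

(* Real power with 0^0 = 1 (in contrast to 0 powr 0 = 0). This matters for nu = 2, where the
   factor (local_norm f x v)^(nu - 2) has to be absent even if the Hessian is degenerate. *)
definition rpow :: "real \<Rightarrow> real \<Rightarrow> real" where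
  "rpow a p = (if p = 0 then 1 else a powr p)"

definition gsc_class :: "real \<Rightarrow> real \<Rightarrow> (real ^ 'n \<Rightarrow> ereal) set" where
  "gsc_class M \<nu> = {f. proper_closed_convex f \<and> open (edom f) \<and> C3_on_edom f \<and>
     (\<forall>x\<in>edom f. \<forall>u v.
        \<bar>(third_deriv f x v *v u) \<bullet> u\<bar>
          \<le> M * (local_norm f x u)\<^sup>2 * rpow (local_norm f x v) (\<nu> - 2) * rpow (norm v) (3 - \<nu>))}"

definition pos_def :: "real ^ 'n ^ 'n \<Rightarrow> bool" where
  "pos_def A \<longleftrightarrow> (\<forall>v. v \<noteq> 0 \<longrightarrow> (A *v v) \<bullet> v > 0)"

(* Only used for symmetric matrices, whose set of real eigenvalues is finite and nonempty. *)
definition lambda_max :: "real ^ 'n ^ 'n \<Rightarrow> real" where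
  "lambda_max A = Sup {l. \<exists>v. v \<noteq> 0 \<and> A *v v = l *\<^sub>R v}"

definition linear_minimizer ::
    "(real ^ 'n \<Rightarrow> ereal) \<Rightarrow> (real ^ 'n) set \<Rightarrow> (real ^ 'n \<Rightarrow> real ^ 'n) \<Rightarrow> bool" where
  "linear_minimizer f X s \<longleftrightarrow>
     (\<forall>x \<in> X \<inter> edom f. is_arg_min (\<lambda>d. gradient f x \<bullet> d) (\<lambda>d. d \<in> X) (s x))"

definition Gap :: "(real ^ 'n \<Rightarrow> ereal) \<Rightarrow> (real ^ 'n) set \<Rightarrow> real ^ 'n \<Rightarrow> real" where
  "Gap f X x = (SUP d\<in>X. gradient f x \<bullet> (x - d))"

definition v_FW :: "(real ^ 'n \<Rightarrow> real ^ 'n) \<Rightarrow> real ^ 'n \<Rightarrow> real ^ 'n" where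
  "v_FW s x = s x - x"

definition e_FW :: "(real ^ 'n \<Rightarrow> ereal) \<Rightarrow> (real ^ 'n \<Rightarrow> real ^ 'n) \<Rightarrow> real ^ 'n \<Rightarrow> real" where
  "e_FW f s x = local_norm f x (v_FW s x)"

definition beta_FW :: "(real ^ 'n \<Rightarrow> real ^ 'n) \<Rightarrow> real ^ 'n \<Rightarrow> real" where
  "beta_FW s x = norm (v_FW s x)"

definition delta_FW ::
    "(real ^ 'n \<Rightarrow> ereal) \<Rightarrow> (real ^ 'n \<Rightarrow> real ^ 'n) \<Rightarrow> real \<Rightarrow> real ^ 'n \<Rightarrow> real" where
  "delta_FW f s \<nu> x =
     (if \<nu> = 2 then beta_FW s x
      else (\<nu> - 2) / 2 * rpow (beta_FW s x) (3 - \<nu>) * rpow (e_FW f s x) (\<nu> - 2))"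

definition t_FW ::
    "(real ^ 'n \<Rightarrow> ereal) \<Rightarrow> (real ^ 'n) set \<Rightarrow> (real ^ 'n \<Rightarrow> real ^ 'n) \<Rightarrow>
     real \<Rightarrow> real \<Rightarrow> real ^ 'n \<Rightarrow> real" where
  "t_FW f X s M \<nu> x =
     (let \<delta> = delta_FW f s \<nu> x; g = Gap f X x; e = e_FW f s x in
      if \<nu> = 2 then 1 / (M * \<delta>) * ln (1 + g * M * \<delta> / e\<^sup>2)
      else if \<nu> = 3 then g / (M * \<delta> * g + e\<^sup>2)
      else 1 / (M * \<delta>) *
             (1 - (1 + M * \<delta> * g / e\<^sup>2 * ((4 - \<nu>) / (\<nu> - 2))) powr (- ((\<nu> - 2) / (4 - \<nu>)))))"

definition alpha_FW ::
    "(real ^ 'n \<Rightarrow> ereal) \<Rightarrow> (real ^ 'n) set \<Rightarrow> (real ^ 'n \<Rightarrow> real ^ 'n) \<Rightarrow>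
     real \<Rightarrow> real \<Rightarrow> real ^ 'n \<Rightarrow> real" where
  "alpha_FW f X s M \<nu> x = min 1 (t_FW f X s M \<nu> x)"

(* The method stops at the first k with Gap(x^k) <= eps; later entries of the sequence are
   unconstrained. They cannot affect the first index with f(x^k) - f^* <= eps, because
   f(x^k) - f^* <= Gap(x^k) <= eps holds at the stopping index. *)
definition FWGSC_sequence ::
    "(real ^ 'n \<Rightarrow> ereal) \<Rightarrow> (real ^ 'n) set \<Rightarrow> (real ^ 'n \<Rightarrow> real ^ 'n) \<Rightarrow>
     real \<Rightarrow> real \<Rightarrow> real \<Rightarrow> real ^ 'n \<Rightarrow> (nat \<Rightarrow> real ^ 'n) \<Rightarrow> bool" where
  "FWGSC_sequence f X s M \<nu> \<epsilon> x0 x \<longleftrightarrow> x 0 = x0 \<and>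
     (\<forall>k. (\<forall>j\<le>k. Gap f X (x j) > \<epsilon>) \<longrightarrow>
        x (Suc k) = x k + alpha_FW f X s M \<nu> (x k) *\<^sub>R v_FW s (x k))"

definition level_set ::
    "(real ^ 'n \<Rightarrow> ereal) \<Rightarrow> (real ^ 'n) set \<Rightarrow> real ^ 'n \<Rightarrow> (real ^ 'n) set" where
  "level_set f X x0 = {x \<in> X \<inter> edom f. f x \<le> f x0}"

definition L_grad :: "(real ^ 'n \<Rightarrow> ereal) \<Rightarrow> (real ^ 'n) set \<Rightarrow> real ^ 'n \<Rightarrow> real" where
  "L_grad f X x0 = (SUP x\<in>level_set f X x0. lambda_max (hessian f x))"

definition gamma_tilde :: "real \<Rightarrow> real" where
  "gamma_tilde \<nu> = 1 + (4 - \<nu>) / (2 * (3 - \<nu>)) * (1 - 2 powr (2 * (3 - \<nu>) / (4 - \<nu>)))"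

definition b_exp :: "real \<Rightarrow> real" where
  "b_exp \<nu> = (2 - \<nu>) / (4 - \<nu>)"

definition c1 ::
    "(real ^ 'n \<Rightarrow> ereal) \<Rightarrow> (real ^ 'n) set \<Rightarrow> real ^ 'n \<Rightarrow> real \<Rightarrow> real \<Rightarrow> real" where
  "c1 f X x0 M \<nu> =
     (let L = L_grad f X x0; D = diameter X in
      if \<nu> = 2 then min (1/2) ((2 * ln 2 - 1) / (M * D))
      else if \<nu> = 3 then min (1/2) (2 * (1 - ln 2) / (M * sqrt L * D))
      else min (1/2) (gamma_tilde \<nu> / (D * (\<nu> / 2 - 1) * M * L powr ((\<nu> - 2) / 2))))"

(* c2 does not depend on M except through the notation. *)
definition c2 ::
    "(real ^ 'n \<Rightarrow> ereal) \<Rightarrow> (real ^ 'n) set \<Rightarrow> real ^ 'n \<Rightarrow> real \<Rightarrow> real \<Rightarrow> real" where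
  "c2 f X x0 M \<nu> =
     (let L = L_grad f X x0; D = diameter X in
      if \<nu> = 2 then (2 * ln 2 - 1) / (L * D\<^sup>2)
      else if \<nu> = 3 then 2 * (1 - ln 2) / (L * D\<^sup>2)
      else (-1 / b_exp \<nu>) * (gamma_tilde \<nu> / (L * D\<^sup>2)))"

(* Extended-real valued, so that the infimum of the empty set is infinity and an upper bound on
   N_eps includes the claim that accuracy eps is reached. *)
definition N_eps :: "(nat \<Rightarrow> ereal) \<Rightarrow> real \<Rightarrow> ereal" where
  "N_eps h \<epsilon> = (INF k\<in>{k. h k \<le> ereal \<epsilon>}. ereal (real k))"

end

theory Submission
  imports Defs
begin

text \<open>
Along a segment \<open>y + t v\<close> the curvature \<open>\<phi>(t) = \<langle>\<nabla>\<^sup>2f(y + t v) v, v\<rangle>\<close> of a generalized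
self-concordant function obeys a differential inequality \<open>\<phi>' \<le> K \<phi>\<^bsup>\<nu>/2\<^esup>\<close> whose extremal
solution is explicit. Integrating it twice yields the upper model
\<open>f(y + t v) \<le> f(y) - g t + E W(t)\<close> with \<open>g\<close> the Frank-Wolfe gap, \<open>E = \<phi>(0)\<close> and \<open>E W''\<close> the extremal
curvature (\<open>descent_along_segment\<close>). The step size of the method minimizes this model over \<open>t \<le> 1\<close>.
A full step therefore gains \<open>g/2\<close>, and a shorter step gains \<open>E / (m\<^sup>2 q) P(Y)\<close> with
\<open>Y = m g q / E\<close>, where \<open>P\<close> is convex with concave derivative and \<open>P(0) = P'(0) = 0\<close>
(\<open>frank_wolfe_step\<close>). Such a function dominates \<open>P(1) min(Y, Y\<^sup>2)\<close>, and since \<open>E \<le> L D\<^sup>2\<close>, \<open>m\<close> is bounded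
and the optimality gap \<open>h\<close> is at most \<open>g\<close>, every step satisfies
\<open>h\<^sub>k\<^sub>+\<^sub>1 \<le> h\<^sub>k - min(c\<^sub>1 h\<^sub>k, c h\<^sub>k\<^sup>2)\<close>.

For \<open>\<nu> < 3\<close> one has \<open>c = c\<^sub>2\<close>. The optimality gap contracts by the factor \<open>1 - c\<^sub>1\<close> until it drops below \<open>c\<^sub>1/c\<^sub>2\<close>, and
from then on \<open>1/h\<close> grows by \<open>c\<^sub>2\<close> per step. Counting both phases gives the bound
(\<open>iteration_bound\<close>, \<open>standard_iteration_bound\<close>); rounding the number of contractions costs
nothing because \<open>1/h \<ge> c\<^sub>2/c\<^sub>1 \<ge> 2 c\<^sub>2\<close> when the second phase starts.

For \<open>\<nu> = 3\<close> a single step only guarantees \<open>c = c\<^sub>2/2\<close>, and the bound needs an amortized argument.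
A step is that bad only if its direction \<open>v\<close> is nearly as long as the diameter \<open>D\<close>, and this
cannot happen all the time: the iterate is a convex combination of an
earlier iterate and the vertices chosen since then. Let \<open>Q\<close> be the variance
of this combination divided by \<open>D\<^sup>2\<close>. The parallel axis identity gives
\<open>|x - z|\<^sup>2/D\<^sup>2 + Q \<le> 1\<close> for all \<open>z\<close> in the feasible set (\<open>spread_geometry\<close>), so that directions are short
when \<open>Q\<close> is large, while a long direction increases \<open>Q\<close>. In units where \<open>L D\<^sup>2 = 1\<close>, the potential
\<open>(3/4 + Q/2)/h - (7/10) \<mu>\<^sup>3 h\<^sup>2\<close> grows by \<open>c\<^sub>2\<close> in each step once contraction has stopped
(\<open>potential_increases_short_step\<close>, \<open>potential_increases_full_step\<close>). It starts below \<open>1/h\<close>, but the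
slack in the count of the first phase pays for that (\<open>potential_start\<close>), and this yields
\<open>amortized_iteration_bound\<close>.
\<close>

section \<open>The extremal model along a segment\<close>

text \<open>The exponent \<open>q\<close> for which the model slope is \<open>((1 - m t)\<^bsup>-q\<^esup> - 1) / (m q)\<close>. The value at
  \<open>\<nu> = 2\<close> is chosen so that the formulas for the gain of a step agree with those for \<open>\<nu> > 2\<close>.\<close>
definition model_exponent :: "real \<Rightarrow> real" where
  "model_exponent \<nu> = (if \<nu> = 2 then 1 else (4 - \<nu>) / (\<nu> - 2))"

text \<open>The solution, with value 1 at 0, of the differential equation that extremal generalized
  self-concordant functions satisfy on a line; \<open>model_slope\<close> and \<open>model_growth\<close> are its first and second
  antiderivatives vanishing at 0.\<close>
definition model_curvature :: "real \<Rightarrow> real \<Rightarrow> real \<Rightarrow> real" where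
  "model_curvature \<nu> m t = (if \<nu> = 2 then exp (m * t) else (1 - m * t) powr (- 2 / (\<nu> - 2)))"

definition model_slope :: "real \<Rightarrow> real \<Rightarrow> real \<Rightarrow> real" where
  "model_slope \<nu> m t = (if \<nu> = 2 then (exp (m * t) - 1) / m
     else ((1 - m * t) powr (- model_exponent \<nu>) - 1) / (m * model_exponent \<nu>))"

definition model_growth :: "real \<Rightarrow> real \<Rightarrow> real \<Rightarrow> real" where
  "model_growth \<nu> m t = (if \<nu> = 2 then (exp (m * t) - 1 - m * t) / m\<^sup>2
     else if \<nu> = 3 then (- ln (1 - m * t) - m * t) / m\<^sup>2
     else (((1 - m * t) powr (1 - model_exponent \<nu>) - 1) / (m * (model_exponent \<nu> - 1)) - t) / (m * model_exponent \<nu>))"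

text \<open>For \<open>\<nu> > 2\<close> the model blows up at \<open>t = 1/m\<close>.\<close>
definition admissible :: "real \<Rightarrow> real \<Rightarrow> real \<Rightarrow> bool" where
  "admissible \<nu> m t \<longleftrightarrow> \<nu> = 2 \<or> m * t < 1"

lemma admissible_mono:
  assumes "admissible \<nu> m t" "0 < m" "r \<le> t"
  shows "admissible \<nu> m r"
proof -
  have "m * r \<le> m * t" using assms by (intro mult_left_mono) auto
  then show ?thesis using assms(1) unfolding admissible_def by linarith
qed

lemma model_growth_0: "model_growth \<nu> m 0 = 0" and model_slope_0: "model_slope \<nu> m 0 = 0"
  by (auto simp: model_growth_def model_slope_def)

lemma one_minus_powr_deriv:
  fixes m t r :: real
  assumes "m * t < 1"
  shows "((\<lambda>t. (1 - m * t) powr r) has_real_derivative (r * (1 - m * t) powr (r - 1) * (- m))) (at t)"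
proof (rule DERIV_chain2[where f = "\<lambda>z. z powr r"])
  show "((\<lambda>z. z powr r) has_real_derivative r * (1 - m * t) powr (r - 1)) (at (1 - m * t))"
    by (rule has_real_derivative_powr) (use assms in simp)
  show "((\<lambda>t. 1 - m * t) has_real_derivative (- m)) (at t)"
    by (auto intro!: derivative_eq_intros)
qed

lemma model_slope_deriv:
  assumes "2 \<le> \<nu>" "\<nu> \<le> 3" "0 < m" "admissible \<nu> m t"
  shows "(model_slope \<nu> m has_real_derivative model_curvature \<nu> m t) (at t)"
proof (cases "\<nu> = 2")
  case True
  then show ?thesis unfolding model_slope_def[abs_def] model_curvature_def using assms by (auto intro!: derivative_eq_intros)
next
  case False
  then have r: "model_exponent \<nu> > 0" "model_exponent \<nu> = 2 / (\<nu> - 2) - 1" using assms by (auto simp: model_exponent_def field_simps)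
  have mt: "m * t < 1" using assms False by (simp add: admissible_def)
  have "((\<lambda>t. ((1 - m * t) powr (- model_exponent \<nu>) - 1) / (m * model_exponent \<nu>)) has_real_derivative
      (- model_exponent \<nu> * (1 - m * t) powr (- model_exponent \<nu> - 1) * (- m) - 0) / (m * model_exponent \<nu>)) (at t)"
    by (intro DERIV_cdivide DERIV_diff one_minus_powr_deriv mt DERIV_const)
  moreover have "(- model_exponent \<nu> * (1 - m * t) powr (- model_exponent \<nu> - 1) * (- m) - 0) / (m * model_exponent \<nu>) = (1 - m * t) powr (- model_exponent \<nu> - 1)"
    using r(1) assms(3) by simp
  moreover have "- model_exponent \<nu> - 1 = - 2 / (\<nu> - 2)" using r by simp
  ultimately show ?thesis using False unfolding model_slope_def[abs_def] model_curvature_def by simp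
qed

lemma model_growth_deriv:
  assumes "2 \<le> \<nu>" "\<nu> \<le> 3" "0 < m" "admissible \<nu> m t"
  shows "(model_growth \<nu> m has_real_derivative model_slope \<nu> m t) (at t)"
proof -
  consider "\<nu> = 2" | "\<nu> = 3" | "\<nu> \<noteq> 2" "\<nu> \<noteq> 3" by blast
  then show ?thesis
  proof cases
    case 1
    then show ?thesis unfolding model_slope_def model_growth_def[abs_def] using assms
      by (auto intro!: derivative_eq_intros simp: field_simps power2_eq_square)
  next
    case 2
    then have mt: "m * t < 1" using assms by (simp add: admissible_def)
    have "((\<lambda>t. (- ln (1 - m * t) - m * t) / m\<^sup>2) has_real_derivative (m / (1 - m * t) - m) / m\<^sup>2) (at t)"
      using mt by (intro DERIV_cdivide) (auto intro!: derivative_eq_intros)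
    moreover have "(m / (1 - m * t) - m) / m\<^sup>2 = (inverse (1 - m * t) - 1) / m"
    proof -
      have "(m / z - m) / m\<^sup>2 = (inverse z - 1) / m" for z using assms(3) by (simp add: field_simps power2_eq_square)
      then show ?thesis .
    qed
    moreover have "inverse (1 - m * t) = (1 - m * t) powr - 1" using mt by (simp add: powr_minus)
    ultimately show ?thesis using 2 unfolding model_slope_def model_growth_def[abs_def] model_exponent_def by simp
  next
    case 3
    then have r: "model_exponent \<nu> > 1" using assms by (auto simp: model_exponent_def field_simps)
    have mt: "m * t < 1" using assms 3 by (simp add: admissible_def)
    have "((\<lambda>t. (((1 - m * t) powr (1 - model_exponent \<nu>) - 1) / (m * (model_exponent \<nu> - 1)) - t) / (m * model_exponent \<nu>)) has_real_derivative
       (((1 - model_exponent \<nu>) * (1 - m * t) powr (1 - model_exponent \<nu> - 1) * (- m) - 0) / (m * (model_exponent \<nu> - 1)) - 1) / (m * model_exponent \<nu>)) (at t)"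
      by (intro DERIV_cdivide DERIV_diff one_minus_powr_deriv mt DERIV_const DERIV_ident)
    moreover have "((1 - model_exponent \<nu>) * x * (- m) - 0) / (m * (model_exponent \<nu> - 1)) = x" for x
      using r assms(3) by (simp add: field_simps)
    ultimately show ?thesis using 3 unfolding model_slope_def model_growth_def[abs_def] by simp
  qed
qed

lemma model_curvature_mono:
  assumes "2 \<le> \<nu>" "\<nu> \<le> 3" "0 < m" "admissible \<nu> m t" "0 \<le> s" "s \<le> t"
  shows "model_curvature \<nu> m s \<le> model_curvature \<nu> m t" "1 \<le> model_curvature \<nu> m s"
proof -
  have ms: "m * s \<le> m * t" "0 \<le> m * s" using assms by auto
  show "model_curvature \<nu> m s \<le> model_curvature \<nu> m t" using assms ms unfolding model_curvature_def admissible_def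
    by (auto intro!: powr_mono2' simp: divide_nonpos_pos)
  have "1 = model_curvature \<nu> m 0" by (simp add: model_curvature_def)
  also have "\<dots> \<le> model_curvature \<nu> m s"
  proof (cases "\<nu> = 2")
    case False
    then have "m * s < 1" using assms(4) ms by (simp add: admissible_def)
    then have "(1 - 0) powr (- 2 / (\<nu> - 2)) \<le> (1 - m * s) powr (- 2 / (\<nu> - 2))"
      using ms assms by (intro powr_mono2') (auto simp: divide_nonpos_pos)
    then show ?thesis using False by (simp add: model_curvature_def)
  qed (use ms in \<open>simp add: model_curvature_def\<close>)
  finally show "1 \<le> model_curvature \<nu> m s" .
qed

text \<open>\<open>gain\<close> is the normalized optimal value of the model as a function of the normalized
  Frank-Wolfe gap. By the envelope theorem its derivative is the normalized optimal step size, which is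
  why \<open>gain_deriv\<close> reappears in the formula for the step size.\<close>
definition gain_deriv :: "real \<Rightarrow> real \<Rightarrow> real" where
  "gain_deriv \<nu> y = (if \<nu> = 2 then ln (1 + y) else 1 - (1 + y) powr (- 1 / model_exponent \<nu>))"

definition gain :: "real \<Rightarrow> real \<Rightarrow> real" where
  "gain \<nu> y = (if \<nu> = 2 then (1 + y) * ln (1 + y) - y
     else if \<nu> = 3 then y - ln (1 + y)
     else y - ((1 + y) powr (1 - 1 / model_exponent \<nu>) - 1) / (1 - 1 / model_exponent \<nu>))"

text \<open>Both estimates are monotonicity statements: \<open>P(s)/s\<close> increases because \<open>P\<close> is convex, and
  \<open>P(s)/s\<^sup>2\<close> decreases because \<open>p(s)/s\<close> does, which is the hypothesis \<open>s p'(s) \<le> p(s)\<close>.\<close>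
lemma convex_concave_lower_bound:
  fixes P p p' :: "real \<Rightarrow> real"
  assumes "P 0 = 0" "p 0 = 0"
    and P: "\<And>s. 0 \<le> s \<Longrightarrow> (P has_real_derivative p s) (at s)"
    and p: "\<And>s. 0 \<le> s \<Longrightarrow> (p has_real_derivative p' s) (at s)"
    and p': "\<And>s. 0 \<le> s \<Longrightarrow> 0 \<le> p' s" "\<And>s. 0 \<le> s \<Longrightarrow> s * p' s \<le> p s"
    and y: "0 \<le> y"
  shows "P 1 * min y (y\<^sup>2) \<le> P y"
proof -
  have "(\<lambda>s. s * p s - P s) 0 \<le> (\<lambda>s. s * p s - P s) z" if "0 \<le> z" for z
  proof (rule DERIV_nonneg_imp_nondecreasing[OF that], intro exI conjI)
    fix s assume "0 \<le> s" "s \<le> z"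
    then show "((\<lambda>s. s * p s - P s) has_real_derivative (s * p' s)) (at s)"
      by (auto intro!: derivative_eq_intros P p)
    show "0 \<le> s * p' s" using p' \<open>0 \<le> s\<close> by simp
  qed
  then have 1: "P z \<le> z * p z" if "0 \<le> z" for z using that assms by simp
  have "(\<lambda>s. 2 * P s - s * p s) 0 \<le> (\<lambda>s. 2 * P s - s * p s) z" if "0 \<le> z" for z
  proof (rule DERIV_nonneg_imp_nondecreasing[OF that], intro exI conjI)
    fix s assume "0 \<le> s" "s \<le> z"
    then show "((\<lambda>s. 2 * P s - s * p s) has_real_derivative (p s - s * p' s)) (at s)"
      by (auto intro!: derivative_eq_intros P p)
    show "0 \<le> p s - s * p' s" using p' \<open>0 \<le> s\<close> by simp
  qed
  then have 2: "z * p z \<le> 2 * P z" if "0 \<le> z" for z using that assms by simp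
  consider "y = 0" | "0 < y" "y < 1" | "1 \<le> y" using y by linarith
  then show ?thesis
  proof cases
    case 1 then show ?thesis using assms by simp
  next
    case 2
    have "(\<lambda>s. P s / s\<^sup>2) y \<ge> (\<lambda>s. P s / s\<^sup>2) 1"
    proof (rule DERIV_nonpos_imp_nonincreasing[of y 1], use 2 in simp, intro exI conjI)
      fix s assume s: "y \<le> s" "s \<le> 1"
      then have "0 < s" using 2 by simp
      then show "((\<lambda>s. P s / s\<^sup>2) has_real_derivative ((p s * s\<^sup>2 - P s * (2 * s)) / (s\<^sup>2 * s\<^sup>2))) (at s)"
        by (auto intro!: derivative_eq_intros P)
      have "(p s * s\<^sup>2 - P s * (2 * s)) = s * (s * p s - 2 * P s)" by (simp add: power2_eq_square algebra_simps)
      also have "\<dots> \<le> 0" using \<open>0 < s\<close> \<open>\<And>z. 0 \<le> z \<Longrightarrow> z * p z \<le> 2 * P z\<close>[of s] by (intro mult_nonneg_nonpos) auto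
      finally show "(p s * s\<^sup>2 - P s * (2 * s)) / (s\<^sup>2 * s\<^sup>2) \<le> 0" by (intro divide_nonpos_nonneg) auto
    qed
    then have "P 1 * y\<^sup>2 \<le> P y" using 2 by (simp add: pos_le_divide_eq)
    moreover have "y\<^sup>2 \<le> y" using 2 by (simp add: power2_eq_square mult_left_le)
    ultimately show ?thesis by (simp add: min_absorb2)
  next
    case 3
    have "(\<lambda>s. P s / s) 1 \<le> (\<lambda>s. P s / s) y"
    proof (rule DERIV_nonneg_imp_nondecreasing[OF 3], intro exI conjI)
      fix s assume s: "1 \<le> s" "s \<le> y"
      then show "((\<lambda>s. P s / s) has_real_derivative ((p s * s - P s) / (s * s))) (at s)"
        by (auto intro!: derivative_eq_intros P)
      show "0 \<le> (p s * s - P s) / (s * s)" using 1[of s] s by (intro divide_nonneg_nonneg) (auto simp: mult.commute)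
    qed
    then have "P 1 * y \<le> P y" using 3 by (simp add: pos_le_divide_eq)
    moreover have "y \<le> y\<^sup>2" using 3 by (simp add: power2_eq_square)
    ultimately show ?thesis by (simp add: min_absorb1)
  qed
qed

lemma gain_has_deriv:
  assumes nu: "2 \<le> \<nu>" "\<nu> \<le> 3" and s: "0 \<le> s"
  shows "(gain \<nu> has_real_derivative gain_deriv \<nu> s) (at s)"
    "(gain_deriv \<nu> has_real_derivative (if \<nu> = 2 then 1 / (1 + s) else 1 / model_exponent \<nu> * (1 + s) powr (- 1 / model_exponent \<nu> - 1))) (at s)"
proof -
  define r where "r = 1 / model_exponent \<nu>"
  have r: "\<nu> \<noteq> 3 \<Longrightarrow> \<nu> \<noteq> 2 \<Longrightarrow> r < 1" using nu by (auto simp: r_def model_exponent_def field_simps)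
  have powr: "((\<lambda>s. (1 + s) powr k) has_real_derivative (k * (1 + s) powr (k - 1))) (at s)" for k
    using one_minus_powr_deriv[of "-1" s k] s by simp
  show "(gain_deriv \<nu> has_real_derivative (if \<nu> = 2 then 1 / (1 + s) else 1 / model_exponent \<nu> * (1 + s) powr (- 1 / model_exponent \<nu> - 1))) (at s)"
  proof (cases "\<nu> = 2")
    case True then show ?thesis using s unfolding gain_deriv_def[abs_def]
      by (auto intro!: derivative_eq_intros)
  next
    case False
    have "((\<lambda>s. 1 - (1 + s) powr (- r)) has_real_derivative (0 - (- r * (1 + s) powr (- r - 1)))) (at s)"
      by (intro DERIV_diff DERIV_const powr)
    then show ?thesis using False unfolding gain_deriv_def[abs_def] by (simp add: r_def)
  qed
  consider "\<nu> = 2" | "\<nu> = 3" | "\<nu> \<noteq> 2" "\<nu> \<noteq> 3" by blast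
  then show "(gain \<nu> has_real_derivative gain_deriv \<nu> s) (at s)"
  proof cases
    case 1 then show ?thesis using s unfolding gain_deriv_def gain_def[abs_def]
      by (auto intro!: derivative_eq_intros)
  next
    case 2
    have "((\<lambda>y. y - ln (1 + y)) has_real_derivative (1 - inverse (1 + s))) (at s)"
      using s by (auto intro!: derivative_eq_intros simp: field_simps)
    then show ?thesis using 2 s unfolding gain_deriv_def gain_def[abs_def] model_exponent_def by (simp add: powr_minus)
  next
    case 3
    have "((\<lambda>y. y - ((1 + y) powr (1 - r) - 1) / (1 - r)) has_real_derivative
        (1 - ((1 - r) * (1 + s) powr (1 - r - 1) - 0) / (1 - r))) (at s)"
      by (intro DERIV_diff DERIV_cdivide DERIV_const DERIV_ident powr)
    moreover have "model_exponent \<nu> \<noteq> 1" using r 3 by (auto simp: r_def)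
    ultimately show ?thesis using 3 unfolding gain_deriv_def gain_def[abs_def] by (simp add: r_def)
  qed
qed

lemma gain_at_1_pos:
  assumes nu: "2 \<le> \<nu>" "\<nu> \<le> 3"
  shows "0 < gain \<nu> 1"
proof -
  have "gain \<nu> 0 < gain \<nu> 1"
  proof (rule DERIV_pos_imp_increasing_open[of 0 1 "gain \<nu>"])
    fix s :: real assume s: "0 < s" "s < 1"
    have "0 < model_exponent \<nu>" using nu by (auto simp: model_exponent_def)
    then have "(1 + s) powr (- 1 / model_exponent \<nu>) < 1"
      using powr_less_mono2_neg[of "- 1 / model_exponent \<nu>" 1 "1 + s"] s by simp
    then have "0 < gain_deriv \<nu> s" using s by (simp add: gain_deriv_def)
    then show "\<exists>y. (gain \<nu> has_real_derivative y) (at s) \<and> 0 < y" using gain_has_deriv(1)[OF nu, of s] s by auto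
  next
    show "continuous_on {0..1} (gain \<nu>)"
      by (rule continuous_at_imp_continuous_on) (use DERIV_isCont[OF gain_has_deriv(1)[OF nu]] in auto)
  qed simp
  then show ?thesis by (simp add: gain_def split: if_splits)
qed

lemma gain_lower_bound:
  assumes nu: "2 \<le> \<nu>" "\<nu> \<le> 3" and y: "0 \<le> y"
  shows "gain \<nu> 1 * min y (y\<^sup>2) \<le> gain \<nu> y"
proof -
  define r where "r = 1 / model_exponent \<nu>"
  have r: "0 < r" "r \<le> 1" "\<nu> \<noteq> 3 \<Longrightarrow> \<nu> \<noteq> 2 \<Longrightarrow> r < 1" using nu by (auto simp: r_def model_exponent_def field_simps)
  define p' where "p' = (\<lambda>y. if \<nu> = 2 then 1 / (1 + y) else r * (1 + y) powr (- r - 1))"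
  show ?thesis
  proof (rule convex_concave_lower_bound[OF _ _ _ _ _ _ y, of "gain \<nu>" "gain_deriv \<nu>" p'])
    show "gain \<nu> 0 = 0" "gain_deriv \<nu> 0 = 0" by (auto simp: gain_def gain_deriv_def)
  next
    fix s :: real assume s: "0 \<le> s"
    show "(gain \<nu> has_real_derivative gain_deriv \<nu> s) (at s)"
      and "(gain_deriv \<nu> has_real_derivative p' s) (at s)"
      using gain_has_deriv[OF nu s] by (auto simp: p'_def r_def)
    show "0 \<le> p' s" using s r by (simp add: p'_def)
    show "s * p' s \<le> gain_deriv \<nu> s"
    proof (cases "\<nu> = 2")
      case True
      have "ln (1 / (1 + s)) \<le> 1 / (1 + s) - 1" using s by (intro ln_le_minus_one) auto
      then show ?thesis using True s by (simp add: p'_def gain_deriv_def ln_div field_simps)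
    next
      case False
      have "1 + (r + 1) * s \<le> (1 + s) powr (r + 1)"
      proof -
        have "ln (1 / (1 + s)) \<le> 1 / (1 + s) - 1" using s by (intro ln_le_minus_one) auto
        then have "s / (1 + s) \<le> ln (1 + s)" using s by (simp add: ln_div field_simps)
        then have "1 + r * (s / (1 + s)) \<le> 1 + r * ln (1 + s)" using r by (intro add_left_mono mult_left_mono) auto
        also have "\<dots> \<le> (1 + s) powr r" using s exp_ge_add_one_self by (simp add: powr_def)
        finally have "(1 + r * (s / (1 + s))) * (1 + s) \<le> (1 + s) powr r * (1 + s)"
          using s by (intro mult_right_mono) auto
        moreover have "(1 + r * (s / (1 + s))) * (1 + s) = 1 + (r + 1) * s" using s by (simp add: field_simps)
        moreover have "(1 + s) powr (r + 1) = (1 + s) powr r * (1 + s)" using s by (simp add: powr_add)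
        ultimately show ?thesis by linarith
      qed
      then have "(1 + (r + 1) * s) * (1 + s) powr (- r - 1) \<le> (1 + s) powr (r + 1) * (1 + s) powr (- r - 1)"
        by (intro mult_right_mono) auto
      also have "\<dots> = 1" using s by (simp flip: powr_add)
      finally have "s * (r * (1 + s) powr (- r - 1)) \<le> 1 - (1 + s) * (1 + s) powr (- r - 1)" by (simp add: algebra_simps)
      also have "(1 + s) * (1 + s) powr (- r - 1) = (1 + s) powr (- r)"
        using s by (simp add: powr_diff)
      finally show ?thesis using False by (simp add: p'_def gain_deriv_def r_def)
    qed
  qed
qed

text \<open>The first-order condition \<open>E \<cdot> model_slope = g\<close> is solved by \<open>t\<close> because \<open>1 - m t\<close> is a power of \<open>1 + y\<close>;
  substituting that power into the model gives the last identity.\<close>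
lemma optimal_step:
  assumes nu: "2 \<le> \<nu>" "\<nu> \<le> 3" and m: "0 < m" and g: "0 < g" and E: "0 < E"
  defines "y \<equiv> m * g * model_exponent \<nu> / E"
  defines "t \<equiv> gain_deriv \<nu> y / m"
  shows "0 < t" "admissible \<nu> m t" "E * model_slope \<nu> m t = g"
    "g * t - E * model_growth \<nu> m t = E / (m\<^sup>2 * model_exponent \<nu>) * gain \<nu> y"
proof -
  define q where "q = model_exponent \<nu>"
  have q: "1 \<le> q" "\<nu> \<noteq> 3 \<Longrightarrow> \<nu> \<noteq> 2 \<Longrightarrow> 1 < q" "\<nu> = 3 \<Longrightarrow> q = 1" "\<nu> = 2 \<Longrightarrow> q = 1"
    using nu by (auto simp: model_exponent_def q_def field_simps)
  have y: "0 < y" using m g E q by (simp add: y_def q_def)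
  have g_eq: "g = y * E / (m * q)" using m E q by (simp add: y_def q_def)
  have mt: "m * t = gain_deriv \<nu> y" using m by (simp add: t_def)
  have pow: "(1 - m * t) powr k = (1 + y) powr (- k / q)" "1 - m * t = (1 + y) powr (- 1 / q)" if "\<nu> \<noteq> 2" for k
    using that y by (auto simp: mt gain_deriv_def q_def[symmetric] powr_powr)
  have lt1: "(1 + y) powr (- 1 / q) < 1" using y q powr_less_mono2_neg[of "-1/q" 1 "1 + y"] by simp
  show "admissible \<nu> m t"
    using pow(2) y unfolding admissible_def by (metis diff_gt_0_iff_gt powr_gt_zero add_pos_pos zero_less_one less_numeral_extra(3))
  show "0 < t" unfolding t_def gain_deriv_def using y m lt1 by (auto simp: q_def)
  show "E * model_slope \<nu> m t = g"
  proof (cases "\<nu> = 2")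
    case True then show ?thesis using y m q by (simp add: model_slope_def mt gain_deriv_def g_eq)
  next
    case False
    have "(1 - m * t) powr (- q) = 1 + y" using pow(1)[OF False, of "- q"] y q by simp
    then show ?thesis using False m q by (simp add: model_slope_def q_def[symmetric] g_eq)
  qed
  consider "\<nu> = 2" | "\<nu> = 3" | "\<nu> \<noteq> 2" "\<nu> \<noteq> 3" by blast
  then show "g * t - E * model_growth \<nu> m t = E / (m\<^sup>2 * model_exponent \<nu>) * gain \<nu> y"
  proof cases
    case 1
    then show ?thesis using y m q by (simp add: model_growth_def mt gain_deriv_def gain_def g_eq t_def q_def[symmetric] model_exponent_def field_simps power2_eq_square)
  next
    case 2
    have "ln (1 - m * t) = - ln (1 + y)" using 2 q y by (simp add: pow ln_powr ln_div)
    moreover have "m * t = y / (1 + y)" using 2 q y by (simp add: mt gain_deriv_def model_exponent_def powr_minus field_simps)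
    then have w: "y * (m * t) + m * t = y" using y by (simp add: field_simps)
    ultimately have model_growth: "model_growth \<nu> m t = (ln (1 + y) - m * t) / m\<^sup>2" using 2 by (simp add: model_growth_def)
    have "g * t = E / m\<^sup>2 * (y * (m * t))" using m q(3)[OF 2] by (simp add: g_eq power2_eq_square)
    then have "g * t - E * model_growth \<nu> m t = E / m\<^sup>2 * (y * (m * t) - (ln (1 + y) - m * t))"
      unfolding model_growth by (simp add: algebra_simps diff_divide_distrib)
    also have "\<dots> = E / m\<^sup>2 * (y - ln (1 + y))" using w by (simp add: algebra_simps)
    finally show ?thesis using 2 q(3)[OF 2] by (simp add: gain_def q_def)
  next
    case 3
    have q1: "1 < q" using q 3 by simp
    define u where "u = (1 + y) powr (1 - 1 / q)"
    have e: "- (1 - q) / q = 1 - 1 / q" using q1 by (simp add: field_simps)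
    have u1: "(1 - m * t) powr (1 - q) = u" using pow(1)[OF 3(1), of "1 - q"] by (simp only: e u_def)
    have "u = (1 + y) * (1 + y) powr (- 1 / q)" using y by (simp add: u_def powr_diff powr_minus field_simps)
    then have "m * t = 1 - u / (1 + y)" using 3 pow(2) y by simp
    then have w: "y * (m * t) + m * t = 1 + y - u" using y by (simp add: field_simps)
    have "model_growth \<nu> m t = ((u - 1) / (m * (q - 1)) - t) / (m * q)"
      using 3 unfolding model_growth_def q_def[symmetric] u1 by simp
    also have "\<dots> = ((u - 1) / (q - 1) - m * t) / (m\<^sup>2 * q)"
      using m q1 by (simp add: power2_eq_square divide_simps)
    finally have model_growth: "model_growth \<nu> m t = ((u - 1) / (q - 1) - m * t) / (m\<^sup>2 * q)" .
    have gt: "g * t = E / (m\<^sup>2 * q) * (y * (m * t))" using m by (simp add: g_eq power2_eq_square)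
    have "g * t - E * model_growth \<nu> m t = E / (m\<^sup>2 * q) * (y * (m * t) - ((u - 1) / (q - 1) - m * t))"
    proof -
      have "g * t - E * (G / K) = E / K * (A - G)" if "g * t = E / K * A" for G K A
        using that by (simp add: right_diff_distrib)
      then show ?thesis using gt unfolding model_growth by blast
    qed
    also have "y * (m * t) - ((u - 1) / (q - 1) - m * t) = y - (u - 1) / (1 - 1 / q)"
    proof -
      have "(u - 1) / (1 - 1 / q) = (u - 1) + (u - 1) / (q - 1)" using q1 by (simp add: field_simps)
      then show ?thesis using w by simp
    qed
    finally show ?thesis using 3 by (simp add: gain_def q_def[symmetric] u_def)
  qed
qed

text \<open>Integration of the monotone curvature. Integrating once more gives the factor 2 in \<open>model_growth_bounds\<close>, which is where the constant 1/2 in \<open>c\<^sub>1\<close> comes from.\<close>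
lemma model_slope_bounds:
  assumes nu: "2 \<le> \<nu>" "\<nu> \<le> 3" and m: "0 < m" and t: "admissible \<nu> m t" "0 \<le> t"
  shows "0 \<le> model_slope \<nu> m t" "model_slope \<nu> m t \<le> t * model_curvature \<nu> m t"
proof -
  have adm: "admissible \<nu> m r" if "r \<le> t" for r
    using admissible_mono[OF t(1) m that] .
  have "model_slope \<nu> m 0 \<le> model_slope \<nu> m t"
    by (rule DERIV_nonneg_imp_nondecreasing[OF t(2)], intro exI conjI, rule model_slope_deriv[OF nu m adm])
      (use model_curvature_mono(2)[OF nu m t(1)] in force)+
  then show "0 \<le> model_slope \<nu> m t" by (simp add: model_slope_0)
  have "0 * model_curvature \<nu> m t - model_slope \<nu> m 0 \<le> t * model_curvature \<nu> m t - model_slope \<nu> m t"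
  proof (rule DERIV_nonneg_imp_nondecreasing[OF t(2), where f = "\<lambda>r. r * model_curvature \<nu> m t - model_slope \<nu> m r"], intro exI conjI)
    fix r assume r: "0 \<le> r" "r \<le> t"
    show "((\<lambda>r. r * model_curvature \<nu> m t - model_slope \<nu> m r) has_real_derivative (1 * model_curvature \<nu> m t - model_curvature \<nu> m r)) (at r)"
      by (intro DERIV_diff DERIV_cmult_right DERIV_ident model_slope_deriv nu m adm r)
    show "0 \<le> 1 * model_curvature \<nu> m t - model_curvature \<nu> m r" using model_curvature_mono(1)[OF nu m t(1) r] by simp
  qed
  then show "model_slope \<nu> m t \<le> t * model_curvature \<nu> m t" by (simp add: model_slope_0)
qed

lemma model_growth_bounds:
  assumes nu: "2 \<le> \<nu>" "\<nu> \<le> 3" and m: "0 < m" and t: "admissible \<nu> m t" "0 \<le> r" "r \<le> t"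
  shows "model_growth \<nu> m r \<le> model_growth \<nu> m t" "model_slope \<nu> m r \<le> model_slope \<nu> m t" "2 * model_growth \<nu> m t \<le> t * model_slope \<nu> m t"
proof -
  have adm: "admissible \<nu> m r" if "r \<le> t" for r
    using admissible_mono[OF t(1) m that] .
  show "model_growth \<nu> m r \<le> model_growth \<nu> m t"
    by (rule DERIV_nonneg_imp_nondecreasing[OF t(3)], intro exI conjI, rule model_growth_deriv[OF nu m adm])
      (use model_slope_bounds(1)[OF nu m adm] t in force)+
  have nonneg: "0 \<le> model_curvature \<nu> m x" if "0 \<le> x" "x \<le> t" for x
    using model_curvature_mono(2)[OF nu m t(1) that] by simp
  show "model_slope \<nu> m r \<le> model_slope \<nu> m t"
    by (rule DERIV_nonneg_imp_nondecreasing[OF t(3)], intro exI conjI, rule model_slope_deriv[OF nu m adm])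
      (use nonneg t in auto)
  have t0: "0 \<le> t" using t by simp
  have "0 * model_slope \<nu> m 0 - 2 * model_growth \<nu> m 0 \<le> t * model_slope \<nu> m t - 2 * model_growth \<nu> m t"
  proof (rule DERIV_nonneg_imp_nondecreasing[OF t0, where f = "\<lambda>r. r * model_slope \<nu> m r - 2 * model_growth \<nu> m r"], intro exI conjI)
    fix r assume r: "0 \<le> r" "r \<le> t"
    show "((\<lambda>r. r * model_slope \<nu> m r - 2 * model_growth \<nu> m r) has_real_derivative
        (1 * model_slope \<nu> m r + model_curvature \<nu> m r * r) - 2 * model_slope \<nu> m r) (at r)"
      by (intro DERIV_diff DERIV_mult DERIV_cmult DERIV_ident model_slope_deriv model_growth_deriv nu m adm r)
    show "0 \<le> (1 * model_slope \<nu> m r + model_curvature \<nu> m r * r) - 2 * model_slope \<nu> m r"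
      using model_slope_bounds(2)[OF nu m adm r(1)] r by (simp add: mult.commute)
  qed
  then show "2 * model_growth \<nu> m t \<le> t * model_slope \<nu> m t" by (simp add: model_growth_0)
qed

section \<open>Generalized self-concordant functions along segments\<close>

locale gsc_function =
  fixes f :: "real ^ 'n \<Rightarrow> ereal" and M \<nu> :: real
  assumes gsc: "f \<in> gsc_class M \<nu>" and nu: "2 \<le> \<nu>" "\<nu> \<le> 3" and M_pos: "0 < M"
begin

abbreviation F :: "real ^ 'n \<Rightarrow> real" where "F y \<equiv> real_of_ereal (f y)"
abbreviation quad :: "real ^ 'n \<Rightarrow> real ^ 'n \<Rightarrow> real" where "quad y v \<equiv> (hessian f y *v v) \<bullet> v"

lemma open_edom: "open (edom f)"
  and not_minus_infinity: "f y \<noteq> -\<infinity>"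
  and convex_ineq: "t \<in> {0..1} \<Longrightarrow> f ((1 - t) *\<^sub>R y + t *\<^sub>R z) \<le> ereal (1 - t) * f y + ereal t * f z"
  and lsc: "f y \<le> Liminf (at y) f"
  using gsc by (auto simp: gsc_class_def proper_closed_convex_def)

lemma ereal_F: "y \<in> edom f \<Longrightarrow> f y = ereal (F y)"
  using not_minus_infinity[of y] by (cases "f y") (auto simp: edom_def)

lemma F_convex_ineq:
  assumes "y \<in> edom f" "z \<in> edom f" "t \<in> {0..1}"
  shows "(1 - t) *\<^sub>R y + t *\<^sub>R z \<in> edom f" "F ((1 - t) *\<^sub>R y + t *\<^sub>R z) \<le> (1 - t) * F y + t * F z"
proof -
  have "f ((1 - t) *\<^sub>R y + t *\<^sub>R z) \<le> ereal ((1 - t) * F y + t * F z)"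
    using convex_ineq[OF assms(3), of y z] ereal_F[OF assms(1)] ereal_F[OF assms(2)]
    by (metis plus_ereal.simps(1) times_ereal.simps(1))
  moreover from this show 1: "(1 - t) *\<^sub>R y + t *\<^sub>R z \<in> edom f" by (auto simp: edom_def)
  ultimately show "F ((1 - t) *\<^sub>R y + t *\<^sub>R z) \<le> (1 - t) * F y + t * F z"
    using ereal_F[OF 1] by (metis ereal_less_eq(3))
qed

lemma F_has_derivative:
  assumes "y \<in> edom f"
  shows "(F has_derivative (\<lambda>v. gradient f y \<bullet> v)) (at y)"
proof -
  have diff: "F differentiable (at y)" using gsc assms by (auto simp: gsc_class_def C3_on_edom_def)
  then obtain L where L: "(F has_derivative L) (at y)" by (auto simp: differentiable_def)
  then have lin: "linear L" by (rule has_derivative_linear)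
  have "L = (\<lambda>v. v \<bullet> adjoint L 1)" using adjoint_works[OF lin, of _ 1] by auto
  with L have "GDERIV F y :> adjoint L 1" by (simp add: gderiv_def)
  moreover have "D = D'" if "GDERIV F y :> D" "GDERIV F y :> D'" for D D'
    using has_derivative_unique[OF that[unfolded gderiv_def]] by (metis vector_eq_ldot)
  ultimately have "GDERIV F y :> gradient f y" unfolding gradient_def by (metis (mono_tags, lifting) theI)
  then show ?thesis by (simp add: gderiv_def inner_commute)
qed

lemma gradient_has_derivative:
  assumes "y \<in> edom f"
  shows "(gradient f has_derivative (\<lambda>v. hessian f y *v v)) (at y)"
proof -
  have "(gradient f has_derivative frechet_derivative (gradient f) (at y)) (at y)"
    using gsc assms by (auto simp: gsc_class_def C3_on_edom_def frechet_derivative_works[symmetric])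
  moreover from this have "linear (frechet_derivative (gradient f) (at y))" by (rule has_derivative_linear)
  then have "frechet_derivative (gradient f) (at y) = (\<lambda>v. hessian f y *v v)"
    by (simp add: hessian_def fun_eq_iff matrix_works)
  ultimately show ?thesis by simp
qed

lemma hessian_has_derivative:
  assumes "y \<in> edom f"
  shows "(hessian f has_derivative (\<lambda>v. third_deriv f y v)) (at y)"
  unfolding third_deriv_def
  using gsc assms by (auto simp: gsc_class_def C3_on_edom_def frechet_derivative_works[symmetric])

lemma line_has_derivative: "((\<lambda>t. y + t *\<^sub>R v) has_derivative (\<lambda>h. h *\<^sub>R v)) (at t)"
  by (auto intro!: derivative_eq_intros)

lemma F_line_deriv:
  assumes "y + t *\<^sub>R v \<in> edom f"
  shows "((\<lambda>t. F (y + t *\<^sub>R v)) has_real_derivative gradient f (y + t *\<^sub>R v) \<bullet> v) (at t)"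
proof -
  have "((\<lambda>t. F (y + t *\<^sub>R v)) has_derivative (\<lambda>h. gradient f (y + t *\<^sub>R v) \<bullet> (h *\<^sub>R v))) (at t)"
    using diff_chain_at[OF line_has_derivative F_has_derivative[OF assms]] unfolding o_def .
  moreover have "(\<lambda>h. gradient f (y + t *\<^sub>R v) \<bullet> (h *\<^sub>R v)) = (*) (gradient f (y + t *\<^sub>R v) \<bullet> v)"
    by (simp add: fun_eq_iff)
  ultimately show ?thesis unfolding has_field_derivative_def by simp
qed

lemma gradient_line_deriv:
  assumes "y + t *\<^sub>R v \<in> edom f"
  shows "((\<lambda>t. gradient f (y + t *\<^sub>R v) \<bullet> u) has_real_derivative (hessian f (y + t *\<^sub>R v) *v v) \<bullet> u) (at t)"
proof -
  have "((\<lambda>t. gradient f (y + t *\<^sub>R v) \<bullet> u) has_derivative (\<lambda>h. (hessian f (y + t *\<^sub>R v) *v (h *\<^sub>R v)) \<bullet> u)) (at t)"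
    using has_derivative_inner_left[OF diff_chain_at[OF line_has_derivative gradient_has_derivative[OF assms]], of u]
    unfolding o_def .
  moreover have "(\<lambda>h. (hessian f (y + t *\<^sub>R v) *v (h *\<^sub>R v)) \<bullet> u) = (*) ((hessian f (y + t *\<^sub>R v) *v v) \<bullet> u)"
    by (simp add: fun_eq_iff matrix_vector_mult_scaleR)
  ultimately show ?thesis unfolding has_field_derivative_def by simp
qed

lemma quad_line_deriv:
  assumes "y + t *\<^sub>R v \<in> edom f"
  shows "((\<lambda>t. quad (y + t *\<^sub>R v) v) has_real_derivative (third_deriv f (y + t *\<^sub>R v) v *v v) \<bullet> v) (at t)"
proof -
  have "linear (\<lambda>A :: real ^ 'n ^ 'n. (A *v v) \<bullet> v)"
    by (rule linearI) (simp_all add: matrix_vector_mult_add_rdistrib inner_add_left scaleR_matrix_vector_assoc[symmetric])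
  then have bl: "bounded_linear (\<lambda>A :: real ^ 'n ^ 'n. (A *v v) \<bullet> v)" by (rule linear_conv_bounded_linear[THEN iffD1])
  have "linear (third_deriv f (y + t *\<^sub>R v))"
    using has_derivative_linear[OF hessian_has_derivative[OF assms]] .
  then have sc: "third_deriv f (y + t *\<^sub>R v) (h *\<^sub>R v) = h *\<^sub>R third_deriv f (y + t *\<^sub>R v) v" for h
    by (rule linear_scale)
  have "((\<lambda>t. quad (y + t *\<^sub>R v) v) has_derivative (\<lambda>h. (third_deriv f (y + t *\<^sub>R v) (h *\<^sub>R v) *v v) \<bullet> v)) (at t)"
    using bounded_linear.has_derivative[OF bl diff_chain_at[OF line_has_derivative hessian_has_derivative[OF assms]]]
    unfolding o_def .
  moreover have "(\<lambda>h. (third_deriv f (y + t *\<^sub>R v) (h *\<^sub>R v) *v v) \<bullet> v) = (*) ((third_deriv f (y + t *\<^sub>R v) v *v v) \<bullet> v)"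
    by (simp add: fun_eq_iff sc scaleR_matrix_vector_assoc[symmetric])
  ultimately show ?thesis unfolding has_field_derivative_def by simp
qed

lemma F_above_tangent:
  assumes "y \<in> edom f" "z \<in> edom f"
  shows "F y + gradient f y \<bullet> (z - y) \<le> F z"
proof -
  let ?\<psi> = "\<lambda>t. F (y + t *\<^sub>R (z - y))"
  have "((\<lambda>t. (?\<psi> t - ?\<psi> 0) / t) \<longlongrightarrow> gradient f y \<bullet> (z - y)) (at_right 0)"
    using F_line_deriv[of y 0 "z - y"] assms(1)
    by (auto simp: has_field_derivative_iff intro: tendsto_within_subset)
  moreover have "\<forall>\<^sub>F t in at_right 0. (?\<psi> t - ?\<psi> 0) / t \<le> F z - F y"
    unfolding eventually_at_right_field
  proof (intro exI conjI allI impI)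
    fix t :: real assume t: "0 < t" "t < 1"
    have "(1 - t) *\<^sub>R y + t *\<^sub>R z = y + t *\<^sub>R (z - y)" by (simp add: algebra_simps)
    then have "?\<psi> t \<le> (1 - t) * F y + t * F z"
      using F_convex_ineq(2)[OF assms, of t] t by simp
    moreover have "a - F y \<le> (F z - F y) * t" if "a \<le> (1 - t) * F y + t * F z" for a
      using that by (simp add: algebra_simps)
    ultimately have "?\<psi> t - ?\<psi> 0 \<le> (F z - F y) * t" by simp
    then show "(?\<psi> t - ?\<psi> 0) / t \<le> F z - F y" using t by (simp add: pos_divide_le_eq)
  qed simp
  ultimately have "gradient f y \<bullet> (z - y) \<le> F z - F y"
    by (rule tendsto_upperbound) simp
  then show ?thesis by simp
qed

text \<open>A segment cannot leave the open domain while the function stays bounded along it: at the first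
  exit point the value is infinite, and lower semicontinuity would force the values before it to be
  unbounded. This is what keeps the iterates in the domain.\<close>
lemma segment_in_edom:
  assumes y: "y \<in> edom f" and \<tau>: "0 \<le> \<tau>"
    and bound: "\<And>t. 0 \<le> t \<Longrightarrow> t \<le> \<tau> \<Longrightarrow> (\<And>r. 0 \<le> r \<Longrightarrow> r \<le> t \<Longrightarrow> y + r *\<^sub>R v \<in> edom f) \<Longrightarrow> F (y + t *\<^sub>R v) \<le> B"
    and t: "0 \<le> t" "t \<le> \<tau>"
  shows "y + t *\<^sub>R v \<in> edom f"
proof (rule ccontr)
  assume not: "y + t *\<^sub>R v \<notin> edom f"
  define S where "S = {0..\<tau>} \<inter> (\<lambda>t. y + t *\<^sub>R v) -` (- edom f)"
  have "closed ((\<lambda>t. y + t *\<^sub>R v) -` (- edom f))"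
    by (intro closed_vimage continuous_intros) (use open_edom in \<open>simp add: closed_def\<close>)
  then have "compact S" unfolding S_def by (intro compact_Int_closed) auto
  moreover have "S \<noteq> {}" using not t by (auto simp: S_def)
  ultimately obtain t0 where t0: "t0 \<in> S" "\<And>t. t \<in> S \<Longrightarrow> t0 \<le> t"
    using compact_attains_inf[of S] by auto
  have dom: "y + r *\<^sub>R v \<in> edom f" if "0 \<le> r" "r < t0" for r
    using that t0 by (force simp: S_def)
  have pos: "0 < t0" using t0(1) y by (cases "t0 = 0") (auto simp: S_def)
  have v: "v \<noteq> 0" using t0(1) y by (auto simp: S_def)
  have "f (y + t0 *\<^sub>R v) = \<infinity>" using t0(1) by (auto simp: S_def edom_def)
  then have "ereal B < Liminf (at (y + t0 *\<^sub>R v)) f" using lsc[of "y + t0 *\<^sub>R v"] by simp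
  then have "\<forall>\<^sub>F z in at (y + t0 *\<^sub>R v). ereal B < f z" by (rule less_LiminfD)
  moreover have "filterlim (\<lambda>t. y + t *\<^sub>R v) (at (y + t0 *\<^sub>R v)) (at_left t0)"
    unfolding filterlim_at using v
    by (auto intro!: tendsto_eq_intros simp: eventually_at_filter)
  ultimately have "\<forall>\<^sub>F t in at_left t0. ereal B < f (y + t *\<^sub>R v)" by (auto simp: filterlim_iff)
  moreover have "\<forall>\<^sub>F t in at_left t0. t \<in> {0<..<t0}" using pos by (intro eventually_at_leftI) auto
  ultimately have "\<forall>\<^sub>F t in at_left t0. False"
  proof eventually_elim
    case (elim t)
    then have "F (y + t *\<^sub>R v) \<le> B" using t0(1) by (intro bound dom) (auto simp: S_def)
    moreover have "f (y + t *\<^sub>R v) = ereal (F (y + t *\<^sub>R v))" using elim by (intro ereal_F dom) auto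
    ultimately show ?case using elim(1) by (metis ereal_less_eq(3) not_less)
  qed
  then show False by simp
qed
end

text \<open>A Gronwall argument: for \<open>\<nu> = 2\<close> the function \<open>\<phi>(r) exp(-K r)\<close> decreases, and for \<open>\<nu> > 2\<close> the function
  \<open>\<phi>(r)\<^bsup>-p\<^esup> + p K r\<close> with \<open>p = (\<nu> - 2)/2\<close> increases.\<close>
lemma curvature_growth:
  fixes \<phi> \<phi>' :: "real \<Rightarrow> real"
  assumes nu: "2 \<le> \<nu>" "\<nu> \<le> 3" and t: "0 \<le> t"
    and pos: "\<And>r. 0 \<le> r \<Longrightarrow> r \<le> t \<Longrightarrow> 0 < \<phi> r"
    and deriv: "\<And>r. 0 \<le> r \<Longrightarrow> r \<le> t \<Longrightarrow> (\<phi> has_real_derivative \<phi>' r) (at r)"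
    and bound: "\<And>r. 0 \<le> r \<Longrightarrow> r \<le> t \<Longrightarrow> \<phi>' r \<le> K * \<phi> r * rpow (sqrt (\<phi> r)) (\<nu> - 2)"
    and m: "m = (if \<nu> = 2 then K else (\<nu> - 2) / 2 * K * rpow (sqrt (\<phi> 0)) (\<nu> - 2))"
    and adm: "admissible \<nu> m t"
  shows "\<phi> t \<le> \<phi> 0 * model_curvature \<nu> m t"
proof (cases "\<nu> = 2")
  case True
  have "\<phi> t * exp (- K * t) \<le> \<phi> 0 * exp (- K * 0)"
  proof (rule DERIV_nonpos_imp_nonincreasing[OF t, where f = "\<lambda>r. \<phi> r * exp (- K * r)"], intro exI conjI)
    fix r assume r: "0 \<le> r" "r \<le> t"
    show "((\<lambda>r. \<phi> r * exp (- K * r)) has_real_derivative (\<phi>' r * exp (- K * r) + exp (- K * r) * (- K) * \<phi> r)) (at r)"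
      by (intro DERIV_mult deriv r) (auto intro!: derivative_eq_intros)
    have "\<phi>' r * exp (- K * r) + exp (- K * r) * (- K) * \<phi> r = (\<phi>' r - K * \<phi> r) * exp (- K * r)"
      by (simp add: algebra_simps)
    also have "\<dots> \<le> 0" using bound[OF r] True by (intro mult_nonpos_nonneg) (auto simp: rpow_def)
    finally show "\<phi>' r * exp (- K * r) + exp (- K * r) * (- K) * \<phi> r \<le> 0" .
  qed
  then show ?thesis using True m by (simp add: model_curvature_def exp_minus field_simps)
next
  case False
  define p where "p = (\<nu> - 2) / 2"
  have p: "0 < p" using False nu by (simp add: p_def)
  have rp: "rpow (sqrt (\<phi> r)) (\<nu> - 2) = \<phi> r powr p" if "0 \<le> r" "r \<le> t" for r
    using False pos[OF that] by (simp add: rpow_def p_def powr_half_sqrt[symmetric] powr_powr)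
  have "\<phi> 0 powr (- p) + p * K * 0 \<le> \<phi> t powr (- p) + p * K * t"
  proof (rule DERIV_nonneg_imp_nondecreasing[OF t, where f = "\<lambda>r. \<phi> r powr (- p) + p * K * r"], intro exI conjI)
    fix r assume r: "0 \<le> r" "r \<le> t"
    have "((\<lambda>r. \<phi> r powr (- p)) has_real_derivative (- p * \<phi> r powr (- p - 1)) * \<phi>' r) (at r)"
      by (rule DERIV_chain2[where f = "\<lambda>z. z powr (- p)"])
        (intro has_real_derivative_powr pos deriv r)+
    then show "((\<lambda>r. \<phi> r powr (- p) + p * K * r) has_real_derivative ((- p * \<phi> r powr (- p - 1)) * \<phi>' r + p * K)) (at r)"
      by (rule DERIV_add) (auto intro!: derivative_eq_intros)
    have "\<phi> r powr (- p - 1) * \<phi>' r \<le> \<phi> r powr (- p - 1) * (K * \<phi> r * \<phi> r powr p)"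
      using bound[OF r] rp[OF r] by (intro mult_left_mono) auto
    also have "\<dots> = K * (\<phi> r powr (- p - 1) * \<phi> r powr 1 * \<phi> r powr p)" using pos[OF r] by simp
    also have "\<phi> r powr (- p - 1) * \<phi> r powr 1 * \<phi> r powr p = \<phi> r powr (- p - 1 + 1 + p)"
      by (simp only: powr_add)
    also have "K * \<dots> = K" using pos[OF r] by simp
    finally have "p * (\<phi> r powr (- p - 1) * \<phi>' r) \<le> p * K" using p by (intro mult_left_mono) auto
    then show "0 \<le> (- p * \<phi> r powr (- p - 1)) * \<phi>' r + p * K" by simp
  qed
  moreover have mK: "m = p * K * \<phi> 0 powr p" using m False rp[of 0] t by (simp add: p_def)
  have "\<phi> 0 powr (- p) * (1 - m * t) = \<phi> 0 powr (- p) - p * K * t * (\<phi> 0 powr (- p) * \<phi> 0 powr p)"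
    by (simp add: mK algebra_simps)
  moreover have "\<phi> 0 powr (- p) * \<phi> 0 powr p = 1" using pos[of 0] t by (simp flip: powr_add)
  ultimately have le: "\<phi> 0 powr (- p) * (1 - m * t) \<le> \<phi> t powr (- p)" by simp
  have mt: "0 < 1 - m * t" using adm False by (simp add: admissible_def)
  have "(\<phi> t powr (- p)) powr (- 1 / p) \<le> (\<phi> 0 powr (- p) * (1 - m * t)) powr (- 1 / p)"
    using le mt pos[of 0] t p by (intro powr_mono2') auto
  moreover have "(\<phi> t powr (- p)) powr (- 1 / p) = \<phi> t" using p pos[of t] t by (simp add: powr_powr)
  moreover have "(\<phi> 0 powr (- p) * (1 - m * t)) powr (- 1 / p) = \<phi> 0 * (1 - m * t) powr (- 1 / p)"
    using p pos[of 0] t mt by (simp add: powr_mult powr_powr)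
  moreover have "- 1 / p = - 2 / (\<nu> - 2)" by (simp add: p_def)
  ultimately show ?thesis using False by (simp add: model_curvature_def)
qed

context gsc_function begin

text \<open>The parameter of the model in the form in which \<open>curvature_growth\<close> produces it.\<close>
lemma delta_FW_alt: "M * delta_FW f s \<nu> y =
   (if \<nu> = 2 then M * rpow (norm (v_FW s y)) (3 - \<nu>)
    else (\<nu> - 2) / 2 * (M * rpow (norm (v_FW s y)) (3 - \<nu>)) * rpow (sqrt (quad y (v_FW s y))) (\<nu> - 2))"
  by (simp add: delta_FW_def beta_FW_def e_FW_def local_norm_def rpow_def)

text \<open>The upper model. Positivity of the curvature is asked for only inside the domain, because membership
  of the segment in the domain is part of the conclusion.\<close>
lemma descent_along_segment:
  fixes y v :: "real ^ 'n"
  assumes y: "y \<in> edom f"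
    and pos: "\<And>r. 0 \<le> r \<Longrightarrow> r \<le> \<tau> \<Longrightarrow> y + r *\<^sub>R v \<in> edom f \<Longrightarrow> 0 < quad (y + r *\<^sub>R v) v"
    and K: "K = M * rpow (norm v) (3 - \<nu>)"
    and m: "m = (if \<nu> = 2 then K else (\<nu> - 2) / 2 * K * rpow (sqrt (quad y v)) (\<nu> - 2))" "0 < m"
    and \<tau>: "0 \<le> \<tau>" "admissible \<nu> m \<tau>"
  shows "y + \<tau> *\<^sub>R v \<in> edom f"
    "F (y + \<tau> *\<^sub>R v) \<le> F y + \<tau> * (gradient f y \<bullet> v) + quad y v * model_growth \<nu> m \<tau>"
proof -
  have adm: "admissible \<nu> m r" if "0 \<le> r" "r \<le> \<tau>" for r
    using admissible_mono[OF \<tau>(2) m(2) that(2)] .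
  have main: "F (y + t *\<^sub>R v) \<le> F y + t * (gradient f y \<bullet> v) + quad y v * model_growth \<nu> m t"
    if t: "0 \<le> t" "t \<le> \<tau>" and dom: "\<And>r. 0 \<le> r \<Longrightarrow> r \<le> t \<Longrightarrow> y + r *\<^sub>R v \<in> edom f" for t
  proof -
    have quad_le: "quad (y + r *\<^sub>R v) v \<le> quad y v * model_curvature \<nu> m r" if r: "0 \<le> r" "r \<le> t" for r
    proof -
      have "quad (y + r *\<^sub>R v) v \<le> quad (y + 0 *\<^sub>R v) v * model_curvature \<nu> m r"
      proof (rule curvature_growth[OF nu r(1), where K = K and \<phi>' = "\<lambda>r. (third_deriv f (y + r *\<^sub>R v) v *v v) \<bullet> v"])
        fix a assume a: "0 \<le> a" "a \<le> r"
        then have dom_a: "y + a *\<^sub>R v \<in> edom f" using r by (intro dom) auto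
        show pos_a: "0 < quad (y + a *\<^sub>R v) v" using a r t dom_a by (intro pos) auto
        show "((\<lambda>r. quad (y + r *\<^sub>R v) v) has_real_derivative (third_deriv f (y + a *\<^sub>R v) v *v v) \<bullet> v) (at a)"
          by (rule quad_line_deriv[OF dom_a])
        have "\<bar>(third_deriv f (y + a *\<^sub>R v) v *v v) \<bullet> v\<bar> \<le> M * (local_norm f (y + a *\<^sub>R v) v)\<^sup>2 *
          rpow (local_norm f (y + a *\<^sub>R v) v) (\<nu> - 2) * rpow (norm v) (3 - \<nu>)"
          using gsc dom_a by (auto simp: gsc_class_def)
        then have "(third_deriv f (y + a *\<^sub>R v) v *v v) \<bullet> v \<le> M * (local_norm f (y + a *\<^sub>R v) v)\<^sup>2 *
          rpow (local_norm f (y + a *\<^sub>R v) v) (\<nu> - 2) * rpow (norm v) (3 - \<nu>)" by linarith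
        then show "(third_deriv f (y + a *\<^sub>R v) v *v v) \<bullet> v
          \<le> K * quad (y + a *\<^sub>R v) v * rpow (sqrt (quad (y + a *\<^sub>R v) v)) (\<nu> - 2)"
          using pos_a by (simp add: local_norm_def K mult_ac)
      qed (use m adm r t in auto)
      then show ?thesis by simp
    qed
    have slope_le: "gradient f (y + r *\<^sub>R v) \<bullet> v \<le> gradient f y \<bullet> v + quad y v * model_slope \<nu> m r" if r: "0 \<le> r" "r \<le> t" for r
    proof -
      have "quad y v * model_slope \<nu> m 0 - gradient f (y + 0 *\<^sub>R v) \<bullet> v \<le> quad y v * model_slope \<nu> m r - gradient f (y + r *\<^sub>R v) \<bullet> v"
      proof (rule DERIV_nonneg_imp_nondecreasing[OF r(1), where f = "\<lambda>r. quad y v * model_slope \<nu> m r - gradient f (y + r *\<^sub>R v) \<bullet> v"],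
          intro exI conjI)
        fix a assume a: "0 \<le> a" "a \<le> r"
        show "((\<lambda>r. quad y v * model_slope \<nu> m r - gradient f (y + r *\<^sub>R v) \<bullet> v) has_real_derivative
            quad y v * model_curvature \<nu> m a - quad (y + a *\<^sub>R v) v) (at a)"
          using a r t by (intro DERIV_diff DERIV_cmult model_slope_deriv gradient_line_deriv nu m(2) adm dom) auto
        show "0 \<le> quad y v * model_curvature \<nu> m a - quad (y + a *\<^sub>R v) v" using quad_le[of a] a r by simp
      qed
      then show ?thesis by (simp add: model_slope_0)
    qed
    have "(0 * (gradient f y \<bullet> v) + quad y v * model_growth \<nu> m 0) - F (y + 0 *\<^sub>R v)
        \<le> (t * (gradient f y \<bullet> v) + quad y v * model_growth \<nu> m t) - F (y + t *\<^sub>R v)"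
    proof (rule DERIV_nonneg_imp_nondecreasing[OF t(1), where f = "\<lambda>t. (t * (gradient f y \<bullet> v) + quad y v * model_growth \<nu> m t) - F (y + t *\<^sub>R v)"],
        intro exI conjI)
      fix a assume a: "0 \<le> a" "a \<le> t"
      show "((\<lambda>t. (t * (gradient f y \<bullet> v) + quad y v * model_growth \<nu> m t) - F (y + t *\<^sub>R v)) has_real_derivative
          (1 * (gradient f y \<bullet> v) + quad y v * model_slope \<nu> m a) - gradient f (y + a *\<^sub>R v) \<bullet> v) (at a)"
        using a t by (intro DERIV_diff DERIV_add DERIV_cmult DERIV_cmult_right DERIV_ident model_growth_deriv F_line_deriv nu m(2) adm dom) auto
      show "0 \<le> (1 * (gradient f y \<bullet> v) + quad y v * model_slope \<nu> m a) - gradient f (y + a *\<^sub>R v) \<bullet> v"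
        using slope_le[OF a] by simp
    qed
    then show ?thesis by (simp add: model_growth_0)
  qed
  have quad0: "0 < quad y v" using pos[of 0] \<tau> y by simp
  have "y + t *\<^sub>R v \<in> edom f" if "0 \<le> t" "t \<le> \<tau>" for t
  proof (rule segment_in_edom[OF y \<tau>(1) _ that])
    fix t assume t: "0 \<le> t" "t \<le> \<tau>" "\<And>r. 0 \<le> r \<Longrightarrow> r \<le> t \<Longrightarrow> y + r *\<^sub>R v \<in> edom f"
    have "F (y + t *\<^sub>R v) \<le> F y + t * (gradient f y \<bullet> v) + quad y v * model_growth \<nu> m t" by (rule main[OF t])
    also have "\<dots> \<le> F y + \<tau> * \<bar>gradient f y \<bullet> v\<bar> + quad y v * model_growth \<nu> m \<tau>"
    proof (intro add_mono mult_left_mono model_growth_bounds(1) nu m(2) \<tau>(2) t(1,2))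
      show "t * (gradient f y \<bullet> v) \<le> \<tau> * \<bar>gradient f y \<bullet> v\<bar>"
        using t(1,2) abs_ge_self[of "gradient f y \<bullet> v"] by (meson abs_ge_zero mult_left_mono mult_right_mono order_trans)
    qed (use quad0 in auto)
    finally show "F (y + t *\<^sub>R v) \<le> F y + \<tau> * \<bar>gradient f y \<bullet> v\<bar> + quad y v * model_growth \<nu> m \<tau>" .
  qed
  then show "y + \<tau> *\<^sub>R v \<in> edom f"
    "F (y + \<tau> *\<^sub>R v) \<le> F y + \<tau> * (gradient f y \<bullet> v) + quad y v * model_growth \<nu> m \<tau>"
    using main[of \<tau>] \<tau> by auto
qed
end

section \<open>Symmetry of the Hessian and its largest eigenvalue\<close>

text \<open>A maximizer \<open>v\<^sub>0\<close> of the quadratic form on the unit sphere is an eigenvector: the form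
  \<open>q(v\<^sub>0) |v|\<^sup>2 - q(v)\<close> is nonnegative and vanishes at \<open>v\<^sub>0\<close>, so its gradient \<open>2 z\<close> there is zero.\<close>
lemma lambda_max_rayleigh:
  fixes A :: "real ^ 'n ^ 'n"
  assumes sym: "\<And>u v. (A *v u) \<bullet> v = (A *v v) \<bullet> u"
  obtains v0 where "norm v0 = 1" "lambda_max A = (A *v v0) \<bullet> v0" "\<And>v. (A *v v) \<bullet> v \<le> lambda_max A * (norm v)\<^sup>2"
proof -
  define q where "q = (\<lambda>v. (A *v v) \<bullet> v)"
  have "continuous_on (sphere 0 1) q" unfolding q_def by (intro continuous_intros matrix_vector_mult_linear_continuous_on)
  moreover have "sphere (0 :: real ^ 'n) 1 \<noteq> {}" by simp
  ultimately obtain v0 where v0: "norm v0 = 1" "\<And>v. norm v = 1 \<Longrightarrow> q v \<le> q v0"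
    using continuous_attains_sup[of "sphere 0 1" q] by auto
  have q_scale: "q (c *\<^sub>R v) = c\<^sup>2 * q v" for c v
    by (simp add: q_def matrix_vector_mult_scaleR power2_eq_square)
  have le: "q v \<le> q v0 * (norm v)\<^sup>2" for v
  proof (cases "v = 0")
    case False
    have "q ((1 / norm v) *\<^sub>R v) \<le> q v0" using False by (intro v0(2)) simp
    then show ?thesis using False by (simp add: q_scale power_divide pos_divide_le_eq)
  qed (simp add: q_def)
  define z where "z = q v0 *\<^sub>R v0 - A *v v0"
  define c where "c = q v0 * (norm z)\<^sup>2 - q z"
  have quad: "2 * r * (norm z)\<^sup>2 \<le> r\<^sup>2 * c" for r
  proof -
    have "q (v0 - r *\<^sub>R z) \<le> q v0 * (norm (v0 - r *\<^sub>R z))\<^sup>2" by (rule le)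
    moreover have "q (v0 - r *\<^sub>R z) = q v0 - 2 * r * ((A *v v0) \<bullet> z) + r\<^sup>2 * q z"
      using sym[of z v0] by (simp add: q_def matrix_vector_mult_diff_distrib matrix_vector_mult_scaleR
          inner_diff_left inner_diff_right algebra_simps power2_eq_square)
    moreover have "(norm (v0 - r *\<^sub>R z))\<^sup>2 = 1 - 2 * r * (v0 \<bullet> z) + r\<^sup>2 * (norm z)\<^sup>2"
      using v0(1) unfolding power2_norm_eq_inner
      by (simp add: inner_diff_left inner_diff_right algebra_simps inner_commute power2_eq_square norm_eq_1)
    ultimately have "2 * r * (q v0 * (v0 \<bullet> z) - (A *v v0) \<bullet> z) \<le> r\<^sup>2 * (q v0 * (norm z)\<^sup>2 - q z)"
      by (simp add: algebra_simps)
    moreover have "(norm z)\<^sup>2 = q v0 * (v0 \<bullet> z) - (A *v v0) \<bullet> z"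
      unfolding power2_norm_eq_inner by (subst (1) z_def) (simp add: inner_diff_left)
    ultimately show ?thesis by (simp add: c_def)
  qed
  have "z = 0"
  proof (rule ccontr)
    assume "z \<noteq> 0"
    then have n: "0 < (norm z)\<^sup>2" by simp
    have "2 * (norm z)\<^sup>2 \<le> c" using quad[of 1] by simp
    then have c: "0 < c" using n by linarith
    \<comment> \<open>At this \<open>r\<close> the quadratic term is half as large as the linear one.\<close>
    have "2 * ((norm z)\<^sup>2 / c) * (norm z)\<^sup>2 \<le> ((norm z)\<^sup>2 / c)\<^sup>2 * c" by (rule quad)
    then have "2 * (norm z)\<^sup>2 * (norm z)\<^sup>2 \<le> (norm z)\<^sup>2 * (norm z)\<^sup>2" using c by (simp add: field_simps power2_eq_square)
    then show False using mult_pos_pos[OF n n] by linarith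
  qed
  then have eig: "A *v v0 = q v0 *\<^sub>R v0" by (simp add: z_def)
  have "lambda_max A = q v0"
    unfolding lambda_max_def
  proof (rule cSup_eq_maximum)
    show "q v0 \<in> {l. \<exists>v. v \<noteq> 0 \<and> A *v v = l *\<^sub>R v}" using eig v0(1) by (auto intro!: exI[of _ v0])
    fix l assume "l \<in> {l. \<exists>v. v \<noteq> 0 \<and> A *v v = l *\<^sub>R v}"
    then obtain v where v: "v \<noteq> 0" "A *v v = l *\<^sub>R v" by auto
    then have "l * (norm v)\<^sup>2 \<le> q v0 * (norm v)\<^sup>2" using le[of v] by (simp add: q_def power2_norm_eq_inner)
    then show "l \<le> q v0" using v by simp
  qed
  then show ?thesis using that[of v0] v0(1) le by (simp add: q_def)
qed

context gsc_function begin

text \<open>The mean value theorem in direction \<open>u\<close> turns the second difference into a difference of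
  gradients, which the derivative of the gradient at \<open>y\<close> controls. The left-hand side is symmetric in
  \<open>u\<close> and \<open>w\<close>, so this yields the symmetry of the Hessian.\<close>
lemma second_difference:
  assumes y: "y \<in> edom f" and e: "0 < e"
  obtains d where "0 < d" "\<And>t. 0 < t \<Longrightarrow> t < d \<Longrightarrow>
    \<bar>F (y + t *\<^sub>R u + t *\<^sub>R w) - F (y + t *\<^sub>R u) - F (y + t *\<^sub>R w) + F y - t\<^sup>2 * ((hessian f y *v w) \<bullet> u)\<bar>
      \<le> 2 * e * t\<^sup>2 * (norm u + norm w)\<^sup>2"
proof -
  define N where "N = norm u + norm w"
  have N: "0 \<le> N" "norm u \<le> N" by (auto simp: N_def)
  obtain d1 where d1: "0 < d1" "\<And>z. norm (z - y) < d1 \<Longrightarrow>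
      norm (gradient f z - gradient f y - hessian f y *v (z - y)) \<le> e * norm (z - y)"
    using gradient_has_derivative[OF y] e unfolding has_derivative_at_alt by blast
  obtain d2 where d2: "0 < d2" "ball y d2 \<subseteq> edom f" using open_edom y by (meson open_contains_ball)
  define d where "d = min d1 d2 / (N + 1)"
  have close: "norm (r *\<^sub>R u + k *\<^sub>R w) < min d1 d2" "norm (r *\<^sub>R u + k *\<^sub>R w) \<le> t * N"
    if "0 < t" "t < d" "0 \<le> r" "r \<le> t" "0 \<le> k" "k \<le> t" for t r k
  proof -
    have "norm (r *\<^sub>R u + k *\<^sub>R w) \<le> r * norm u + k * norm w"
      using norm_triangle_ineq[of "r *\<^sub>R u" "k *\<^sub>R w"] that by simp
    also have "\<dots> \<le> t * norm u + t * norm w" using that by (intro add_mono mult_right_mono) auto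
    also have "\<dots> = t * N" by (simp add: N_def distrib_left)
    finally show 1: "norm (r *\<^sub>R u + k *\<^sub>R w) \<le> t * N" .
    also have "t * N \<le> t * (N + 1)" using that by simp
    also have "\<dots> < min d1 d2" using that N by (simp add: d_def pos_less_divide_eq)
    finally show "norm (r *\<^sub>R u + k *\<^sub>R w) < min d1 d2" .
  qed
  show ?thesis
  proof
    show "0 < d" using d1 d2 N by (simp add: d_def)
    fix t assume t: "0 < t" "t < d"
    have dom: "y + k *\<^sub>R w + r *\<^sub>R u \<in> edom f" if "0 \<le> r" "r \<le> t" "k = 0 \<or> k = t" for r k
      using close(1)[OF t, of r k] that t d2(2) by (auto simp: subset_iff dist_norm norm_minus_commute add_ac)
    have grad: "norm (gradient f (y + k *\<^sub>R w + r *\<^sub>R u) - gradient f y - hessian f y *v (k *\<^sub>R w + r *\<^sub>R u)) \<le> e * (t * N)"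
      if "0 \<le> r" "r \<le> t" "k = 0 \<or> k = t" for r k
    proof -
      have "norm (gradient f (y + k *\<^sub>R w + r *\<^sub>R u) - gradient f y - hessian f y *v (y + k *\<^sub>R w + r *\<^sub>R u - y))
          \<le> e * norm (y + k *\<^sub>R w + r *\<^sub>R u - y)"
        using close(1)[OF t, of r k] that t by (intro d1(2)) (auto simp: add_ac)
      also have "\<dots> \<le> e * (t * N)" using close(2)[OF t, of r k] that t e
        by (intro mult_left_mono) (auto simp: add_ac)
      finally show ?thesis by (simp add: add_ac)
    qed
    define k where "k = (\<lambda>r. F (y + t *\<^sub>R w + r *\<^sub>R u) - F (y + 0 *\<^sub>R w + r *\<^sub>R u))"
    have "\<exists>r>0. r < t \<and> k t - k 0 = (t - 0) * (gradient f (y + t *\<^sub>R w + r *\<^sub>R u) \<bullet> u - gradient f (y + 0 *\<^sub>R w + r *\<^sub>R u) \<bullet> u)"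
      unfolding k_def by (rule MVT2[OF t(1)]) (intro DERIV_diff F_line_deriv dom; simp)
    then obtain r where r: "0 < r" "r < t"
      and kt: "k t - k 0 = t * ((gradient f (y + t *\<^sub>R w + r *\<^sub>R u) - gradient f (y + 0 *\<^sub>R w + r *\<^sub>R u)) \<bullet> u)"
      by (auto simp: inner_diff_left)
    let ?D = "gradient f (y + t *\<^sub>R w + r *\<^sub>R u) - gradient f (y + 0 *\<^sub>R w + r *\<^sub>R u) - t *\<^sub>R (hessian f y *v w)"
    have "?D = (gradient f (y + t *\<^sub>R w + r *\<^sub>R u) - gradient f y - hessian f y *v (t *\<^sub>R w + r *\<^sub>R u))
        - (gradient f (y + 0 *\<^sub>R w + r *\<^sub>R u) - gradient f y - hessian f y *v (0 *\<^sub>R w + r *\<^sub>R u))"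
      by (simp add: matrix_vector_right_distrib matrix_vector_mult_scaleR)
    then have "norm ?D \<le> e * (t * N) + e * (t * N)"
      using grad[of r t] grad[of r 0] r norm_triangle_ineq4 by (smt (verit) less_eq_real_def)
    then have "norm ?D * norm u \<le> (e * (t * N) + e * (t * N)) * N" using N e t by (intro mult_mono) auto
    then have 1: "\<bar>?D \<bullet> u\<bar> \<le> 2 * e * t * N\<^sup>2"
      using Cauchy_Schwarz_ineq2[of ?D u] by (simp add: power2_eq_square mult_ac)
    have "F (y + t *\<^sub>R u + t *\<^sub>R w) - F (y + t *\<^sub>R u) - F (y + t *\<^sub>R w) + F y = k t - k 0"
      by (simp add: k_def add_ac)
    then have "F (y + t *\<^sub>R u + t *\<^sub>R w) - F (y + t *\<^sub>R u) - F (y + t *\<^sub>R w) + F y - t\<^sup>2 * ((hessian f y *v w) \<bullet> u) = t * (?D \<bullet> u)"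
      unfolding kt by (simp add: inner_diff_left algebra_simps power2_eq_square)
    moreover have "\<bar>t * (?D \<bullet> u)\<bar> \<le> t * (2 * e * t * N\<^sup>2)" using 1 t by (simp add: abs_mult)
    ultimately show "\<bar>F (y + t *\<^sub>R u + t *\<^sub>R w) - F (y + t *\<^sub>R u) - F (y + t *\<^sub>R w) + F y - t\<^sup>2 * ((hessian f y *v w) \<bullet> u)\<bar>
      \<le> 2 * e * t\<^sup>2 * (norm u + norm w)\<^sup>2"
      by (simp add: N_def power2_eq_square mult_ac)
  qed
qed

lemma hessian_symmetric:
  assumes y: "y \<in> edom f"
  shows "(hessian f y *v u) \<bullet> w = (hessian f y *v w) \<bullet> u"
proof (rule ccontr)
  define a where "a = \<bar>(hessian f y *v u) \<bullet> w - (hessian f y *v w) \<bullet> u\<bar>"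
  define N where "N = (norm u + norm w)\<^sup>2"
  assume "(hessian f y *v u) \<bullet> w \<noteq> (hessian f y *v w) \<bullet> u"
  then have a: "0 < a" by (simp add: a_def)
  \<comment> \<open>The two expansions of the second difference differ by at most \<open>4 e N t\<^sup>2\<close>, which is less than \<open>a t\<^sup>2\<close>.\<close>
  define e where "e = a / (8 * (N + 1))"
  have N: "0 \<le> N" by (simp add: N_def)
  have e: "0 < e" using a N by (simp add: e_def)
  obtain d1 where d1: "0 < d1" "\<And>t. 0 < t \<Longrightarrow> t < d1 \<Longrightarrow>
    \<bar>F (y + t *\<^sub>R u + t *\<^sub>R w) - F (y + t *\<^sub>R u) - F (y + t *\<^sub>R w) + F y - t\<^sup>2 * ((hessian f y *v w) \<bullet> u)\<bar>
      \<le> 2 * e * t\<^sup>2 * (norm u + norm w)\<^sup>2" using second_difference[OF y e] by metis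
  obtain d2 where d2: "0 < d2" "\<And>t. 0 < t \<Longrightarrow> t < d2 \<Longrightarrow>
    \<bar>F (y + t *\<^sub>R w + t *\<^sub>R u) - F (y + t *\<^sub>R w) - F (y + t *\<^sub>R u) + F y - t\<^sup>2 * ((hessian f y *v u) \<bullet> w)\<bar>
      \<le> 2 * e * t\<^sup>2 * (norm w + norm u)\<^sup>2" using second_difference[OF y e] by metis
  define t where "t = min d1 d2 / 2"
  have t: "0 < t" "t < d1" "t < d2" using d1 d2 by (auto simp: t_def)
  have sw: "y + t *\<^sub>R w + t *\<^sub>R u = y + t *\<^sub>R u + t *\<^sub>R w" "norm w + norm u = norm u + norm w" by simp_all
  have "\<bar>t\<^sup>2 * ((hessian f y *v u) \<bullet> w) - t\<^sup>2 * ((hessian f y *v w) \<bullet> u)\<bar> \<le> 4 * e * t\<^sup>2 * N"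
    using d1(2)[OF t(1,2)] d2(2)[OF t(1,3)] unfolding sw N_def by linarith
  then have "t\<^sup>2 * a \<le> t\<^sup>2 * (4 * e * N)" by (simp add: a_def right_diff_distrib[symmetric] abs_mult mult_ac)
  then have "a \<le> 4 * e * N" using t by simp
  also have "4 * e * N = a * (N / (2 * (N + 1)))" using N by (simp add: e_def divide_simps)
  also have "\<dots> < a * 1" using a N by (intro mult_strict_left_mono) (auto simp: pos_divide_less_eq)
  finally show False by simp
qed

lemma level_set_compact:
  assumes "compact X" "x0 \<in> edom f"
  shows "compact (level_set f X x0)"
proof -
  have eq: "level_set f X x0 = X \<inter> {y. f y \<le> f x0}"
    using assms(2) by (auto simp: level_set_def edom_def)
  have "closed {y. f y \<le> f x0}"
    unfolding closed_limpt
  proof (intro allI impI)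
    fix l assume l: "l islimpt {y. f y \<le> f x0}"
    show "l \<in> {y. f y \<le> f x0}"
    proof (rule ccontr)
      assume "l \<notin> {y. f y \<le> f x0}"
      then have "f x0 < Liminf (at l) f" using lsc[of l] by auto
      then have "\<forall>\<^sub>F z in at l. f x0 < f z" by (rule less_LiminfD)
      then have "\<forall>\<^sub>F z in at l. z \<notin> {y. f y \<le> f x0}" by eventually_elim auto
      then show False using l by (simp add: islimpt_iff_eventually)
    qed
  qed
  then show ?thesis unfolding eq using assms(1) by (rule compact_Int_closed[rotated])
qed

lemma lambda_max_bounded:
  assumes X: "compact X" and x0: "x0 \<in> edom f" and cont: "continuous_on (X \<inter> edom f) (hessian f)"
  shows "bdd_above ((\<lambda>y. lambda_max (hessian f y)) ` level_set f X x0)"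
proof -
  have "continuous_on (level_set f X x0) (hessian f)"
    using cont by (rule continuous_on_subset) (auto simp: level_set_def)
  then have "bounded (hessian f ` level_set f X x0)"
    using compact_continuous_image level_set_compact[OF X x0] compact_imp_bounded by blast
  then obtain B where B: "\<And>y. y \<in> level_set f X x0 \<Longrightarrow> norm (hessian f y) \<le> B" by (auto simp: bounded_iff)
  show ?thesis
  proof (rule bdd_aboveI2)
    fix y assume y: "y \<in> level_set f X x0"
    then have dom: "y \<in> edom f" by (auto simp: level_set_def)
    obtain v0 where v0: "norm v0 = 1" "lambda_max (hessian f y) = (hessian f y *v v0) \<bullet> v0"
      using lambda_max_rayleigh[OF hessian_symmetric[OF dom]] by metis
    have "\<bar>hessian f y $ i $ j\<bar> \<le> B" for i j
      using component_le_norm_cart[of "hessian f y $ i" j] Finite_Cartesian_Product.norm_nth_le[of "hessian f y" i] B[OF y] by linarith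
    then have "onorm ((*v) (hessian f y)) \<le> real (CARD('n)) * real (CARD('n)) * B"
      by (intro onorm_le_matrix_component)
    moreover have "norm (hessian f y *v v0) \<le> onorm ((*v) (hessian f y)) * norm v0"
      by (intro onorm) simp
    moreover have "(hessian f y *v v0) \<bullet> v0 \<le> norm (hessian f y *v v0) * norm v0" by (rule norm_cauchy_schwarz)
    ultimately show "lambda_max (hessian f y) \<le> real (CARD('n)) * real (CARD('n)) * B" using v0 by simp
  qed
qed
end

section \<open>Counting iterations\<close>

lemma ln_one_minus_le:
  fixes a :: real assumes "0 < a" "a \<le> 1/2"
  shows "a \<le> - ln (1 - a)" "- ln (1 - a) \<le> 1" "- ln (1 - a) \<le> 2 * ln 2 * a"
proof -
  show "a \<le> - ln (1 - a)" using ln_le_minus_one[of "1-a"] assms by simp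
  have "convex_on {0<..} (\<lambda>x::real. - ln x)" using ln_concave by (simp add: concave_on_def)
  then have "- ln ((1 - 2*a) *\<^sub>R 1 + (2*a) *\<^sub>R (1/2::real)) \<le> (1 - 2*a) * (- ln 1) + 2*a * (- ln (1/2))"
    by (rule convex_onD) (use assms in auto)
  then show *: "- ln (1 - a) \<le> 2 * ln 2 * a" by (simp add: ln_div algebra_simps)
  have "2 * ln 2 * a \<le> 2 * ln (2::real) * (1/2)" using assms by (intro mult_left_mono) auto
  then show "- ln (1 - a) \<le> 1" using * ln_2_less_1 by linarith
qed

text \<open>Counting with an abstract potential \<open>\<Phi>\<close>: before \<open>T\<close> the optimality gap \<open>h\<close> contracts, and from \<open>T\<close> on the potential,
  which is at most \<open>1/h\<close>, grows by \<open>b\<close> in each step. The assumption on \<open>\<Phi> T\<close> says exactly that the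
  second phase is short enough for the total count.\<close>
lemma iteration_bound:
  fixes h \<Phi> :: "nat \<Rightarrow> real" and a b \<epsilon> :: real
  assumes a: "0 < a" "a \<le> 1/2" and b: "0 < b" and eps: "0 < \<epsilon>"
    and above: "\<And>j. j < n \<Longrightarrow> \<epsilon> < h j" and n: "n > 0"
    and contr: "\<And>i. i < T \<Longrightarrow> Suc i < n \<Longrightarrow> h (Suc i) \<le> (1 - a) * h i"
    and start: "T < n \<Longrightarrow> b * (1 + ln (b * h T / a) / ln (1 - a)) \<le> \<Phi> T"
    and step: "\<And>i. T \<le> i \<Longrightarrow> Suc i < n \<Longrightarrow> \<Phi> i + b \<le> \<Phi> (Suc i)"
    and top: "\<And>i. T \<le> i \<Longrightarrow> i < n \<Longrightarrow> \<Phi> i \<le> 1 / h i"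
  shows "real n \<le> ln (a / (h 0 * b)) / ln (1 - a) + 1 / (b * \<epsilon>)"
proof -
  define l where "l = - ln (1 - a)"
  have l: "a \<le> l" "l \<le> 1" "0 < l" using ln_one_minus_le[OF a] a by (auto simp: l_def)
  have pos: "0 < h j" if "j < n" for j using above[OF that] eps by simp
  have decay: "real i * l \<le> ln (h 0) - ln (h i)" if "i \<le> T" "i < n" for i
    using that
  proof (induction i)
    case (Suc i)
    have "ln (h (Suc i)) \<le> ln ((1 - a) * h i)"
      using contr[of i] Suc.prems pos[of i] pos[of "Suc i"] by simp
    also have "\<dots> = ln (h i) - l" using a pos[of i] Suc.prems by (simp add: ln_mult l_def)
    finally show ?case using Suc by (simp add: algebra_simps)
  qed simp
  have bound: "ln (a / (h 0 * b)) / ln (1 - a) = (ln (h 0) + ln b - ln a) / l"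
    using pos[of 0] n a b by (simp add: ln_div ln_mult l_def minus_divide_right[symmetric] field_simps)
  show ?thesis
  proof (cases "n - 1 \<le> T")
    case True
    have le: "real (n - 1) * l \<le> ln (h 0) - ln \<epsilon>"
      using decay[of "n-1"] True n above[of "n-1"] eps by (smt (verit) diff_less ln_le_cancel_iff zero_less_one)
    \<comment> \<open>The accuracy is reached during the contraction phase. The quantity \<open>u l / a\<close> is the term
      \<open>1 / (b \<epsilon>)\<close> times \<open>l\<close>, and \<open>ln z \<le> z - 1\<close> shows that it pays for rounding up the number of steps.\<close>
    define u where "u = a / (b * \<epsilon>)"
    have u: "u > 0" using a b eps by (simp add: u_def)
    have "ln (u * l / a) \<le> u * l / a - 1" using u l a by (intro ln_le_minus_one) auto
    moreover have "ln (u * l / a) = ln u + ln (l / a)" using u l a by (simp add: ln_mult ln_div)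
    moreover have "0 \<le> ln (l / a)" using l a by simp
    ultimately have "ln u \<le> u * l / a - l" using l by linarith
    moreover have "ln u = ln a - ln b - ln \<epsilon>" using a b eps by (simp add: u_def ln_div ln_mult)
    ultimately have "real (n - 1) * l + l \<le> ln (h 0) + ln b - ln a + u * l / a" using le by linarith
    then have "real n * l \<le> ln (h 0) + ln b - ln a + u * l / a" using n by (simp add: of_nat_diff algebra_simps)
    then have "real n \<le> (ln (h 0) + ln b - ln a + u * l / a) / l" using l by (simp add: pos_le_divide_eq)
    also have "\<dots> = (ln (h 0) + ln b - ln a) / l + 1 / (b * \<epsilon>)"
      using l a by (simp add: u_def add_divide_distrib)
    finally show ?thesis using bound by simp
  next
    case False
    have Tn: "T < n" using False by simp
    have grow: "\<Phi> T + real j * b \<le> \<Phi> (T + j)" if "T + j < n" for j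
      using that
    proof (induction j)
      case (Suc j)
      then show ?case using step[of "T + j"] by (simp add: algebra_simps)
    qed simp
    have "\<Phi> T + real (n - 1 - T) * b \<le> \<Phi> (n - 1)" using grow[of "n - 1 - T"] False by simp
    also have "\<dots> \<le> 1 / h (n - 1)" using top[of "n-1"] False n by simp
    also have "\<dots> \<le> 1 / \<epsilon>" using above[of "n-1"] n eps by (intro divide_left_mono) (auto intro!: mult_pos_pos pos)
    finally have "b * (1 + ln (b * h T / a) / ln (1 - a)) + real (n - 1 - T) * b \<le> 1 / \<epsilon>"
      using start False by (smt (verit) One_nat_def diff_le_self le_add_diff_inverse not_le_imp_less less_le_trans)
    then have "1 + ln (b * h T / a) / ln (1 - a) + real (n - 1 - T) \<le> 1 / (b * \<epsilon>)"
      using b eps by (simp add: field_simps)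
    moreover have "ln (b * h T / a) / ln (1 - a) = - ((ln b + ln (h T) - ln a) / l)"
      using pos[OF Tn] a b by (simp add: ln_div ln_mult l_def)
    moreover have "real T \<le> (ln (h 0) - ln (h T)) / l"
      using decay[of T] False l by (simp add: pos_le_divide_eq)
    moreover have "real n = 1 + real (n - 1 - T) + real T" using False by simp
    ultimately have "real n \<le> 1 / (b * \<epsilon>) + (ln b + ln (h T) - ln a) / l + (ln (h 0) - ln (h T)) / l"
      by linarith
    then show ?thesis using bound by (simp add: diff_divide_distrib add_divide_distrib)
  qed
qed

text \<open>Here the potential is \<open>1/h\<close> itself, and \<open>T\<close> is the first step that does not contract the gap by the
  factor \<open>1 - a\<close>.\<close>
lemma standard_iteration_bound:
  fixes h :: "nat \<Rightarrow> real" and a b \<epsilon> :: real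
  assumes a: "0 < a" "a \<le> 1/2" and b: "0 < b" and eps: "0 < \<epsilon>" and n: "0 < n"
    and above: "\<And>i. i < n \<Longrightarrow> \<epsilon> < h i"
    and decrease: "\<And>i. i < n \<Longrightarrow> h (Suc i) \<le> h i - min (a * h i) (b * (h i)\<^sup>2)"
  shows "real n \<le> ln (a / (h 0 * b)) / ln (1 - a) + 1 / (b * \<epsilon>)"
proof -
  have pos: "0 < h i" if "i < n" for i using above[OF that] eps by simp
  \<comment> \<open>If every step contracts, then \<open>T = n\<close>.\<close>
  define T where "T = (LEAST i. h (Suc i) > (1 - a) * h i \<or> n \<le> i)"
  have T: "h (Suc T) > (1 - a) * h T \<or> n \<le> T" unfolding T_def by (rule LeastI[of _ n]) simp
  have bhT: "b * h T < a" if "T < n"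
  proof -
    have "min (a * h T) (b * (h T)\<^sup>2) < a * h T"
      using T decrease[OF that] that by (auto simp: algebra_simps)
    then have "b * (h T)\<^sup>2 < a * h T" by linarith
    then show ?thesis using pos[OF that] by (simp add: power2_eq_square)
  qed
  have small: "b * h i < a" if "T \<le> i" "i < n" for i
    using that
  proof (induction i rule: dec_induct)
    case base then show ?case by (rule bhT)
  next
    case (step i)
    have "h (Suc i) \<le> h i" using decrease[of i] step.prems a b pos[of i] by (smt (verit) Suc_lessD min_def mult_pos_pos zero_less_power)
    then have "b * h (Suc i) \<le> b * h i" using b by (intro mult_left_mono) auto
    then show ?case using step by simp
  qed
  show ?thesis
  proof (rule iteration_bound[OF a b eps above n, where T = T and \<Phi> = "\<lambda>i. 1 / h i"])
    fix i assume "i < T"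
    then show "h (Suc i) \<le> (1 - a) * h i" using not_less_Least[of i "\<lambda>i. h (Suc i) > (1 - a) * h i \<or> n \<le> i"]
      by (auto simp: T_def)
  next
    assume T: "T < n"
    define c where "c = a / (b * h T)"
    have c: "1 < c" using bhT[OF T] b pos[OF T] by (simp add: c_def)
    have "ln (b * h T / a) = - ln c" using a b pos[OF T] by (simp add: c_def ln_div ln_mult)
    moreover have "ln c / - ln (1 - a) \<le> (c - 1) / a"
      using ln_le_minus_one[of c] c a ln_one_minus_le(1)[OF a] by (intro frac_le) auto
    ultimately have "b * (1 + ln (b * h T / a) / ln (1 - a)) \<le> b * (1 + (c - 1) / a)"
      using b by (intro mult_left_mono) auto
    also have "\<dots> = 1 / h T - b * (1 / a - 1)" using a b pos[OF T] by (simp add: c_def field_simps)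
    also have "\<dots> \<le> 1 / h T" using a b by simp
    finally show "b * (1 + ln (b * h T / a) / ln (1 - a)) \<le> 1 / h T" .
  next
    fix i assume i: "T \<le> i" "Suc i < n"
    then have hi: "0 < h i" "b * h i < a" using pos[of i] small[of i] by auto
    have "b * (h i)\<^sup>2 \<le> a * h i" using hi by (simp add: power2_eq_square)
    then have le: "h (Suc i) \<le> h i * (1 - b * h i)" using decrease[of i] i
      by (simp add: min_absorb2 power2_eq_square algebra_simps)
    have "(1 / h i + b) * h (Suc i) \<le> (1 / h i + b) * (h i * (1 - b * h i))"
      using le hi b by (intro mult_left_mono) auto
    also have "\<dots> = 1 - (b * h i)\<^sup>2" using hi by (simp add: field_simps power2_eq_square)
    also have "\<dots> \<le> 1" by simp
    finally show "1 / h i + b \<le> 1 / h (Suc i)" using pos[OF i(2)] by (simp add: pos_le_divide_eq)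
  qed auto
qed

section \<open>The potential for the cubic case\<close>

lemma nonneg_of_endpoints:
  fixes c d x l u :: real
  assumes "l \<le> x" "x \<le> u" "0 \<le> c + d * l" "0 \<le> c + d * u"
  shows "0 \<le> c + d * x"
proof (cases "0 \<le> d")
  case True then show ?thesis using assms mult_left_mono[of l x d] by linarith
next
  case False then show ?thesis using assms mult_left_mono_neg[of x u d] by linarith
qed

lemma ln2_lower: "277/400 \<le> ln (2::real)"
  using ln_approx_bounds[of 2 3] by (simp add: eval_nat_numeral)

text \<open>The difference of both sides vanishes at 0 and has derivative \<open>y\<^sup>3 / ((1 + y) (3 + 2 y)\<^sup>2)\<close>. The
  right-hand side is the normalized gain of a step for \<open>\<nu> = 3\<close>.\<close>
lemma sub_ln_lower:
  fixes y :: real assumes "0 \<le> y"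
  shows "3 * y\<^sup>2 / (6 + 4 * y) \<le> y - ln (1 + y)"
proof -
  define F where "F = (\<lambda>y::real. y - ln (1 + y) - 3 * y\<^sup>2 / (6 + 4 * y))"
  have "\<exists>D. (F has_real_derivative D) (at x) \<and> 0 \<le> D" if "0 \<le> x" "x \<le> y" for x
  proof (intro exI conjI)
    define u v where "u = 1 + x" and "v = 3 + 2 * x"
    have uv: "u > 0" "v > 0" and subst: "v = 2 * u + 1" "x = u - 1" using that by (auto simp: u_def v_def)
    have "1 - 1 / u - (6 * x * (2 * v) - 3 * x\<^sup>2 * 4) / ((2 * v) * (2 * v)) = x^3 / (u * v\<^sup>2)"
      using uv by (simp add: divide_simps, unfold subst, simp add: algebra_simps eval_nat_numeral)
    then have "1 - 1 / (1 + x) - (6 * x * (6 + 4 * x) - 3 * x\<^sup>2 * 4) / ((6 + 4 * x) * (6 + 4 * x))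
        = x^3 / ((1 + x) * (3 + 2*x)\<^sup>2)"
      by (simp add: u_def v_def)
    moreover have "(F has_real_derivative (1 - 1 / (1 + x)
        - (6 * x * (6 + 4 * x) - 3 * x\<^sup>2 * 4) / ((6 + 4 * x) * (6 + 4 * x)))) (at x)"
      unfolding F_def using that by (auto intro!: derivative_eq_intros)
    ultimately show "(F has_real_derivative (x^3 / ((1 + x) * (3 + 2*x)\<^sup>2))) (at x)" by simp
    show "0 \<le> x^3 / ((1 + x) * (3 + 2*x)\<^sup>2)" using that by simp
  qed
  then have "F 0 \<le> F y" by (rule DERIV_nonneg_imp_nondecreasing[OF assms])
  then show ?thesis by (simp add: F_def)
qed

text \<open>The expression is affine in \<open>\<alpha>\<close>, and at \<open>\<alpha> = 0\<close> and \<open>\<alpha> = 1\<close> it is affine in \<open>w\<close> with a slope of known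
  sign. This leaves one polynomial in \<open>H\<close> for each end point, which is bounded below by comparing
  the powers of \<open>H\<close> with each other and with their tangents near the minimizer. The weight 7/10 of the second term of the
  potential makes both polynomials positive, \<open>\<phi>\<close> is an affine lower bound for \<open>3 (1 + H) / (3 + 2 H)\<close>, and
  123/200 is an upper bound for \<open>2 (1 - ln 2)\<close>.\<close>
lemma potential_polynomial:
  fixes \<alpha> w H b :: real
  assumes \<alpha>: "0 \<le> \<alpha>" "\<alpha> \<le> 1" and w: "1/2 \<le> w" "w \<le> 1" and H: "0 \<le> H" "H \<le> 1"
  defines "\<phi> \<equiv> 1 + H / 5" and "b \<equiv> 123 / 200"
  shows "0 \<le> w - 1/2 - \<alpha> * w / 2 + \<phi> * (5/8 - w/4) + (7/10) * H^3 * \<phi> * (1 - 3/4 * \<alpha> * \<phi>)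
             - (1 - \<alpha> * \<phi> / 2) * b * (w + H)"
proof -
  have H2: "H\<^sup>2 \<ge> 2 * x * H - x\<^sup>2" for x :: real
    using zero_le_power2[of "H - x"] by (simp add: power2_eq_square algebra_simps)
  have H3: "H^3 \<ge> 3 * x\<^sup>2 * H - 2 * x^3" if "0 \<le> x" for x :: real
  proof -
    have "0 \<le> (H - x)\<^sup>2 * (H + 2 * x)" using that H by simp
    also have "\<dots> = H^3 - (3 * x\<^sup>2 * H - 2 * x^3)" by (simp add: power2_eq_square power3_eq_cube algebra_simps)
    finally show ?thesis by simp
  qed
  have H4: "H^4 \<le> H^3" using H by (intro power_decreasing) auto
  have H5: "H^5 \<le> H^3" using H by (intro power_decreasing) auto
  have H4': "0 \<le> H^4" using H by simp
  have zero: "0 \<le> -1/2 + \<phi> * 5/8 + (7/10) * H^3 * \<phi> - b * H + (1 - \<phi>/4 - b) * w"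
  proof -
    have "-1/2 + \<phi> * 5/8 + (7/10) * H^3 * \<phi> - b * H + (1 - \<phi>/4 - b) * (1/2)
        = 77/400 - 103/200 * H + 7/10 * H^3 + 7/50 * H^4"
      unfolding \<phi>_def b_def by (simp add: field_simps eval_nat_numeral)
    also have "0 \<le> \<dots>" using H3[of "1/2"] H4' H by (simp add: power2_eq_square power3_eq_cube)
    finally have 1: "0 \<le> -1/2 + \<phi> * 5/8 + (7/10) * H^3 * \<phi> - b * H + (1 - \<phi>/4 - b) * (1/2)" .
    have "0 \<le> 1 - \<phi>/4 - b" using H by (simp add: \<phi>_def b_def)
    then have "(1 - \<phi>/4 - b) * (1/2) \<le> (1 - \<phi>/4 - b) * w" using w by (intro mult_left_mono) auto
    then show ?thesis using 1 by linarith
  qed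
  have one: "0 \<le> -1/2 + \<phi> * 5/8 + (7/10) * H^3 * \<phi> * (1 - 3/4 * \<phi>) - (1 - \<phi>/2) * b * H
               + (1/2 - \<phi>/4 - (1 - \<phi>/2) * b) * w"
  proof -
    have "-1/2 + \<phi> * 5/8 + (7/10) * H^3 * \<phi> * (1 - 3/4 * \<phi>) - (1 - \<phi>/2) * b * H
               + (1/2 - \<phi>/4 - (1 - \<phi>/2) * b) * 1
        = 27/400 - 171/1000 * H + 123/2000 * H\<^sup>2 + 7/40 * H^3 - 7/100 * H^4 - 21/1000 * H^5"
      unfolding \<phi>_def b_def by (simp add: field_simps eval_nat_numeral)
    also have "0 \<le> \<dots>" using H2[of "3/5"] H3[of "3/5"] H4 H5 H by (simp add: power2_eq_square power3_eq_cube)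
    finally have 1: "0 \<le> -1/2 + \<phi> * 5/8 + (7/10) * H^3 * \<phi> * (1 - 3/4 * \<phi>) - (1 - \<phi>/2) * b * H
               + (1/2 - \<phi>/4 - (1 - \<phi>/2) * b) * 1" .
    have "1/2 - \<phi>/4 - (1 - \<phi>/2) * b = (1/2 - \<phi>/4) * (1 - 2 * b)" by (simp add: algebra_simps)
    also have "\<dots> \<le> 0" using H by (intro mult_nonneg_nonpos) (auto simp: \<phi>_def b_def)
    finally have "(1/2 - \<phi>/4 - (1 - \<phi>/2) * b) * 1 \<le> (1/2 - \<phi>/4 - (1 - \<phi>/2) * b) * w"
      using w by (intro mult_left_mono_neg) auto
    then show ?thesis using 1 by linarith
  qed
  let ?c = "-1/2 + \<phi> * 5/8 + (7/10) * H^3 * \<phi> - b * H + (1 - \<phi>/4 - b) * w"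
  let ?d = "- w / 2 - (7/10) * H^3 * \<phi> * (3/4 * \<phi>) + \<phi> / 2 * b * (w + H)"
  have "0 \<le> ?c + ?d * 0" using zero by simp
  moreover have "0 \<le> ?c + ?d * 1" using one by (simp add: field_simps)
  ultimately have "0 \<le> ?c + ?d * \<alpha>" using \<alpha> by (intro nonneg_of_endpoints[of 0 \<alpha> 1]) auto
  moreover have "?c + ?d * \<alpha> = w - 1/2 - \<alpha> * w / 2 + \<phi> * (5/8 - w/4) + (7/10) * H^3 * \<phi> * (1 - 3/4 * \<alpha> * \<phi>)
             - (1 - \<alpha> * \<phi> / 2) * b * (w + H)"
    by (simp add: algebra_simps add_divide_distrib diff_divide_distrib)
  ultimately show ?thesis by simp
qed

text \<open>The weight \<open>3/4 + Q/2\<close> rewards steps that increase the spread \<open>Q \<le> 1/2\<close>; at the largest spread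
  it equals 1. The second term only matters while \<open>\<mu> h\<close> is of order 1, where the gain of a step is
  noticeably smaller than for a quadratic function.\<close>
definition potential :: "real \<Rightarrow> real \<Rightarrow> real \<Rightarrow> real" where
  "potential \<mu> h Q = (3/4 + Q/2) / h - 7/10 * \<mu>^3 * h\<^sup>2"

text \<open>The expression decreases in \<open>w\<close> and in \<open>Q\<close>, so \<open>w\<close> may be raised to at least 1/2 and then \<open>Q\<close> to \<open>1 - w\<close>,
  which is the case of \<open>potential_polynomial\<close>.\<close>
lemma potential_step_inequality:
  fixes \<alpha> w Q H b :: real
  assumes \<alpha>: "0 \<le> \<alpha>" "\<alpha> \<le> 1" and w: "0 \<le> w" "w + Q \<le> 1" and Q: "0 \<le> Q" "Q \<le> 1/2"
    and H: "0 \<le> H" "H \<le> 1"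
  defines "\<phi> \<equiv> 1 + H / 5" and "b \<equiv> 123 / 200"
  defines "d \<equiv> \<alpha> * \<phi> / 2"
  shows "0 \<le> ((1 - \<alpha>) * w - Q) / 2 + \<phi> / 2 * (3/4 + Q/2) + (7/10) * H^3 * (\<phi> / 2) * (2 - 3 * d)
             - (1 - d) * b * (w + H)"
proof -
  have phi: "1 \<le> \<phi>" "\<phi> \<le> 6/5" using H by (auto simp: \<phi>_def)
  define W where "W = max w (1/2)"
  have W: "1/2 \<le> W" "W \<le> 1" "w \<le> W" "Q \<le> 1 - W" using w Q by (auto simp: W_def)
  have "0 \<le> (1/2 - \<phi>/4) * ((1 - W) - Q)" using W phi by (intro mult_nonneg_nonneg) auto
  moreover have "0 \<le> ((1 - \<alpha>) / 2 - (1 - d) * b) * (w - W)"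
  proof (rule mult_nonpos_nonpos)
    have "d \<le> \<alpha>" using \<alpha> phi mult_left_mono[of "\<phi> / 2" 1 \<alpha>] by (simp add: d_def)
    then have "(1 - \<alpha>) * b \<le> (1 - d) * b" by (intro mult_right_mono) (auto simp: b_def)
    moreover have "(1 - \<alpha>) / 2 \<le> (1 - \<alpha>) * b" using \<alpha> by (simp add: b_def)
    ultimately show "(1 - \<alpha>) / 2 - (1 - d) * b \<le> 0" by simp
  qed (use W in simp)
  moreover have "0 \<le> W - 1/2 - \<alpha> * W / 2 + \<phi> * (5/8 - W/4) + (7/10) * H^3 * \<phi> * (1 - 3/4 * \<alpha> * \<phi>)
             - (1 - \<alpha> * \<phi> / 2) * b * (W + H)"
    unfolding \<phi>_def b_def by (intro potential_polynomial) (use \<alpha> W H in auto)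
  ultimately have "0 \<le> (W - 1/2 - \<alpha> * W / 2 + \<phi> * (5/8 - W/4) + (7/10) * H^3 * \<phi> * (1 - 3/4 * \<alpha> * \<phi>)
             - (1 - \<alpha> * \<phi> / 2) * b * (W + H)) + (1/2 - \<phi>/4) * ((1 - W) - Q)
             + ((1 - \<alpha>) / 2 - (1 - d) * b) * (w - W)" by (intro add_nonneg_nonneg)
  also have "\<dots> = ((1 - \<alpha>) * w - Q) / 2 + \<phi> / 2 * (3/4 + Q/2) + (7/10) * H^3 * (\<phi> / 2) * (2 - 3 * d)
             - (1 - d) * b * (w + H)"
    unfolding d_def by (simp add: algebra_simps add_divide_distrib diff_divide_distrib)
  finally show ?thesis .
qed

text \<open>Two facts relate the step to its length \<open>\<alpha>\<close>: the relative gain \<open>d\<close> is at least \<open>\<alpha> \<phi> / 2\<close>, and conversely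
  \<open>h \<le> \<alpha> (w + H)\<close>, because a step is short only if the curvature is large compared with the gap. After
  division by \<open>\<alpha>\<close> the required increase becomes \<open>potential_step_inequality\<close>.\<close>
lemma potential_increases_short_step:
  fixes h g e w Q \<mu> h' b :: real
  assumes h: "0 < h" "h \<le> g" and e: "0 < e" "e\<^sup>2 \<le> w" and wQ: "w + Q \<le> 1" and Q: "0 \<le> Q" "Q \<le> 1/2"
    and mu: "0 < \<mu>" "\<mu> * h \<le> 1"
    and \<alpha>: "\<alpha> = g / (e\<^sup>2 + \<mu> * e * g)" "\<alpha> \<le> 1"
    and h': "0 < h'" "h' \<le> h - (\<mu> * g / e - ln (1 + \<mu> * g / e)) / \<mu>\<^sup>2"
    and b: "0 \<le> b" "b \<le> 123/200"
  shows "potential \<mu> h Q + b \<le> potential \<mu> h' ((1 - \<alpha>) * (Q + \<alpha> * w))"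
proof -
  define H where "H = \<mu> * h"
  define \<phi> where "\<phi> = 1 + H / 5"
  define d where "d = \<alpha> * \<phi> / 2"
  define y where "y = \<mu> * g / e"
  define Q' where "Q' = (1 - \<alpha>) * (Q + \<alpha> * w)"
  have g: "0 < g" using h by simp
  have w0: "0 \<le> w" using e zero_le_power2[of e] by linarith
  have e1: "e \<le> 1" using e wQ Q by (intro power2_le_imp_le[of e 1]) auto
  have H: "0 < H" "H \<le> 1" using h mu by (auto simp: H_def)
  have den: "0 < e\<^sup>2 + \<mu> * e * g" using e mu g by (intro add_pos_pos) auto
  have \<alpha>0: "0 < \<alpha>" unfolding \<alpha>(1) using den g by simp
  have phi: "1 \<le> \<phi>" "\<phi> \<le> 6/5" using H by (auto simp: \<phi>_def)
  have d: "0 < d" "d \<le> 3/5"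
    using \<alpha>0 phi \<alpha>(2) mult_mono[of \<alpha> 1 \<phi> "6/5"] by (auto simp: d_def)
  have "\<mu> * h * e \<le> \<mu> * g * 1" using h mu e e1 g by (intro mult_mono) auto
  then have y: "H \<le> y" "0 < y" using e H by (auto simp: H_def y_def pos_le_divide_eq intro!: divide_pos_pos mult_pos_pos mu g)
  \<comment> \<open>The gain of a step of length \<open>\<alpha>\<close> exceeds \<open>\<alpha> g / 2\<close> by a factor that increases with \<open>y\<close>, and \<open>y \<ge> H\<close>.\<close>
  have "\<alpha> * g * (\<phi> / 2) \<le> (y - ln (1 + y)) / \<mu>\<^sup>2"
  proof -
    have ag: "\<alpha> * g = (y\<^sup>2 / (1 + y)) / \<mu>\<^sup>2"
      using e(1) mu(1) g den add_pos_pos[OF e(1) mult_pos_pos[OF mu(1) g]] by (simp add: \<alpha>(1) y_def divide_simps) (simp add: algebra_simps power2_eq_square)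
    have "\<phi> * (3 + 2 * H) \<le> 3 + 3 * H" using H by (simp add: \<phi>_def field_simps)
    then have "\<phi> \<le> 3 * (1 + H) / (3 + 2 * H)" using H by (simp add: pos_le_divide_eq)
    also have "\<dots> \<le> 3 * (1 + y) / (3 + 2 * y)" using H y by (simp add: field_simps)
    finally have "\<phi> \<le> 3 * (1 + y) / (3 + 2 * y)" .
    then have "y\<^sup>2 / (1 + y) * (\<phi> / 2) \<le> y\<^sup>2 / (1 + y) * (3 * (1 + y) / (3 + 2 * y) / 2)"
      using y(2) by (intro mult_left_mono divide_right_mono) auto
    also have "\<dots> = 3 * y\<^sup>2 / (6 + 4 * y)" using y by (simp add: divide_simps)
    also have "\<dots> \<le> y - ln (1 + y)" using y by (intro sub_ln_lower) auto
    finally have "y\<^sup>2 / (1 + y) * (\<phi> / 2) / \<mu>\<^sup>2 \<le> (y - ln (1 + y)) / \<mu>\<^sup>2" by (rule divide_right_mono) simp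
    moreover have "x / \<mu>\<^sup>2 * (\<phi> / 2) = x * (\<phi> / 2) / \<mu>\<^sup>2" for x by simp
    ultimately show ?thesis unfolding ag by metis
  qed
  moreover have "\<alpha> * h * (\<phi> / 2) \<le> \<alpha> * g * (\<phi> / 2)" using h \<alpha>0 phi by (intro mult_right_mono mult_left_mono) auto
  moreover have "(1 - d) * h = h - \<alpha> * h * (\<phi> / 2)" by (simp add: d_def algebra_simps)
  ultimately have h'_le: "h' \<le> (1 - d) * h" using h'(2) unfolding y_def by linarith
  have h_le: "h \<le> \<alpha> * (w + H)"
  proof -
    have "g = \<alpha> * (e\<^sup>2 + \<mu> * e * g)" using den by (simp add: \<alpha>(1))
    then have "h * g = h * (\<alpha> * (e\<^sup>2 + \<mu> * e * g))" by simp
    also have "\<dots> = \<alpha> * (e\<^sup>2 * h + (\<mu> * h * g) * e)" by (simp add: algebra_simps)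
    also have "\<dots> \<le> \<alpha> * (w * g + (\<mu> * h * g) * 1)"
      using h e mu \<alpha>0 g e1 w0 by (intro mult_left_mono add_mono mult_mono) auto
    also have "\<dots> = \<alpha> * (w + H) * g" by (simp add: H_def algebra_simps)
    finally show ?thesis using g by simp
  qed
  have Q'0: "0 \<le> Q'" using Q \<alpha>0 \<alpha>(2) w0 by (simp add: Q'_def)
  have pot: "(3/4 + Q/2) + 7/10 * H^3 * (-1) + b * h \<le> (3/4 + Q'/2) / (1 - d) - 7/10 * H^3 * (1 - d)\<^sup>2"
  proof -
    define Z where "Z = (3/4 + Q'/2) / (1 - d)"
    have Q'_Z: "Q' = 2 * (Z * (1 - d)) - 3/2" using d by (simp add: Z_def)
    have "0 \<le> ((1 - \<alpha>) * w - Q) / 2 + \<phi> / 2 * (3/4 + Q/2) + (7/10) * H^3 * (\<phi> / 2) * (2 - 3 * d)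
             - (1 - d) * (123/200) * (w + H)"
      unfolding d_def \<phi>_def by (rule potential_step_inequality) (use wQ Q \<alpha>0 \<alpha>(2) H w0 in auto)
    then have "0 \<le> \<alpha> * (((1 - \<alpha>) * w - Q) / 2 + \<phi> / 2 * (3/4 + Q/2) + (7/10) * H^3 * (\<phi> / 2) * (2 - 3 * d)
             - (1 - d) * (123/200) * (w + H))" using \<alpha>0 by simp
    also have "\<dots> = (Q' - Q) / 2 + d * (3/4 + Q/2) + (7/10) * H^3 * (d * (2 - 3 * d))
        - (1 - d) * ((123/200) * (\<alpha> * (w + H)))"
      by (simp add: d_def Q'_def field_simps)
    also have "\<dots> \<le> (Q' - Q) / 2 + d * (3/4 + Q/2) + (7/10) * H^3 * (d * ((2 - d) * (1 - d))) - (1 - d) * (b * h)"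
    proof -
      have "d * (2 - 3 * d) \<le> d * ((2 - d) * (1 - d))"
        using d by (intro mult_left_mono) (auto simp: algebra_simps)
      moreover have "b * h \<le> (123/200) * (\<alpha> * (w + H))" using b h_le h(1) by (intro mult_mono) auto
      ultimately show ?thesis using d H by (intro diff_mono add_mono mult_left_mono) auto
    qed
    also have "\<dots> = (Z - 7/10 * H^3 * (1 - d)\<^sup>2 - ((3/4 + Q/2) + 7/10 * H^3 * (-1) + b * h)) * (1 - d)"
      unfolding Q'_Z by (simp add: field_simps power2_eq_square)
    finally have "0 \<le> Z - 7/10 * H^3 * (1 - d)\<^sup>2 - ((3/4 + Q/2) + 7/10 * H^3 * (-1) + b * h)"
      using d by (simp add: zero_le_mult_iff)
    then show ?thesis by (simp add: Z_def)
  qed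
  have "potential \<mu> h Q + b = ((3/4 + Q/2) + 7/10 * H^3 * (-1) + b * h) / h"
    using h(1) by (simp add: potential_def H_def field_simps eval_nat_numeral)
  also have "\<dots> \<le> ((3/4 + Q'/2) / (1 - d) - 7/10 * H^3 * (1 - d)\<^sup>2) / h"
    using pot h(1) by (intro divide_right_mono) auto
  also have "\<dots> = (3/4 + Q'/2) / ((1 - d) * h) - 7/10 * \<mu>^3 * ((1 - d) * h)\<^sup>2"
    using h(1) d by (simp add: H_def field_simps eval_nat_numeral)
  also have "\<dots> \<le> (3/4 + Q'/2) / h' - 7/10 * \<mu>^3 * h'\<^sup>2"
    using h'_le h'(1) Q'0 mu d h(1)
    by (intro diff_mono divide_left_mono mult_left_mono power_mono mult_pos_pos) auto
  finally show ?thesis by (simp add: potential_def Q'_def)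
qed

text \<open>A full step resets the spread to 0 but halves the gap: the potential rises from at most \<open>1/h\<close> to at
  least \<open>(3/4) (2/h) - \<dots>\<close>, a surplus of \<open>1/(2h) \<ge> b\<close>.\<close>
lemma potential_increases_full_step:
  fixes h h' Q \<mu> b :: real
  assumes "0 < h'" "h' \<le> h / 2" "0 \<le> Q" "Q \<le> 1/2" "0 < \<mu>" "0 \<le> b" "b * h \<le> 1/2"
  shows "potential \<mu> h Q + b \<le> potential \<mu> h' 0"
proof -
  have h: "0 < h" using assms by linarith
  have "(3/4 + Q/2) / h + b = (3/4 + Q/2 + b * h) / h" using h by (simp add: field_simps)
  also have "\<dots> \<le> (3/2) / h" using h assms by (intro divide_right_mono) auto
  also have "\<dots> = (3/4) / (h / 2)" by simp
  also have "\<dots> \<le> (3/4) / h'" using assms h by (intro divide_left_mono) auto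
  finally have "(3/4 + Q/2) / h + b \<le> (3/4) / h'" .
  moreover have "7/10 * \<mu>^3 * h'\<^sup>2 \<le> 7/10 * \<mu>^3 * h\<^sup>2" using assms h by (intro mult_left_mono power_mono) auto
  ultimately show ?thesis by (simp add: potential_def)
qed

text \<open>With \<open>c = a/(b h)\<close> and the largest possible \<open>\<mu>\<close> the claim is \<open>a + (a/l) ln c \<le> (3/4) c - (7/80)/c\<^sup>2\<close> for
  \<open>c \<ge> 1/2\<close>, where \<open>l = - ln (1 - a)\<close> lies between \<open>a\<close> and \<open>2 a ln 2\<close>.\<close>
lemma potential_start:
  fixes a b \<mu> h :: real
  assumes a: "0 < a" "a \<le> 1/2" and b: "0 < b" and mu: "0 < \<mu>" "2 * a * \<mu> \<le> b" and h: "0 < h" "b * h \<le> 2 * a"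
  shows "b * (1 + ln (b * h / a) / ln (1 - a)) \<le> potential \<mu> h 0"
proof -
  define l where "l = - ln (1 - a)"
  have l: "a \<le> l" "l \<le> 2 * ln 2 * a" "0 < l" using ln_one_minus_le[OF a] a by (auto simp: l_def)
  define c where "c = a / (b * h)"
  have c: "0 < c" "1/2 \<le> c" using a b h by (auto simp: c_def pos_le_divide_eq)
  have h_eq: "h = a / (b * c)" using a b h by (simp add: c_def)
  have "ln (b * h / a) = - ln c" using a b h by (simp add: c_def ln_div ln_mult)
  then have lhs: "ln (b * h / a) / ln (1 - a) = ln c / l" by (simp add: l_def)
  have "a + a / l * ln c \<le> 3/4 * c - 7/80 / c\<^sup>2"
  proof (cases "1 \<le> c")
    case True
    have "a / l * ln c \<le> 1 * ln c" using a l True by (intro mult_right_mono) auto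
    \<comment> \<open>The tangent of the logarithm at 4/3, where its derivative is the coefficient 3/4 of \<open>c\<close>.\<close>
    moreover have "ln (3 * c / 4) \<le> 3 * c / 4 - 1" using c by (intro ln_le_minus_one) auto
    moreover have "ln (3 * c / 4) = ln c - ln (4/3)" using c by (simp add: ln_div ln_mult)
    moreover have "ln (4/3::real) \<le> 1/3" using ln_le_minus_one[of "4/3"] by simp
    moreover have "7/80 / c\<^sup>2 \<le> 7/80 / 1" using True by (intro divide_left_mono) auto
    ultimately show ?thesis using a by linarith
  next
    case False
    define s where "s = 2 * c"
    have s: "1 \<le> s" "s \<le> 2" using c False by (auto simp: s_def)
    have ln2: "9/13 \<le> ln (2::real)" "ln (2::real) \<le> 25/36" using ln2_lower ln2_le_25_over_36 by auto
    have "1 / (2 * ln 2) \<le> a / l" using a l by (simp add: field_simps)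
    then have "a / l * ln c \<le> 1 / (2 * ln 2) * ln c" using False c by (intro mult_right_mono_neg) auto
    also have "\<dots> = ln s / (2 * ln 2) - 1/2" using c by (simp add: s_def ln_mult add_divide_distrib)
    finally have 1: "a + a / l * ln c \<le> ln s / (2 * ln 2)" using a by linarith
    \<comment> \<open>Both sides almost meet at \<open>s = 1\<close>, so the tangent of the logarithm at 1 is used up to 8/5, and
      its tangent at 2 beyond that point.\<close>
    have "ln s / (2 * ln 2) \<le> 3/8 * s - 7/20 / s\<^sup>2"
    proof (cases "s \<le> 8/5")
      case True
      have "ln s / (2 * ln 2) \<le> (s - 1) / (2 * (9/13))"
        using ln_le_minus_one[of s] s ln2 by (intro frac_le) auto
      then have "ln s / (2 * ln 2) \<le> 13/18 * (s - 1)" by simp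
      moreover have "7/20 \<le> (3/8 * s - 13/18 * (s - 1)) * s\<^sup>2"
      proof -
        have "0 \<le> (s - 1) * (8/5 - s)" using s True by simp
        moreover have "(2 * s - 1) * (3/8 * s - 13/18 * (s - 1))
            = 25/36 * ((s - 1) * (8/5 - s)) + 7/18 - s / 72"
          by (simp add: field_simps)
        ultimately have "7/20 \<le> (2 * s - 1) * (3/8 * s - 13/18 * (s - 1))" using True by linarith
        also have "\<dots> \<le> s\<^sup>2 * (3/8 * s - 13/18 * (s - 1))"
          using zero_le_power2[of "s - 1"] True s by (intro mult_right_mono) (auto simp: power2_eq_square algebra_simps)
        finally show ?thesis by (simp add: mult.commute)
      qed
      then have "7/20 / s\<^sup>2 \<le> 3/8 * s - 13/18 * (s - 1)" using s by (simp add: pos_divide_le_eq)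
      ultimately show ?thesis by linarith
    next
      case False
      have "ln s = ln 2 + ln (s / 2)" using s by (simp add: ln_div)
      then have "ln s / (2 * ln 2) = 1/2 + ln (s / 2) / (2 * ln 2)" by (simp add: add_divide_distrib)
      moreover have "ln (s / 2) \<le> s / 2 - 1" using s by (intro ln_le_minus_one) auto
      then have "ln (s / 2) / (2 * ln 2) \<le> (s / 2 - 1) / (2 * ln 2)" by (intro divide_right_mono) auto
      moreover have "(s / 2 - 1) / (2 * ln 2) \<le> (s / 2 - 1) / (2 * (25/36))"
        using s ln2 by (intro divide_left_mono_neg) auto
      then have "(s / 2 - 1) / (2 * ln 2) \<le> (s / 2 - 1) * (18/25)" by simp
      moreover have "7/20 / s\<^sup>2 \<le> 7/20 / (8/5)\<^sup>2" using False by (intro divide_left_mono power_mono) auto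
      then have "7/20 / s\<^sup>2 \<le> 7/50" by (simp add: power2_eq_square)
      moreover have "A \<le> 3/8 * s - E" if "A = 1/2 + B" "B \<le> C" "C \<le> (s / 2 - 1) * (18/25)" "E \<le> 7/50"
        for A B C E :: real using that False by simp
      ultimately show ?thesis by blast
    qed
    moreover have "3/8 * s - 7/20 / s\<^sup>2 = 3/4 * c - 7/80 / c\<^sup>2" by (simp add: s_def power_mult_distrib)
    ultimately show ?thesis using 1 by simp
  qed
  then have "b / a * (a + a / l * ln c) \<le> b / a * (3/4 * c - 7/80 / c\<^sup>2)" using a b by (intro mult_left_mono) auto
  moreover have "b / a * (a + a / l * ln c) = b * (1 + ln c / l)" using a by (simp add: field_simps)
  moreover have "b / a * (3/4 * c - 7/80 / c\<^sup>2) = 3/4 / h - 7/10 * (b / (2 * a))^3 * h\<^sup>2"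
    using a b c by (simp add: h_eq field_simps eval_nat_numeral)
  moreover have "\<mu>^3 \<le> (b / (2 * a))^3" using mu a by (intro power_mono) (auto simp: pos_le_divide_eq mult_ac)
  then have "7/10 * \<mu>^3 * h\<^sup>2 \<le> 7/10 * (b / (2 * a))^3 * h\<^sup>2" by (intro mult_right_mono mult_left_mono) auto
  ultimately show ?thesis by (simp add: potential_def lhs)
qed

text \<open>The variance of the convex combination of the iterate \<open>T\<close> and the vertices chosen since then that
  represents the iterate \<open>T + j\<close>. A step of length \<open>\<alpha>\<close> in a direction of
  squared length \<open>w\<close> mixes in an atom of weight \<open>\<alpha>\<close>.\<close>
primrec spread :: "(nat \<Rightarrow> real) \<Rightarrow> (nat \<Rightarrow> real) \<Rightarrow> nat \<Rightarrow> nat \<Rightarrow> real" where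
  "spread \<alpha> w T 0 = 0"
| "spread \<alpha> w T (Suc j) = (1 - \<alpha> (T + j)) * (spread \<alpha> w T j + \<alpha> (T + j) * w (T + j))"

text \<open>Since \<open>w \<le> 1 - Q\<close>, a step turns \<open>Q \<le> 1/2\<close> into at most \<open>(1 - \<alpha>\<^sup>2) / 2\<close>.\<close>
lemma spread_bounds:
  assumes "\<And>i. i < n \<Longrightarrow> 0 \<le> \<alpha> i \<and> \<alpha> i \<le> 1 \<and> 0 \<le> w i"
    and "\<And>j. T + j < n \<Longrightarrow> w (T + j) + spread \<alpha> w T j \<le> 1"
    and "T + j \<le> n"
  shows "0 \<le> spread \<alpha> w T j" "spread \<alpha> w T j \<le> 1/2"
proof -
  have "0 \<le> spread \<alpha> w T j \<and> spread \<alpha> w T j \<le> 1/2" using assms(3)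
  proof (induction j)
    case (Suc j)
    define p q v where "p = \<alpha> (T + j)" and "q = spread \<alpha> w T j" and "v = w (T + j)"
    have IH: "0 \<le> q" "q \<le> 1/2" and pv: "0 \<le> p" "p \<le> 1" "0 \<le> v" "v + q \<le> 1"
      using Suc assms(1)[of "T + j"] assms(2)[of j] by (auto simp: p_def q_def v_def)
    have "(1 - p) * (q + p * v) \<le> (1 - p) * (q + p * (1 - q))"
      using pv by (intro mult_left_mono add_left_mono) auto
    also have "\<dots> = (1 - p)\<^sup>2 * q + p * (1 - p)" by (simp add: algebra_simps power2_eq_square)
    also have "\<dots> \<le> (1 - p)\<^sup>2 * (1/2) + p * (1 - p)" using IH by (intro add_right_mono mult_left_mono) auto
    also have "\<dots> = 1/2 - p\<^sup>2 / 2" by (simp add: field_simps power2_eq_square)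
    also have "\<dots> \<le> 1/2" by simp
    finally have "(1 - p) * (q + p * v) \<le> 1/2" .
    then show ?case using pv IH by (simp add: p_def q_def v_def)
  qed simp
  then show "0 \<le> spread \<alpha> w T j" "spread \<alpha> w T j \<le> 1/2" by auto
qed

text \<open>The case \<open>\<nu> = 3\<close> in units with \<open>L D\<^sup>2 = 1\<close>. The single-step estimate with the constant \<open>b/2\<close> shows that at the
  first non-contracting step \<open>T\<close> one has \<open>b h \<le> 2 a\<close> and that the step is not full. After that step
  \<open>b h \<le> 1/2\<close>, because \<open>u - u\<^sup>2/2 \<le> 1/2\<close> for every \<open>u\<close>, so full steps are harmless from then on. The spread is
  restarted at \<open>T\<close>.\<close>
lemma amortized_iteration_bound:
  fixes h g e w \<alpha> :: "nat \<Rightarrow> real" and \<mu> \<epsilon> :: real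
  defines "b \<equiv> 2 * (1 - ln 2)" and "a \<equiv> min (1/2) ((1 - ln 2) / \<mu>)"
  assumes mu: "0 < \<mu>" and eps: "0 < \<epsilon>" and n: "0 < n"
    and above: "\<And>i. i < n \<Longrightarrow> \<epsilon> < h i" and hg: "\<And>i. i < n \<Longrightarrow> h i \<le> g i"
    and e: "\<And>i. i < n \<Longrightarrow> 0 < e i \<and> (e i)\<^sup>2 \<le> w i"
    and geom: "\<And>T j. T + j < n \<Longrightarrow> w (T + j) + spread \<alpha> w T j \<le> 1"
    and \<alpha>: "\<And>i. i < n \<Longrightarrow> 0 \<le> \<alpha> i \<and> \<alpha> i \<le> 1"
    and step: "\<And>i. i < n \<Longrightarrow> (\<alpha> i = 1 \<and> h (Suc i) \<le> h i - g i / 2) \<or>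
      (\<alpha> i = g i / ((e i)\<^sup>2 + \<mu> * e i * g i) \<and>
       h (Suc i) \<le> h i - (\<mu> * g i / e i - ln (1 + \<mu> * g i / e i)) / \<mu>\<^sup>2)"
  shows "real n \<le> ln (a / (h 0 * b)) / ln (1 - a) + 1 / (b * \<epsilon>)"
proof -
  define \<kappa> where "\<kappa> = 1 - ln (2::real)"
  have kap: "0 < \<kappa>" "b = 2 * \<kappa>" "b \<le> 123/200" "0 < b"
    using ln_2_less_1 ln2_lower by (auto simp: \<kappa>_def b_def)
  have a: "0 < a" "a \<le> 1/2" "a \<le> \<kappa> / \<mu>"
    using kap(1) mu unfolding a_def \<kappa>_def[symmetric] by (auto simp: min_def)
  have amu: "a * \<mu> \<le> \<kappa>" using a(3) mu by (simp add: pos_le_divide_eq)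
  have pos: "0 < h i" "0 < g i" if "i < n" for i using above[OF that] hg[OF that] eps by auto
  have decrease: "h (Suc i) \<le> h i - min (a * h i) (\<kappa> * (h i)\<^sup>2)" if i: "i < n" for i
  proof -
    have e1: "e i \<le> 1" using e[OF i] geom[of i 0] i by (intro power2_le_imp_le[of "e i" 1]) auto
    define y where "y = \<mu> * g i / e i"
    have y: "0 < y" using mu pos[OF i] e[OF i] by (simp add: y_def)
    from step[OF i] show ?thesis
    proof
      assume *: "\<alpha> i = 1 \<and> h (Suc i) \<le> h i - g i / 2"
      have "a * h i \<le> 1/2 * g i" using a pos[OF i] hg[OF i] by (intro mult_mono) auto
      then show ?thesis using * by linarith
    next
      assume *: "\<alpha> i = g i / ((e i)\<^sup>2 + \<mu> * e i * g i) \<and>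
       h (Suc i) \<le> h i - (\<mu> * g i / e i - ln (1 + \<mu> * g i / e i)) / \<mu>\<^sup>2"
      have "min (a * h i) (\<kappa> * (h i)\<^sup>2) \<le> \<kappa> * min y (y\<^sup>2) / \<mu>\<^sup>2"
      proof (cases "1 \<le> y")
        case True
        have "a * h i * \<mu>\<^sup>2 = a * \<mu> * (\<mu> * h i)" by (simp add: power2_eq_square)
        also have "\<dots> \<le> \<kappa> * y"
        proof (rule mult_mono[OF amu])
          have "\<mu> * h i \<le> \<mu> * g i" using mu hg[OF i] by simp
          also have "\<dots> \<le> y" using e1 e[OF i] mu pos[OF i] by (simp add: y_def pos_le_divide_eq mult_left_le)
          finally show "\<mu> * h i \<le> y" .
        qed (use kap mu pos[OF i] in auto)
        also have "y = min y (y\<^sup>2)" using True by (simp add: min_absorb1 power2_eq_square)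
        finally have "a * h i \<le> \<kappa> * min y (y\<^sup>2) / \<mu>\<^sup>2" using mu by (simp add: pos_le_divide_eq)
        then show ?thesis by (rule min.coboundedI1)
      next
        case False
        have "h i \<le> g i / e i" using hg[OF i] e1 e[OF i] pos[OF i] by (simp add: pos_le_divide_eq) (smt (verit) mult_left_le)
        then have "\<kappa> * (h i)\<^sup>2 \<le> \<kappa> * (g i / e i)\<^sup>2" using kap pos[OF i] by (intro mult_left_mono power_mono) auto
        also have "\<dots> = \<kappa> * y\<^sup>2 / \<mu>\<^sup>2" using mu by (simp add: y_def power_divide power_mult_distrib)
        also have "y\<^sup>2 = min y (y\<^sup>2)" using False y by (simp add: min_absorb2 power2_eq_square mult_left_le)
        finally show ?thesis by (simp add: min.coboundedI2)
      qed
      also have "\<kappa> * min y (y\<^sup>2) \<le> y - ln (1 + y)"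
        using gain_lower_bound[of 3 y] y by (simp add: gain_def \<kappa>_def)
      finally have "min (a * h i) (\<kappa> * (h i)\<^sup>2) \<le> (y - ln (1 + y)) / \<mu>\<^sup>2"
        by (simp add: divide_right_mono)
      then show ?thesis using * unfolding y_def by linarith
    qed
  qed
  have antimono: "h (Suc i) \<le> h i" if "i < n" for i
  proof -
    have "0 \<le> min (a * h i) (\<kappa> * (h i)\<^sup>2)" using a kap pos[OF that] by simp
    then show ?thesis using decrease[OF that] by linarith
  qed
  \<comment> \<open>If every step contracts, then \<open>T = n\<close>.\<close>
  define T where "T = (LEAST i. h (Suc i) > (1 - a) * h i \<or> n \<le> i)"
  have T: "h (Suc T) > (1 - a) * h T \<or> n \<le> T" unfolding T_def by (rule LeastI[of _ n]) simp
  define Q where "Q = spread \<alpha> w T"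
  have Q: "0 \<le> Q j" "Q j \<le> 1/2" if "T + j \<le> n" for j
    unfolding Q_def using spread_bounds[of n \<alpha> w T j] that \<alpha> e geom by (auto intro: order_trans[OF zero_le_power2])
  have at_T: "\<kappa> * h T < a" "\<kappa> * (h T)\<^sup>2 \<le> h T - h (Suc T)" "\<not> (\<alpha> T = 1 \<and> h (Suc T) \<le> h T - g T / 2)" if Tn: "T < n"
  proof -
    have less: "h T - h (Suc T) < a * h T" using T Tn by (simp add: algebra_simps)
    then have "\<kappa> * (h T)\<^sup>2 < a * h T" using decrease[OF Tn] by linarith
    then show "\<kappa> * h T < a" using pos[OF Tn] by (simp add: power2_eq_square)
    show "\<kappa> * (h T)\<^sup>2 \<le> h T - h (Suc T)" using less decrease[OF Tn] by linarith
    have "a * h T \<le> 1/2 * g T" using a pos[OF Tn] hg[OF Tn] by (intro mult_mono) auto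
    then show "\<not> (\<alpha> T = 1 \<and> h (Suc T) \<le> h T - g T / 2)" using less by auto
  qed
  have muh: "\<mu> * h i \<le> 1" if "T \<le> i" "i < n" for i
    using that
  proof (induction i rule: dec_induct)
    case base
    have "\<kappa> * (h T * \<mu>) < \<kappa>" using mult_strict_right_mono[OF at_T(1)[OF base] mu] amu by simp
    then show ?case using kap by (simp add: mult.commute)
  next
    case (step i)
    have "\<mu> * h (Suc i) \<le> \<mu> * h i" using antimono[of i] step.prems mu by simp
    then show ?case using step by simp
  qed
  have bh: "b * h i \<le> 1/2" if "Suc T \<le> i" "i < n" for i
    using that
  proof (induction i rule: dec_induct)
    case base
    have Tn: "T < n" using base by simp
    have "\<kappa> * h (Suc T) \<le> \<kappa> * (h T - \<kappa> * (h T)\<^sup>2)"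
      using at_T(2)[OF Tn] kap by (intro mult_left_mono) auto
    also have "\<dots> = 1/4 - (\<kappa> * h T - 1/2)\<^sup>2" by (simp add: power2_eq_square algebra_simps)
    also have "\<dots> \<le> 1/4" by simp
    finally show ?case using kap by simp
  next
    case (step i)
    have "b * h (Suc i) \<le> b * h i" using antimono[of i] step.prems kap by simp
    then show ?case using step by simp
  qed
  show ?thesis
  proof (rule iteration_bound[OF a(1,2) kap(4) eps above n, where T = T and \<Phi> = "\<lambda>i. potential \<mu> (h i) (Q (i - T))"])
    fix i assume "i < T"
    then show "h (Suc i) \<le> (1 - a) * h i" using not_less_Least[of i "\<lambda>i. h (Suc i) > (1 - a) * h i \<or> n \<le> i"]
      by (auto simp: T_def)
  next
    assume Tn: "T < n"
    have "b * (1 + ln (b * h T / a) / ln (1 - a)) \<le> potential \<mu> (h T) 0"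
      using at_T(1)[OF Tn] kap amu pos[OF Tn] mu by (intro potential_start[OF a(1,2)]) auto
    then show "b * (1 + ln (b * h T / a) / ln (1 - a)) \<le> potential \<mu> (h T) (Q (T - T))" by (simp add: Q_def)
  next
    fix i assume i: "T \<le> i" "Suc i < n"
    then have Q_Suc: "Q (Suc i - T) = (1 - \<alpha> i) * (Q (i - T) + \<alpha> i * w i)" by (simp add: Q_def Suc_diff_le)
    have i_n: "i < n" using i by simp
    have Qi: "0 \<le> Q (i - T)" "Q (i - T) \<le> 1/2" using Q[of "i - T"] i by auto
    have Qw: "w i + Q (i - T) \<le> 1" using geom[of T "i - T"] i by (simp add: Q_def)
    from step[OF i_n]
    show "potential \<mu> (h i) (Q (i - T)) + b \<le> potential \<mu> (h (Suc i)) (Q (Suc i - T))"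
    proof
      assume full: "\<alpha> i = 1 \<and> h (Suc i) \<le> h i - g i / 2"
      have "i \<noteq> T" using full at_T(3) i_n by auto
      then have "b * h i \<le> 1/2" using bh[of i] i by simp
      moreover have "h (Suc i) \<le> h i / 2" using full hg[OF i_n] by linarith
      ultimately show ?thesis using full pos(1)[OF i(2)] Qi mu kap
        unfolding Q_Suc by (simp add: potential_increases_full_step)
    next
      assume short: "\<alpha> i = g i / ((e i)\<^sup>2 + \<mu> * e i * g i) \<and>
       h (Suc i) \<le> h i - (\<mu> * g i / e i - ln (1 + \<mu> * g i / e i)) / \<mu>\<^sup>2"
      show ?thesis unfolding Q_Suc
        by (rule potential_increases_short_step[where g = "g i" and e = "e i"])
          (use short pos[OF i_n] pos(1)[OF i(2)] hg[OF i_n] e[OF i_n] Qi Qw mu muh[OF i(1) i_n] \<alpha>[OF i_n] kap in auto)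
    qed
  next
    fix i assume i: "T \<le> i" "i < n"
    have "(3/4 + Q (i - T) / 2) / h i \<le> 1 / h i"
      using Q[of "i - T"] i pos(1)[OF i(2)] by (intro divide_right_mono) auto
    moreover have "0 \<le> 7/10 * \<mu>^3 * (h i)\<^sup>2" using mu by simp
    ultimately show "potential \<mu> (h i) (Q (i - T)) \<le> 1 / h i" unfolding potential_def by linarith
  qed
qed

section \<open>The Frank-Wolfe step\<close>

locale frank_wolfe = gsc_function f M \<nu> for f :: "real ^ 'n \<Rightarrow> ereal" and M \<nu> :: real +
  fixes X :: "(real ^ 'n) set" and s :: "real ^ 'n \<Rightarrow> real ^ 'n" and xstar x0 :: "real ^ 'n"
  assumes convex_X: "convex X" and compact_X: "compact X"
    and xstar: "is_arg_min f (\<lambda>y. y \<in> X) xstar"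
    and hessian_cont: "continuous_on (X \<inter> edom f) (hessian f)"
    and hessian_pos: "\<forall>y \<in> X \<inter> edom f. pos_def (hessian f y)"
    and lin_min: "linear_minimizer f X s"
    and x0: "x0 \<in> X \<inter> edom f"
begin

abbreviation "L \<equiv> L_grad f X x0"
abbreviation "D \<equiv> diameter X"

lemma xstar_in: "xstar \<in> X" "xstar \<in> edom f" "y \<in> X \<Longrightarrow> f xstar \<le> f y"
proof -
  show "xstar \<in> X" using xstar by (simp add: is_arg_min_def)
  show le: "f xstar \<le> f y" if "y \<in> X" for y using xstar that by (force simp: is_arg_min_def)
  show "xstar \<in> edom f" using le[of x0] x0 by (auto simp: edom_def)
qed

lemma level_set_iff: "y \<in> level_set f X x0 \<longleftrightarrow> y \<in> X \<and> y \<in> edom f \<and> F y \<le> F x0"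
proof -
  have "f y \<le> f x0 \<longleftrightarrow> F y \<le> F x0" if "y \<in> edom f"
    using ereal_F[OF that] ereal_F[of x0] x0 by (metis IntD2 ereal_less_eq(3))
  then show ?thesis by (auto simp: level_set_def)
qed

lemma Gap_eq:
  assumes "y \<in> X \<inter> edom f"
  shows "s y \<in> X" "Gap f X y = - (gradient f y \<bullet> v_FW s y)"
proof -
  have min: "is_arg_min (\<lambda>d. gradient f y \<bullet> d) (\<lambda>d. d \<in> X) (s y)"
    using lin_min assms by (simp add: linear_minimizer_def)
  then show sy: "s y \<in> X" by (simp add: is_arg_min_def)
  have "Gap f X y = gradient f y \<bullet> (y - s y)"
    unfolding Gap_def
  proof (rule cSup_eq_maximum)
    fix r assume "r \<in> (\<lambda>d. gradient f y \<bullet> (y - d)) ` X"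
    then obtain d where d: "d \<in> X" "r = gradient f y \<bullet> (y - d)" by auto
    then have "gradient f y \<bullet> s y \<le> gradient f y \<bullet> d" using min by (force simp: is_arg_min_def)
    then show "r \<le> gradient f y \<bullet> (y - s y)" using d by (simp add: inner_diff_right)
  qed (use sy in auto)
  then show "Gap f X y = - (gradient f y \<bullet> v_FW s y)" by (simp add: v_FW_def inner_diff_right)
qed

lemma optimality_gap_le_Gap:
  assumes y: "y \<in> X \<inter> edom f"
  shows "F y - F xstar \<le> Gap f X y"
proof -
  have "gradient f y \<bullet> (y - xstar) \<le> Gap f X y"
  proof -
    have min: "is_arg_min (\<lambda>d. gradient f y \<bullet> d) (\<lambda>d. d \<in> X) (s y)"
      using lin_min y by (simp add: linear_minimizer_def)
    then have "gradient f y \<bullet> s y \<le> gradient f y \<bullet> xstar" using xstar_in(1) by (force simp: is_arg_min_def)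
    then show ?thesis using Gap_eq(2)[OF y] by (simp add: v_FW_def inner_diff_right)
  qed
  moreover have "F y + gradient f y \<bullet> (xstar - y) \<le> F xstar" using y xstar_in by (intro F_above_tangent) auto
  ultimately show ?thesis by (simp add: inner_diff_right)
qed

lemma quad_pos: "y \<in> X \<inter> edom f \<Longrightarrow> v \<noteq> 0 \<Longrightarrow> 0 < quad y v"
  using hessian_pos by (auto simp: pos_def_def)

lemma quad_le:
  assumes y: "y \<in> level_set f X x0"
  shows "quad y v \<le> L * (norm v)\<^sup>2"
proof -
  have dom: "y \<in> edom f" using y by (auto simp: level_set_def)
  have "quad y v \<le> lambda_max (hessian f y) * (norm v)\<^sup>2"
    using lambda_max_rayleigh[OF hessian_symmetric[OF dom]] by metis
  also have "lambda_max (hessian f y) \<le> L"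
    unfolding L_grad_def using lambda_max_bounded[OF compact_X _ hessian_cont] x0 y by (intro cSUP_upper) auto
  finally show ?thesis by (simp add: mult_right_mono)
qed

lemma L_pos: "0 < L"
proof -
  have x0': "x0 \<in> level_set f X x0" using x0 by (simp add: level_set_def)
  have "axis undefined 1 \<noteq> (0 :: real ^ 'n)" by (simp add: axis_eq_0_iff)
  then have "0 < quad x0 (axis undefined 1)" using x0 by (intro quad_pos) auto
  also have "\<dots> \<le> L" using quad_le[OF x0', of "axis undefined 1"] by simp
  finally show ?thesis .
qed

lemma dist_le_D: "y \<in> X \<Longrightarrow> z \<in> X \<Longrightarrow> norm (y - z) \<le> D"
  using diameter_bounded_bound[OF compact_imp_bounded[OF compact_X]] by (simp add: dist_norm)

text \<open>An upper bound for the model parameter \<open>M \<delta>\<^sub>\<nu>\<close> on the level set, from which \<open>c\<^sub>1\<close> is built.\<close>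
definition m_bar :: real where
  "m_bar = (if \<nu> = 2 then M * D else (\<nu> / 2 - 1) * D * M * L powr ((\<nu> - 2) / 2))"

lemma gain_1_eq_gamma_tilde:
  assumes "\<nu> \<noteq> 2" "\<nu> \<noteq> 3"
  shows "gain \<nu> 1 = gamma_tilde \<nu>"
proof -
  define \<theta> where "\<theta> = 2 * (3 - \<nu>) / (4 - \<nu>)"
  have "1 - 1 / model_exponent \<nu> = \<theta>" using assms nu by (simp add: model_exponent_def \<theta>_def field_simps)
  then have "gain \<nu> 1 = 1 - (2 powr \<theta> - 1) / \<theta>" using assms by (simp add: gain_def)
  also have "\<dots> = 1 + 1 / \<theta> * (1 - 2 powr \<theta>)" by (simp add: diff_divide_distrib)
  also have "\<dots> = gamma_tilde \<nu>" by (simp add: gamma_tilde_def \<theta>_def)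
  finally show ?thesis .
qed

lemma c1_eq: "c1 f X x0 M \<nu> = min (1/2) (gain \<nu> 1 / m_bar)"
proof -
  consider "\<nu> = 2" | "\<nu> = 3" | "\<nu> \<noteq> 2" "\<nu> \<noteq> 3" by blast
  then show ?thesis
  proof cases
    case 1 then show ?thesis unfolding m_bar_def by (simp add: c1_def gain_def)
  next
    case 2
    then show ?thesis unfolding m_bar_def using L_pos by (simp add: c1_def gain_def powr_half_sqrt mult_ac)
  next
    case 3
    then show ?thesis by (simp add: c1_def m_bar_def gain_1_eq_gamma_tilde mult_ac)
  qed
qed

text \<open>The factor 2 at \<open>\<nu> = 3\<close> is the discrepancy between \<open>c\<^sub>2\<close> and the decrease that a single step guarantees.\<close>
lemma c2_eq: "c2 f X x0 M \<nu> = (if \<nu> = 3 then 2 else 1) * (model_exponent \<nu> * gain \<nu> 1 / (L * D\<^sup>2))"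
proof -
  consider "\<nu> = 2" | "\<nu> = 3" | "\<nu> \<noteq> 2" "\<nu> \<noteq> 3" by blast
  then show ?thesis
  proof cases
    case 1 then show ?thesis by (simp add: c2_def gain_def model_exponent_def)
  next
    case 2 then show ?thesis by (simp add: c2_def gain_def model_exponent_def)
  next
    case 3
    then have "- 1 / b_exp \<nu> = model_exponent \<nu>" using nu by (simp add: b_exp_def model_exponent_def field_simps)
    then show ?thesis using 3 by (simp add: c2_def gain_1_eq_gamma_tilde)
  qed
qed

text \<open>The step size minimizes the upper model over \<open>[0, 1]\<close>. If the unconstrained minimizer exceeds 1, the
  slope of \<open>E W\<close> at 1 is still at most \<open>g\<close>, so the curvature eats up at most half of the linear decrease.\<close>
lemma frank_wolfe_step:
  assumes y: "y \<in> level_set f X x0" and g: "0 < Gap f X y"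
  defines "v \<equiv> v_FW s y" and "\<alpha> \<equiv> alpha_FW f X s M \<nu> y"
  defines "m \<equiv> M * delta_FW f s \<nu> y" and "E \<equiv> quad y (v_FW s y)"
  shows "v \<noteq> 0" "0 < E" "0 < m" "m \<le> m_bar" "0 < D" "E \<le> L * D\<^sup>2"
    "0 < \<alpha>" "\<alpha> \<le> 1" "y + \<alpha> *\<^sub>R v \<in> X \<inter> edom f"
    "(\<alpha> = 1 \<and> F (y + \<alpha> *\<^sub>R v) \<le> F y - Gap f X y / 2) \<or>
     (\<alpha> = t_FW f X s M \<nu> y \<and>
      F (y + \<alpha> *\<^sub>R v) \<le> F y - E / (m\<^sup>2 * model_exponent \<nu>) * gain \<nu> (m * Gap f X y * model_exponent \<nu> / E))"
proof -
  define g where "g = Gap f X y"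
  have g0: "0 < g" using assms(2) by (simp add: g_def)
  have yX: "y \<in> X \<inter> edom f" using y by (auto simp: level_set_def)
  have gv: "gradient f y \<bullet> v = - g" using Gap_eq(2)[OF yX] by (simp add: g_def v_def)
  show v: "v \<noteq> 0" using gv g0 by auto
  show E: "0 < E" using quad_pos[OF yX v] by (simp add: E_def v_def)
  have norm_v: "norm v \<le> D" using dist_le_D[OF Gap_eq(1)[OF yX]] yX by (simp add: v_def v_FW_def)
  show D: "0 < D" using norm_v v by (smt (verit) zero_less_norm_iff)
  have E_le: "E \<le> L * (norm v)\<^sup>2" using quad_le[OF y] by (simp add: E_def v_def)
  also have "\<dots> \<le> L * D\<^sup>2" using norm_v L_pos by (intro mult_left_mono power_mono) auto
  finally show "E \<le> L * D\<^sup>2" .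
  define K where "K = M * rpow (norm v) (3 - \<nu>)"
  have m_alt: "m = (if \<nu> = 2 then K else (\<nu> - 2) / 2 * K * rpow (sqrt E) (\<nu> - 2))"
    unfolding m_def delta_FW_alt K_def E_def v_def by simp
  have rpow_pos: "0 < rpow z p" if "0 < z" for z p using that by (simp add: rpow_def)
  have K: "0 < K" using M_pos v by (auto simp: K_def intro!: mult_pos_pos rpow_pos)
  show m: "0 < m" using K E nu unfolding m_alt by (auto intro!: mult_pos_pos rpow_pos)
  show "m \<le> m_bar"
  proof (cases "\<nu> = 2")
    case True
    then show ?thesis unfolding m_bar_def using norm_v M_pos v by (simp add: m_alt K_def rpow_def)
  next
    case False
    define p where "p = (\<nu> - 2) / 2"
    have p: "0 < p" "3 - \<nu> = 1 - 2 * p" "\<nu> - 2 = 2 * p" using False nu by (auto simp: p_def field_simps)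
    have "rpow (sqrt E) (\<nu> - 2) = E powr p"
      using E p by (simp add: rpow_def powr_half_sqrt[symmetric] powr_powr)
    also have "\<dots> \<le> (L * (norm v)\<^sup>2) powr p" using E E_le p by (intro powr_mono2) auto
    also have "\<dots> = L powr p * norm v powr (2 * p)" using L_pos v by (simp add: powr_mult powr_powr flip: powr_numeral)
    finally have 1: "rpow (sqrt E) (\<nu> - 2) \<le> L powr p * norm v powr (2 * p)" .
    have "rpow (norm v) k = norm v powr k" for k using v by (simp add: rpow_def)
    then have 2: "rpow (norm v) (3 - \<nu>) = norm v powr (1 - 2 * p)" by (simp only: p(2))
    have "m = p * M * (rpow (norm v) (3 - \<nu>) * rpow (sqrt E) (\<nu> - 2))" using False by (simp add: m_alt K_def p_def)
    also have "\<dots> \<le> p * M * (norm v powr (1 - 2 * p) * (L powr p * norm v powr (2 * p)))"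
      unfolding 2 using 1 p M_pos by (intro mult_left_mono) auto
    also have "norm v powr (1 - 2 * p) * (L powr p * norm v powr (2 * p)) = L powr p * (norm v powr (1 - 2 * p) * norm v powr (2 * p))"
      by simp
    also have "norm v powr (1 - 2 * p) * norm v powr (2 * p) = norm v powr (1 - 2 * p + 2 * p)" by (simp only: powr_add)
    also have "\<dots> = norm v" using v by simp
    also have "p * M * (L powr p * norm v) \<le> p * M * (L powr p * D)" using p M_pos norm_v by (intro mult_left_mono) auto
    also have "\<dots> = m_bar" using False by (simp add: m_bar_def p_def diff_divide_distrib)
    finally show ?thesis .
  qed
  define t where "t = gain_deriv \<nu> (m * g * model_exponent \<nu> / E) / m"
  note opt = optimal_step[OF nu m g0 E, folded t_def]
  have eE: "(e_FW f s y)\<^sup>2 = E" using E by (simp add: e_FW_def local_norm_def E_def)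
  have t_eq: "t_FW f X s M \<nu> y = t"
  proof -
    consider "\<nu> = 2" | "\<nu> = 3" | "\<nu> \<noteq> 2" "\<nu> \<noteq> 3" by blast
    then show ?thesis
    proof cases
      case 1
      then show ?thesis unfolding t_FW_def Let_def eE g_def[symmetric]
        by (simp add: t_def gain_deriv_def model_exponent_def m_def[unfolded 1] m_def mult_ac)
    next
      case 2
      have "0 < 1 + m * g / E" using m g0 E by (simp add: add_pos_pos)
      have "t = (1 - inverse (1 + m * g / E)) / m" using 2 \<open>0 < 1 + m * g / E\<close>
        by (simp add: t_def gain_deriv_def model_exponent_def powr_minus)
      also have "1 - inverse (1 + m * g / E) = m * g / (m * g + E)"
        using m g0 E add_pos_pos[OF mult_pos_pos[OF m g0] E] by (simp add: field_simps)
      also have "\<dots> / m = g / (m * g + E)" using m by simp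
      finally show ?thesis unfolding t_FW_def Let_def eE g_def[symmetric] m_def[symmetric] using 2 by simp
    next
      case 3
      have "- 1 / (p / k) = - (k / p)" for p k :: real by simp
      then have e: "- 1 / ((4 - \<nu>) / (\<nu> - 2)) = - ((\<nu> - 2) / (4 - \<nu>))" .
      show ?thesis unfolding t_FW_def Let_def eE g_def[symmetric] t_def gain_deriv_def model_exponent_def m_def[symmetric]
        using 3 by (simp only: if_False e) (simp add: mult.commute[of E])
    qed
  qed
  have \<alpha>_eq: "\<alpha> = min 1 t" by (simp add: \<alpha>_def alpha_FW_def t_eq)
  show \<alpha>0: "0 < \<alpha>" and \<alpha>1: "\<alpha> \<le> 1" using opt(1) by (auto simp: \<alpha>_eq)
  have seg: "y + r *\<^sub>R v \<in> X" if "0 \<le> r" "r \<le> 1" for r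
  proof -
    have "(1 - r) *\<^sub>R y + r *\<^sub>R s y \<in> X" using convex_X Gap_eq(1)[OF yX] yX that by (intro convexD) auto
    then show ?thesis by (simp add: v_def v_FW_def algebra_simps)
  qed
  have adm: "admissible \<nu> m \<alpha>" using admissible_mono[OF opt(2) m] by (simp add: \<alpha>_eq)
  have descent: "y + \<alpha> *\<^sub>R v \<in> edom f" "F (y + \<alpha> *\<^sub>R v) \<le> F y + \<alpha> * (gradient f y \<bullet> v) + quad y v * model_growth \<nu> m \<alpha>"
    by (rule descent_along_segment[where K = K];
        use yX seg v \<alpha>0 \<alpha>1 m adm in \<open>auto simp: K_def m_alt E_def v_def intro!: quad_pos\<close>)+
  show "y + \<alpha> *\<^sub>R v \<in> X \<inter> edom f" using descent(1) seg \<alpha>0 \<alpha>1 by auto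
  have F_le: "F (y + \<alpha> *\<^sub>R v) \<le> F y - (g * \<alpha> - E * model_growth \<nu> m \<alpha>)"
  proof -
    have "quad y v = E" by (simp add: E_def v_def)
    then show ?thesis using descent(2) unfolding gv by (simp add: mult.commute)
  qed
  show "(\<alpha> = 1 \<and> F (y + \<alpha> *\<^sub>R v) \<le> F y - Gap f X y / 2) \<or>
     (\<alpha> = t_FW f X s M \<nu> y \<and>
      F (y + \<alpha> *\<^sub>R v) \<le> F y - E / (m\<^sup>2 * model_exponent \<nu>) * gain \<nu> (m * Gap f X y * model_exponent \<nu> / E))"
  proof (cases "t \<le> 1")
    case True
    then have "\<alpha> = t" by (simp add: \<alpha>_eq)
    then show ?thesis using F_le opt(4) t_eq by (simp add: g_def)
  next
    case False
    then have \<alpha>: "\<alpha> = 1" by (simp add: \<alpha>_eq)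
    have "2 * model_growth \<nu> m 1 \<le> 1 * model_slope \<nu> m 1" using model_growth_bounds(3)[OF nu m, of 1 1] adm \<alpha> by auto
    also have "model_slope \<nu> m 1 \<le> model_slope \<nu> m t" using model_growth_bounds(2)[OF nu m opt(2), of 1] False by simp
    finally have "E * (2 * model_growth \<nu> m 1) \<le> E * model_slope \<nu> m t" using E by (intro mult_left_mono) auto
    then show ?thesis using F_le opt(3) \<alpha> by (simp add: g_def)
  qed
qed
end

section \<open>Iteration bounds\<close>

context frank_wolfe begin

context
  fixes \<epsilon> :: real and x :: "nat \<Rightarrow> real ^ 'n" and n :: nat
  assumes eps: "0 < \<epsilon>" and seq: "FWGSC_sequence f X s M \<nu> \<epsilon> x0 x"
    and above: "\<And>j. j < n \<Longrightarrow> \<epsilon> < F (x j) - F xstar"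
begin

text \<open>As long as the optimality gap exceeds \<open>\<epsilon>\<close>, so does the Frank-Wolfe gap, and the method has not stopped.\<close>
lemma iterates_in_level_set:
  "k \<le> n \<Longrightarrow> x k \<in> level_set f X x0"
  "k < n \<Longrightarrow> x (Suc k) = x k + alpha_FW f X s M \<nu> (x k) *\<^sub>R v_FW s (x k)"
proof -
  have *: "(\<forall>j\<le>k. x j \<in> level_set f X x0) \<and>
     (\<forall>j<k. x (Suc j) = x j + alpha_FW f X s M \<nu> (x j) *\<^sub>R v_FW s (x j))" if "k \<le> n" for k
    using that
  proof (induction k)
    case 0
    have "x 0 = x0" using seq by (simp add: FWGSC_sequence_def)
    then show ?case using x0 by (auto simp: level_set_def)
  next
    case (Suc k)
    then have IH: "\<And>j. j \<le> k \<Longrightarrow> x j \<in> level_set f X x0"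
      and IH2: "\<And>j. j < k \<Longrightarrow> x (Suc j) = x j + alpha_FW f X s M \<nu> (x j) *\<^sub>R v_FW s (x j)" by auto
    have gap: "\<epsilon> < Gap f X (x j)" if "j \<le> k" for j
      using above[of j] optimality_gap_le_Gap[of "x j"] IH[OF that] that Suc.prems by (force simp: level_set_def)
    then have eq: "x (Suc k) = x k + alpha_FW f X s M \<nu> (x k) *\<^sub>R v_FW s (x k)"
      using seq by (simp add: FWGSC_sequence_def)
    have xk: "x k \<in> level_set f X x0" and gk: "0 < Gap f X (x k)" using IH gap[of k] eps by auto
    note st = frank_wolfe_step[OF xk gk, folded eq]
    have "0 \<le> gain \<nu> (M * delta_FW f s \<nu> (x k) * Gap f X (x k) * model_exponent \<nu> / quad (x k) (v_FW s (x k)))"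
    proof -
      have "0 < model_exponent \<nu>" using nu by (auto simp: model_exponent_def)
      then have y: "0 \<le> M * delta_FW f s \<nu> (x k) * Gap f X (x k) * model_exponent \<nu> / quad (x k) (v_FW s (x k))" (is "0 \<le> ?y")
        using st(2,3) gk by simp
      have "0 \<le> gain \<nu> 1 * min ?y (?y\<^sup>2)" using gain_at_1_pos[OF nu] y by (intro mult_nonneg_nonneg) auto
      then show ?thesis using gain_lower_bound[OF nu y] by linarith
    qed
    then have "F (x (Suc k)) \<le> F (x k)"
      using st(10) gk st(2) nu by (smt (verit) divide_nonneg_nonneg mult_nonneg_nonneg model_exponent_def zero_le_power2)
    then have "x (Suc k) \<in> level_set f X x0" using st(9) xk by (auto simp: level_set_iff)
    then show ?case using IH IH2 eq by (auto simp: le_Suc_eq less_Suc_eq)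
  qed
  show "k \<le> n \<Longrightarrow> x k \<in> level_set f X x0" using * by blast
  show "k < n \<Longrightarrow> x (Suc k) = x k + alpha_FW f X s M \<nu> (x k) *\<^sub>R v_FW s (x k)" using *[of n] by blast
qed

lemma Gap_pos:
  assumes "k < n"
  shows "F (x k) - F xstar \<le> Gap f X (x k)" "0 < Gap f X (x k)"
proof -
  show "F (x k) - F xstar \<le> Gap f X (x k)"
    using optimality_gap_le_Gap[of "x k"] iterates_in_level_set(1)[of k] assms by (auto simp: level_set_def)
  then show "0 < Gap f X (x k)" using above[OF assms] eps by linarith
qed

lemma constants_pos:
  assumes "0 < n"
  shows "0 < D" "0 < m_bar"
proof -
  have st: "x 0 \<in> level_set f X x0" "0 < Gap f X (x 0)" using iterates_in_level_set(1)[of 0] Gap_pos(2)[OF assms] by auto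
  show "0 < D" by (rule frank_wolfe_step(5)[OF st])
  show "0 < m_bar" using frank_wolfe_step(3,4)[OF st] by linarith
qed

lemma iterations_le_generic:
  assumes n: "0 < n" and "\<nu> \<noteq> 3"
  shows "real n \<le> ln (c1 f X x0 M \<nu> / ((F (x 0) - F xstar) * c2 f X x0 M \<nu>)) / ln (1 - c1 f X x0 M \<nu>)
    + 1 / (c2 f X x0 M \<nu> * \<epsilon>)"
proof -
  define \<gamma> where "\<gamma> = gain \<nu> 1"
  have q: "0 < model_exponent \<nu>" using nu by (auto simp: model_exponent_def)
  have c1: "c1 f X x0 M \<nu> = min (1/2) (\<gamma> / m_bar)" by (simp add: c1_eq \<gamma>_def)
  have c2: "c2 f X x0 M \<nu> = model_exponent \<nu> * \<gamma> / (L * D\<^sup>2)" using assms by (simp add: c2_eq \<gamma>_def)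
  have \<gamma>: "0 < \<gamma>" using gain_at_1_pos[OF nu] by (simp add: \<gamma>_def)
  have c1p: "0 < c1 f X x0 M \<nu>" "c1 f X x0 M \<nu> \<le> 1/2" "c1 f X x0 M \<nu> \<le> \<gamma> / m_bar"
    using \<gamma> constants_pos[OF n] unfolding c1 by (auto simp: min_def)
  have c2p: "0 < c2 f X x0 M \<nu>" using \<gamma> q constants_pos[OF n] L_pos by (simp add: c2)
  show ?thesis
  proof (rule standard_iteration_bound[where h = "\<lambda>i. F (x i) - F xstar", OF c1p(1,2) c2p eps n above])
    fix i assume i: "i < n"
    define h g where "h = F (x i) - F xstar" and "g = Gap f X (x i)"
    have h: "0 < h" "h \<le> g" using above[OF i] eps Gap_pos[OF i] by (auto simp: h_def g_def)
    have xi: "x i \<in> level_set f X x0" using iterates_in_level_set(1) i by simp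
    note st = frank_wolfe_step[OF xi Gap_pos(2)[OF i], folded iterates_in_level_set(2)[OF i]]
    define m E where "m = M * delta_FW f s \<nu> (x i)" and "E = quad (x i) (v_FW s (x i))"
    have mE: "0 < m" "0 < E" "m \<le> m_bar" "E \<le> L * D\<^sup>2" using st(2,3,4,6) by (auto simp: m_def E_def)
    define y where "y = m * g * model_exponent \<nu> / E"
    have y: "0 \<le> y" using mE h q by (simp add: y_def)
    have "min (c1 f X x0 M \<nu> * h) (c2 f X x0 M \<nu> * h\<^sup>2) \<le> F (x i) - F (x (Suc i))"
      using st(10)
    proof
      assume *: "alpha_FW f X s M \<nu> (x i) = 1 \<and> F (x (Suc i)) \<le> F (x i) - Gap f X (x i) / 2"
      have "c1 f X x0 M \<nu> * h \<le> 1/2 * g" using c1p h by (intro mult_mono) auto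
      then show ?thesis using * unfolding g_def by linarith
    next
      assume *: "alpha_FW f X s M \<nu> (x i) = t_FW f X s M \<nu> (x i) \<and> F (x (Suc i)) \<le> F (x i) -
        quad (x i) (v_FW s (x i)) / ((M * delta_FW f s \<nu> (x i))\<^sup>2 * model_exponent \<nu>) *
        gain \<nu> (M * delta_FW f s \<nu> (x i) * Gap f X (x i) * model_exponent \<nu> / quad (x i) (v_FW s (x i)))"
      have "E / (m\<^sup>2 * model_exponent \<nu>) * (\<gamma> * min y (y\<^sup>2)) \<le> E / (m\<^sup>2 * model_exponent \<nu>) * gain \<nu> y"
        using gain_lower_bound[OF nu y] mE q by (intro mult_left_mono) (auto simp: \<gamma>_def)
      then have dec: "E / (m\<^sup>2 * model_exponent \<nu>) * (\<gamma> * min y (y\<^sup>2)) \<le> F (x i) - F (x (Suc i))"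
        using * unfolding y_def m_def E_def g_def by linarith
      have "min (c1 f X x0 M \<nu> * h) (c2 f X x0 M \<nu> * h\<^sup>2) \<le> E / (m\<^sup>2 * model_exponent \<nu>) * (\<gamma> * min y (y\<^sup>2))"
      proof (cases "y \<le> y\<^sup>2")
        case True
        have "c1 f X x0 M \<nu> * h \<le> \<gamma> / m_bar * g" using c1p h by (intro mult_mono) auto
        also have "\<dots> \<le> \<gamma> / m * g" using mE h \<gamma> constants_pos[OF n] by (intro mult_right_mono divide_left_mono) auto
        also have "\<dots> = E / (m\<^sup>2 * model_exponent \<nu>) * (\<gamma> * y)" using mE q by (simp add: y_def power2_eq_square)
        finally show ?thesis using True by (simp add: min_absorb1 min.coboundedI1)
      next
        case False
        have "c2 f X x0 M \<nu> * h\<^sup>2 \<le> (model_exponent \<nu> * \<gamma> / E) * g\<^sup>2"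
          unfolding c2 using mE h \<gamma> q constants_pos[OF n] L_pos by (intro mult_mono divide_left_mono power_mono) auto
        also have "\<dots> = E / (m\<^sup>2 * model_exponent \<nu>) * (\<gamma> * y\<^sup>2)" using mE q by (simp add: y_def power2_eq_square)
        finally show ?thesis using False by (simp add: min_absorb2 min.coboundedI2)
      qed
      then show ?thesis using dec by linarith
    qed
    then show "F (x (Suc i)) - F xstar \<le> F (x i) - F xstar -
        min (c1 f X x0 M \<nu> * (F (x i) - F xstar)) (c2 f X x0 M \<nu> * (F (x i) - F xstar)\<^sup>2)"
      by (simp add: h_def)
  qed
qed

text \<open>The sum is the mean of the squared distances from \<open>z\<close> to the points of the convex combination, in
  units of \<open>D\<^sup>2\<close>. The induction rests on
  \<open>|(1 - \<alpha>) a + \<alpha> b|\<^sup>2 = (1 - \<alpha>) |a|\<^sup>2 + \<alpha> |b|\<^sup>2 - \<alpha> (1 - \<alpha>) |a - b|\<^sup>2\<close>: the negative term is exactly what the spread gains.\<close>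
lemma spread_geometry:
  fixes w :: "nat \<Rightarrow> real"
  assumes D0: "0 < D" and T: "T + j \<le> n" and z: "z \<in> X"
  defines "w \<equiv> \<lambda>i. (norm (v_FW s (x i)))\<^sup>2 / D\<^sup>2"
  shows "(norm (x (T + j) - z))\<^sup>2 / D\<^sup>2 + spread (\<lambda>i. alpha_FW f X s M \<nu> (x i)) w T j \<le> 1"
  using T z
proof (induction j arbitrary: z)
  case 0
  have "x T \<in> X" using iterates_in_level_set(1)[of T] 0 by (auto simp: level_set_def)
  then have "(norm (x T - z))\<^sup>2 \<le> D\<^sup>2" using dist_le_D 0 by (intro power_mono) auto
  then show ?case using D0 by simp
next
  case (Suc j)
  let ?i = "T + j"
  have i: "?i < n" using Suc.prems by simp
  define \<alpha> v where "\<alpha> = alpha_FW f X s M \<nu> (x ?i)" and "v = v_FW s (x ?i)"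
  have xi: "x ?i \<in> level_set f X x0" using iterates_in_level_set(1) i by simp
  have \<alpha>: "0 < \<alpha>" "\<alpha> \<le> 1" using frank_wolfe_step(7,8)[OF xi Gap_pos(2)[OF i]] by (auto simp: \<alpha>_def)
  have sX: "s (x ?i) \<in> X" using Gap_eq(1)[of "x ?i"] xi by (auto simp: level_set_def)
  have "x (Suc ?i) - z = (x ?i - z) + \<alpha> *\<^sub>R v" using iterates_in_level_set(2)[OF i] by (simp add: \<alpha>_def v_def)
  moreover have "s (x ?i) - z = (x ?i - z) + v" by (simp add: v_def v_FW_def)
  ultimately have id: "(norm (x (Suc ?i) - z))\<^sup>2
      = (1 - \<alpha>) * (norm (x ?i - z))\<^sup>2 + \<alpha> * (norm (s (x ?i) - z))\<^sup>2 - \<alpha> * (1 - \<alpha>) * (norm v)\<^sup>2"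
    unfolding power2_norm_eq_inner by (simp add: inner_add_left inner_add_right inner_commute algebra_simps power2_eq_square)
  have "(norm (s (x ?i) - z))\<^sup>2 \<le> D\<^sup>2" using dist_le_D[OF sX] Suc.prems by (intro power_mono) auto
  then have "\<alpha> * ((norm (s (x ?i) - z))\<^sup>2 / D\<^sup>2) \<le> \<alpha> * 1" using D0 \<alpha> by (intro mult_left_mono) auto
  moreover have "(1 - \<alpha>) * ((norm (x ?i - z))\<^sup>2 / D\<^sup>2 + spread (\<lambda>i. alpha_FW f X s M \<nu> (x i)) w T j) \<le> (1 - \<alpha>) * 1"
    using Suc \<alpha> by (intro mult_left_mono) auto
  moreover have "(norm (x (Suc ?i) - z))\<^sup>2 / D\<^sup>2
      = (1 - \<alpha>) * ((norm (x ?i - z))\<^sup>2 / D\<^sup>2) + \<alpha> * ((norm (s (x ?i) - z))\<^sup>2 / D\<^sup>2) - \<alpha> * (1 - \<alpha>) * w ?i"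
    unfolding id by (simp add: w_def v_def add_divide_distrib diff_divide_distrib)
  moreover have "spread (\<lambda>i. alpha_FW f X s M \<nu> (x i)) w T (Suc j)
      = (1 - \<alpha>) * spread (\<lambda>i. alpha_FW f X s M \<nu> (x i)) w T j + \<alpha> * (1 - \<alpha>) * w ?i"
    by (simp add: \<alpha>_def algebra_simps)
  ultimately show ?case by (simp add: algebra_simps)
qed

text \<open>Rescaling gaps by \<open>L D\<^sup>2\<close> and lengths by \<open>D\<close> turns the method into the scalar recursion of
  \<open>amortized_iteration_bound\<close> with \<open>\<mu> = M \<surd>L D / 2\<close>.\<close>
lemma iterations_le_cubic:
  assumes n: "0 < n" and nu3: "\<nu> = 3"
  shows "real n \<le> ln (c1 f X x0 M \<nu> / ((F (x 0) - F xstar) * c2 f X x0 M \<nu>)) / ln (1 - c1 f X x0 M \<nu>)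
    + 1 / (c2 f X x0 M \<nu> * \<epsilon>)"
proof -
  define C where "C = L * D\<^sup>2"
  define \<mu> where "\<mu> = m_bar"
  have mu: "0 < \<mu>" and D0: "0 < D" using constants_pos[OF n] by (auto simp: \<mu>_def)
  have C: "0 < C" using D0 L_pos by (simp add: C_def)
  have mu_eq: "\<mu> = M / 2 * sqrt C" unfolding \<mu>_def m_bar_def
    using nu3 L_pos D0 by (simp add: C_def real_sqrt_mult powr_half_sqrt)
  define h g e w \<alpha> where "h = (\<lambda>i. (F (x i) - F xstar) / C)" and "g = (\<lambda>i. Gap f X (x i) / C)"
    and "e = (\<lambda>i. sqrt (quad (x i) (v_FW s (x i)) / C))" and "w = (\<lambda>i. (norm (v_FW s (x i)))\<^sup>2 / D\<^sup>2)"
    and "\<alpha> = (\<lambda>i. alpha_FW f X s M \<nu> (x i))"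
  have c1: "c1 f X x0 M \<nu> = min (1/2) ((1 - ln 2) / \<mu>)"
  proof -
    have "gain \<nu> 1 = 1 - ln 2" using nu3 by (simp add: gain_def)
    then show ?thesis by (simp add: c1_eq \<mu>_def)
  qed
  have c2: "c2 f X x0 M \<nu> = 2 * (1 - ln 2) / C" unfolding c2_eq C_def using nu3 by (simp add: gain_def model_exponent_def)
  have "real n \<le> ln (min (1/2) ((1 - ln 2) / \<mu>) / (h 0 * (2 * (1 - ln 2)))) / ln (1 - min (1/2) ((1 - ln 2) / \<mu>))
      + 1 / (2 * (1 - ln 2) * (\<epsilon> / C))"
  proof (rule amortized_iteration_bound[OF mu _ n, where g = g and e = e and w = w and \<alpha> = \<alpha>])
    show "0 < \<epsilon> / C" using eps C by simp
  next
    fix T j assume Tj: "T + j < n"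
    have xi: "x (T + j) \<in> level_set f X x0" using iterates_in_level_set(1) Tj by simp
    then have "s (x (T + j)) \<in> X" using Gap_eq(1)[of "x (T + j)"] by (auto simp: level_set_def)
    then show "w (T + j) + spread \<alpha> w T j \<le> 1"
      using spread_geometry[OF D0, of T j "s (x (T + j))"] Tj
      by (simp add: w_def \<alpha>_def v_FW_def norm_minus_commute)
  next
    fix i assume i: "i < n"
    have xi: "x i \<in> level_set f X x0" using iterates_in_level_set(1) i by simp
    note st = frank_wolfe_step[OF xi Gap_pos(2)[OF i], folded iterates_in_level_set(2)[OF i]]
    show "\<epsilon> / C < h i" using above[OF i] C by (simp add: h_def divide_strict_right_mono)
    show "h i \<le> g i" using Gap_pos(1)[OF i] C by (simp add: h_def g_def divide_right_mono)
    show "0 \<le> \<alpha> i \<and> \<alpha> i \<le> 1" using st(7,8) by (simp add: \<alpha>_def)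
    define G E where "G = Gap f X (x i)" and "E = quad (x i) (v_FW s (x i))"
    have E: "0 < E" using st(2) by (simp add: E_def)
    have G: "0 < G" using Gap_pos(2)[OF i] by (simp add: G_def)
    have e_pos: "0 < e i" and e2: "(e i)\<^sup>2 = E / C" using E C by (auto simp: e_def E_def)
    have "E / C \<le> L * (norm (v_FW s (x i)))\<^sup>2 / C" using quad_le[OF xi] C by (simp add: E_def divide_right_mono)
    also have "\<dots> = w i" using L_pos by (simp add: w_def C_def)
    finally show "0 < e i \<and> (e i)\<^sup>2 \<le> w i" using e_pos e2 by simp
    define m where "m = M * delta_FW f s \<nu> (x i)"
    have m_eq: "m = \<mu> * e i"
      unfolding m_def delta_FW_alt mu_eq e_def E_def[symmetric]
      using nu3 E C by (simp add: rpow_def real_sqrt_divide)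
    have m: "0 < m" using mu e_pos by (simp add: m_eq)
    have y: "m * G / E = \<mu> * g i / e i"
    proof -
      have "E = C * (e i * e i)" using e2 C by (simp add: power2_eq_square)
      then show ?thesis using e_pos C by (simp add: m_eq g_def G_def)
    qed
    have t: "t_FW f X s M \<nu> (x i) = g i / ((e i)\<^sup>2 + \<mu> * e i * g i)"
    proof -
      have "(e_FW f s (x i))\<^sup>2 = E" using E by (simp add: e_FW_def local_norm_def E_def)
      then have "t_FW f X s M \<nu> (x i) = G / (m * G + E)"
        using nu3 by (simp add: t_FW_def Let_def m_def G_def)
      also have "\<dots> = (G / C) / ((m * G + E) / C)" using C by simp
      also have "(m * G + E) / C = (e i)\<^sup>2 + \<mu> * e i * g i" by (simp add: e2 m_eq g_def G_def add_divide_distrib)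
      finally show ?thesis by (simp add: g_def G_def)
    qed
    from st(10)
    show "(\<alpha> i = 1 \<and> h (Suc i) \<le> h i - g i / 2) \<or>
      (\<alpha> i = g i / ((e i)\<^sup>2 + \<mu> * e i * g i) \<and>
       h (Suc i) \<le> h i - (\<mu> * g i / e i - ln (1 + \<mu> * g i / e i)) / \<mu>\<^sup>2)"
    proof
      assume *: "alpha_FW f X s M \<nu> (x i) = 1 \<and> F (x (Suc i)) \<le> F (x i) - Gap f X (x i) / 2"
      then have "(F (x (Suc i)) - F xstar) / C \<le> (F (x i) - F xstar - Gap f X (x i) / 2) / C"
        using C by (intro divide_right_mono) auto
      then show ?thesis using * by (simp add: h_def g_def \<alpha>_def diff_divide_distrib)
    next
      assume *: "alpha_FW f X s M \<nu> (x i) = t_FW f X s M \<nu> (x i) \<and> F (x (Suc i)) \<le> F (x i) -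
        quad (x i) (v_FW s (x i)) / ((M * delta_FW f s \<nu> (x i))\<^sup>2 * model_exponent \<nu>) *
        gain \<nu> (M * delta_FW f s \<nu> (x i) * Gap f X (x i) * model_exponent \<nu> / quad (x i) (v_FW s (x i)))"
      have "F (x (Suc i)) \<le> F (x i) - E / m\<^sup>2 * gain \<nu> (m * G / E)"
        using * nu3 by (simp add: E_def m_def G_def model_exponent_def)
      then have "(F (x (Suc i)) - F xstar) / C \<le> (F (x i) - F xstar - E / m\<^sup>2 * gain \<nu> (m * G / E)) / C"
        using C by (intro divide_right_mono) auto
      also have "\<dots> = h i - (E / C) / m\<^sup>2 * gain \<nu> (m * G / E)" by (simp add: h_def diff_divide_distrib)
      also have "(E / C) / m\<^sup>2 = 1 / \<mu>\<^sup>2" using e2[symmetric] e_pos by (simp add: m_eq power_mult_distrib)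
      finally show ?thesis using * nu3 t y by (simp add: h_def \<alpha>_def gain_def)
    qed
  qed
  moreover have "h 0 * (2 * (1 - ln 2)) = (F (x 0) - F xstar) * c2 f X x0 M \<nu>" by (simp add: h_def c2)
  moreover have "2 * (1 - ln 2) * (\<epsilon> / C) = c2 f X x0 M \<nu> * \<epsilon>" by (simp add: c2)
  ultimately show ?thesis by (simp only: c1)
qed

lemma iterations_le:
  assumes "0 < n"
  shows "real n \<le> ln (c1 f X x0 M \<nu> / ((F (x 0) - F xstar) * c2 f X x0 M \<nu>)) / ln (1 - c1 f X x0 M \<nu>)
    + 1 / (c2 f X x0 M \<nu> * \<epsilon>)"
  using iterations_le_generic[OF assms] iterations_le_cubic[OF assms] by blast

end

text \<open>If the feasible set is a point, then both constants vanish and so does the bound.\<close>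
lemma bound_nonneg:
  assumes eps: "0 < \<epsilon>" and h0: "c1 f X x0 M \<nu> / c2 f X x0 M \<nu> \<le> h0"
  shows "0 \<le> ln (c1 f X x0 M \<nu> / (h0 * c2 f X x0 M \<nu>)) / ln (1 - c1 f X x0 M \<nu>) + 1 / (c2 f X x0 M \<nu> * \<epsilon>)"
proof (cases "D = 0")
  case True
  then have "c2 f X x0 M \<nu> = 0" by (simp add: c2_eq)
  then show ?thesis by simp
next
  case False
  then have D: "0 < D" using dist_le_D[of x0 x0] x0 by simp
  then have m: "0 < m_bar" using M_pos L_pos nu by (auto simp: m_bar_def)
  have q: "0 < model_exponent \<nu>" using nu by (auto simp: model_exponent_def)
  have a: "0 < c1 f X x0 M \<nu>" "c1 f X x0 M \<nu> \<le> 1/2" using m gain_at_1_pos[OF nu] unfolding c1_eq by (auto simp: min_def)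
  have b: "0 < c2 f X x0 M \<nu>" using D L_pos q gain_at_1_pos[OF nu] by (simp add: c2_eq)
  have "0 < h0" using h0 divide_pos_pos[OF a(1) b] by linarith
  moreover have "c1 f X x0 M \<nu> \<le> h0 * c2 f X x0 M \<nu>" using h0 b by (simp add: pos_divide_le_eq)
  ultimately have "ln (c1 f X x0 M \<nu> / (h0 * c2 f X x0 M \<nu>)) \<le> 0" using a b by simp
  moreover have "ln (1 - c1 f X x0 M \<nu>) \<le> 0" using a by simp
  ultimately have "0 \<le> ln (c1 f X x0 M \<nu> / (h0 * c2 f X x0 M \<nu>)) / ln (1 - c1 f X x0 M \<nu>)" by (rule divide_nonpos_nonpos)
  then show ?thesis using b eps by simp
qed
end

theorem theorem4p8:
  fixes f :: "real ^ 'n \<Rightarrow> ereal" and X :: "(real ^ 'n) set"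
    and s :: "real ^ 'n \<Rightarrow> real ^ 'n" and x :: "nat \<Rightarrow> real ^ 'n"
    and x0 xstar :: "real ^ 'n" and M \<nu> \<epsilon> :: real
  assumes "2 \<le> \<nu>" "\<nu> \<le> 3" "M > 0"
    and "f \<in> gsc_class M \<nu>"
    and "convex X" "compact X"
    and "is_arg_min f (\<lambda>y. y \<in> X) xstar"
    and "continuous_on (X \<inter> edom f) (hessian f)"
    and "\<forall>y \<in> X \<inter> edom f. pos_def (hessian f y)"
    and "linear_minimizer f X s"
    and "x0 \<in> X \<inter> edom f"
    and "\<epsilon> > 0"
    and "FWGSC_sequence f X s M \<nu> \<epsilon> x0 x"
  shows "let h = (\<lambda>k. f (x k) - f xstar);
             h0 = real_of_ereal (h 0);
             a = c1 f X x0 M \<nu>;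
             b = c2 f X x0 M \<nu>;
             bound = ln (a / (h0 * b)) / ln (1 - a) + 1 / (b * \<epsilon>)
         in (\<epsilon> < h0 \<or> a / b \<le> h0 \<longrightarrow> N_eps h \<epsilon> \<le> ereal bound) \<and>
            N_eps h \<epsilon> \<le> ereal (max 0 bound)"
proof -
  interpret frank_wolfe f M \<nu> X s xstar x0 using assms by unfold_locales auto
  define h where "h = (\<lambda>k. f (x k) - f xstar)"
  define B where "B = ln (c1 f X x0 M \<nu> / ((F (x 0) - F xstar) * c2 f X x0 M \<nu>)) / ln (1 - c1 f X x0 M \<nu>)
    + 1 / (c2 f X x0 M \<nu> * \<epsilon>)"
  have seq: "FWGSC_sequence f X s M \<nu> \<epsilon> x0 x" and eps: "0 < \<epsilon>" using assms by auto
  have fstar: "f xstar = ereal (F xstar)" using ereal_F xstar_in by blast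
  have h_eq: "h k = ereal (F (x k) - F xstar)" if "x k \<in> edom f" for k
    using ereal_F[OF that] fstar by (metis h_def ereal_minus(1))
  have "x 0 = x0" using seq by (simp add: FWGSC_sequence_def)
  then have h0: "real_of_ereal (h 0) = F (x 0) - F xstar" using h_eq[of 0] x0 by simp
  have bounded: "real n \<le> B" if "0 < n" "\<And>j. j < n \<Longrightarrow> \<epsilon> < F (x j) - F xstar" for n
    unfolding B_def by (rule iterations_le[OF eps seq that(2,1)])
  have "\<exists>k. \<not> \<epsilon> < F (x k) - F xstar"
  proof (rule ccontr)
    assume "\<nexists>k. \<not> \<epsilon> < F (x k) - F xstar"
    then have "real (Suc (nat \<lceil>B\<rceil>)) \<le> B" by (intro bounded) auto
    then show False by linarith
  qed
  then obtain N where N: "\<not> \<epsilon> < F (x N) - F xstar" "\<And>j. j < N \<Longrightarrow> \<epsilon> < F (x j) - F xstar"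
    using exists_least_iff[of "\<lambda>k. \<not> \<epsilon> < F (x k) - F xstar"] by blast
  have "x N \<in> level_set f X x0" using iterates_in_level_set(1)[OF eps seq N(2), of N N] by blast
  then have "h N \<le> ereal \<epsilon>" using h_eq[of N] N(1) by (simp add: level_set_iff)
  then have NN: "N_eps h \<epsilon> \<le> ereal (real N)" unfolding N_eps_def by (intro INF_lower) simp
  have max: "N_eps h \<epsilon> \<le> ereal (max 0 B)"
  proof (cases "N = 0")
    case True
    then show ?thesis using NN by (simp add: order_trans)
  next
    case False
    then have "real N \<le> B" using bounded[of N] N(2) by simp
    then show ?thesis using NN by (meson ereal_less_eq(3) max.coboundedI2 order_trans)
  qed
  moreover have "N_eps h \<epsilon> \<le> ereal B" if "\<epsilon> < F (x 0) - F xstar \<or> c1 f X x0 M \<nu> / c2 f X x0 M \<nu> \<le> F (x 0) - F xstar"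
    using that
  proof
    assume "\<epsilon> < F (x 0) - F xstar"
    then have "N \<noteq> 0" using N(1) by metis
    then have "real N \<le> B" using bounded[of N] N(2) by (simp add: neq0_conv)
    then show ?thesis using NN by (meson ereal_less_eq(3) order_trans)
  next
    assume "c1 f X x0 M \<nu> / c2 f X x0 M \<nu> \<le> F (x 0) - F xstar"
    then have "0 \<le> B" unfolding B_def by (rule bound_nonneg[OF eps])
    then show ?thesis using max by (simp add: max_absorb2)
  qed
  ultimately show ?thesis unfolding Let_def h_def[symmetric] h0 B_def by blast
qed

end
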